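(* There exists an absolute constant $A$, $1\le A<\infty$, such that for every measurable set $E\subset\mathbb{R}$ with $\operatorname{mes}E<\infty$ and every $x\in L^2(E)$ the inequalities $$\Vert\mathscr{F}_Ex\Vert^2\le\big(1-A^{-1}e^{-A(\operatorname{mes}E)^2}\big)\Vert x\Vert^2,\qquad \Vert\mathscr{F}_E^{\ast}x\Vert^2\le\big(1-A^{-1}e^{-A(\operatorname{mes}E)^2}\big)\Vert x\Vert^2$$ hold, where $\Vert\cdot\Vert$ is the norm of $L^2(E)$. (The constant $A$ depends neither on $x$ nor on $E$.)
   Context: $\operatorname{mes}$ denotes Lebesgue measure on $\mathbb{R}$. For a measurable set $E\subset\mathbb{R}$ with $0<\operatorname{mes}E\le\infty$, $L^2(E)$ is the Hilbert space of complex-valued square-integrable functions on $E$ with scalar product $\int_E x(t)\overline{y(t)}\,dt$. The truncated Fourier operator $\mathscr{F}_E:L^2(E)\to L^2(E)$ is $(\mathscr{F}_Ex)(t)=\frac{1}{\sqrt{2\pi}}\int_E e^{it\xi}x(\xi)\,d\xi$, $t\in E$. Its adjoint is $(\mathscr{F}_E^{\ast}x)(t)=\frac{1}{\sqrt{2\pi}}\int_E e^{-it\xi}x(\xi)\,d\xi$, $t\in E$. *)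

theory Defs
  imports "HOL-Analysis.Analysis"
begin

text \<open>
  An element of L2(E) is represented by a function on the real line of which only the values on
  \<open>E\<close> matter; the norm does not distinguish representatives that agree almost everywhere on \<open>E\<close>.
\<close>

definition L2 :: "real set \<Rightarrow> (real \<Rightarrow> complex) set" where
  "L2 E = {x. set_borel_measurable lebesgue E x \<and>
              set_integrable lebesgue E (\<lambda>t. (cmod (x t))\<^sup>2)}"

definition L2_norm :: "real set \<Rightarrow> (real \<Rightarrow> complex) \<Rightarrow> real" where
  "L2_norm E x = sqrt (LINT t:E|lebesgue. (cmod (x t))\<^sup>2)"

text \<open>
  For \<open>E\<close> of finite measure, L2(E) is contained in L1(E), so that the integrals below converge
  absolutely. For \<open>E\<close> of infinite measure these formulas would need the usual extension by
  continuity; that case is not used.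
\<close>

definition truncated_fourier :: "real set \<Rightarrow> (real \<Rightarrow> complex) \<Rightarrow> real \<Rightarrow> complex" where
  "truncated_fourier E x t =
     complex_of_real (1 / sqrt (2 * pi)) *
       (LINT \<xi>:E|lebesgue. exp (\<i> * complex_of_real (t * \<xi>)) * x \<xi>)"

definition truncated_fourier_adj :: "real set \<Rightarrow> (real \<Rightarrow> complex) \<Rightarrow> real \<Rightarrow> complex" where
  "truncated_fourier_adj E x t =
     complex_of_real (1 / sqrt (2 * pi)) *
       (LINT \<xi>:E|lebesgue. exp (- \<i> * complex_of_real (t * \<xi>)) * x \<xi>)"

text \<open>
  Well-definedness: a Bochner integral of a non-integrable function is 0 by convention, so the
  following facts are needed for the integrals above, and for the norms of the transforms, to
  have their intended meaning.
\<close>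

lemma L2_set_integrable:
  assumes "E \<in> sets lebesgue" "emeasure lebesgue E < \<infinity>" "x \<in> L2 E"
  shows "set_integrable lebesgue E x"
proof -
  have m: "set_borel_measurable lebesgue E x"
    and i: "set_integrable lebesgue E (\<lambda>t. (cmod (x t))\<^sup>2)"
    using assms(3) by (auto simp: L2_def)
  have one: "set_integrable lebesgue E (\<lambda>t. 1::real)"
    using assms(1,2) by (simp add: set_integrable_def)
  have "set_integrable lebesgue E (\<lambda>t. 1 + (cmod (x t))\<^sup>2)"
    by (rule set_integral_add(1)[OF one i])
  then show ?thesis
  proof (rule set_integrable_bound)
    show "set_borel_measurable lebesgue E x" by (rule m)
    have "u \<le> 1 + u\<^sup>2" for u :: real
      using zero_le_power2[of "u - 1/2"] by (simp add: power2_eq_square algebra_simps)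
    then show "AE t in lebesgue. t \<in> E \<longrightarrow> norm (x t) \<le> norm (1 + (cmod (x t))\<^sup>2)"
      by (auto simp: abs_of_nonneg)
  qed
qed

lemma fourier_kernel_set_integrable:
  assumes "E \<in> sets lebesgue" "emeasure lebesgue E < \<infinity>" "x \<in> L2 E"
  shows "set_integrable lebesgue E (\<lambda>\<xi>. exp (\<i> * complex_of_real (s * \<xi>)) * x \<xi>)"
proof (rule set_integrable_bound[OF L2_set_integrable[OF assms]])
  have "(\<lambda>\<xi>. exp (\<i> * complex_of_real (s * \<xi>))) \<in> borel_measurable lebesgue"
    by (intro borel_measurable_continuous_onI measurable_completion) 
       (auto intro!: continuous_intros)
  moreover have "(\<lambda>\<xi>. indicator E \<xi> *\<^sub>R x \<xi>) \<in> borel_measurable lebesgue"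
    using assms(3) by (simp add: L2_def set_borel_measurable_def)
  ultimately have "(\<lambda>\<xi>. exp (\<i> * complex_of_real (s * \<xi>)) * (indicator E \<xi> *\<^sub>R x \<xi>))
      \<in> borel_measurable lebesgue"
    by (rule borel_measurable_times)
  then show "set_borel_measurable lebesgue E (\<lambda>\<xi>. exp (\<i> * complex_of_real (s * \<xi>)) * x \<xi>)"
    by (simp add: set_borel_measurable_def)
qed (simp add: norm_mult)

lemma truncated_fourier_adj_eq: "truncated_fourier_adj E x t = truncated_fourier E x (- t)"
  by (simp add: truncated_fourier_def truncated_fourier_adj_def)

lemma continuous_on_truncated_fourier:
  assumes "E \<in> sets lebesgue" "emeasure lebesgue E < \<infinity>" "x \<in> L2 E"
  shows "continuous_on UNIV (truncated_fourier E x)"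
proof -
  have "((\<lambda>t. LINT \<xi>:E|lebesgue. exp (\<i> * complex_of_real (t * \<xi>)) * x \<xi>) \<longlongrightarrow>
         (LINT \<xi>:E|lebesgue. exp (\<i> * complex_of_real (a * \<xi>)) * x \<xi>)) (at a)" for a :: real
    unfolding set_lebesgue_integral_def tendsto_at_iff_sequentially comp_def
  proof (intro allI impI)
    fix X :: "nat \<Rightarrow> real" assume X: "X \<longlonglongrightarrow> a"
    show "(\<lambda>n. LINT \<xi>|lebesgue. indicator E \<xi> *\<^sub>R (exp (\<i> * complex_of_real (X n * \<xi>)) * x \<xi>))
        \<longlonglongrightarrow> (LINT \<xi>|lebesgue. indicator E \<xi> *\<^sub>R (exp (\<i> * complex_of_real (a * \<xi>)) * x \<xi>))"
    proof (rule integral_dominated_convergence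
        [where w = "\<lambda>\<xi>. norm (indicator E \<xi> *\<^sub>R x \<xi>)"])
      show "integrable lebesgue (\<lambda>\<xi>. norm (indicator E \<xi> *\<^sub>R x \<xi>))"
        using L2_set_integrable[OF assms] unfolding set_integrable_def
        by (rule integrable_norm)
      show "AE \<xi> in lebesgue. (\<lambda>n. indicator E \<xi> *\<^sub>R (exp (\<i> * complex_of_real (X n * \<xi>)) * x \<xi>))
          \<longlonglongrightarrow> indicator E \<xi> *\<^sub>R (exp (\<i> * complex_of_real (a * \<xi>)) * x \<xi>)"
        by (intro AE_I2 tendsto_intros X)
    qed (use fourier_kernel_set_integrable[OF assms] in
          \<open>auto simp: set_integrable_def norm_mult intro: borel_measurable_integrable\<close>)
  qed
  then show ?thesis
    unfolding truncated_fourier_def continuous_on_def by (auto intro!: tendsto_intros)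
qed

lemma norm_truncated_fourier_le:
  assumes "E \<in> sets lebesgue" "emeasure lebesgue E < \<infinity>" "x \<in> L2 E"
  shows "cmod (truncated_fourier E x t) \<le> 1 / sqrt (2 * pi) * (LINT \<xi>:E|lebesgue. cmod (x \<xi>))"
proof -
  have "cmod (LINT \<xi>:E|lebesgue. exp (\<i> * complex_of_real (t * \<xi>)) * x \<xi>)
      \<le> (LINT \<xi>:E|lebesgue. cmod (exp (\<i> * complex_of_real (t * \<xi>)) * x \<xi>))"
    by (rule set_integral_norm_bound[OF fourier_kernel_set_integrable[OF assms]])
  then show ?thesis
    by (simp add: truncated_fourier_def norm_mult norm_divide divide_right_mono)
qed

lemma bounded_continuous_in_L2:
  assumes "E \<in> sets lebesgue" "emeasure lebesgue E < \<infinity>"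
    and c: "continuous_on UNIV y" and B: "\<And>t. cmod (y t) \<le> B"
  shows "y \<in> L2 E"
proof -
  have ym: "y \<in> borel_measurable lebesgue"
    using borel_measurable_continuous_onI[OF c] by (auto intro: measurable_completion)
  have "set_integrable lebesgue E (\<lambda>t. B\<^sup>2)"
    using assms(1,2) by (simp add: set_integrable_def)
  then have "set_integrable lebesgue E (\<lambda>t. (cmod (y t))\<^sup>2)"
  proof (rule set_integrable_bound)
    show "set_borel_measurable lebesgue E (\<lambda>t. (cmod (y t))\<^sup>2)"
      using ym assms(1) by (simp add: set_borel_measurable_def)
  qed (use B in \<open>auto intro!: power_mono\<close>)
  then show ?thesis
    using ym assms(1) by (simp add: L2_def set_borel_measurable_def)
qed

lemma truncated_fourier_in_L2:
  assumes "E \<in> sets lebesgue" "emeasure lebesgue E < \<infinity>" "x \<in> L2 E"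
  shows "truncated_fourier E x \<in> L2 E"
  by (rule bounded_continuous_in_L2[OF assms(1,2) continuous_on_truncated_fourier[OF assms]
        norm_truncated_fourier_le[OF assms]])

lemma truncated_fourier_adj_in_L2:
  assumes "E \<in> sets lebesgue" "emeasure lebesgue E < \<infinity>" "x \<in> L2 E"
  shows "truncated_fourier_adj E x \<in> L2 E"
proof (rule bounded_continuous_in_L2[OF assms(1,2)])
  show "continuous_on UNIV (truncated_fourier_adj E x)"
    unfolding truncated_fourier_adj_eq
    by (rule continuous_on_compose2[OF continuous_on_truncated_fourier[OF assms]])
       (auto intro: continuous_intros)
  show "\<And>t. cmod (truncated_fourier_adj E x t)
      \<le> 1 / sqrt (2 * pi) * (LINT \<xi>:E|lebesgue. cmod (x \<xi>))"
    unfolding truncated_fourier_adj_eq by (rule norm_truncated_fourier_le[OF assms])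
qed

end

theory Submission
  imports Defs "HOL-Complex_Analysis.Complex_Analysis"
    "HOL-Computational_Algebra.Fundamental_Theorem_Algebra"
begin

text \<open>
  This is Nazarov's uncertainty principle for a function \<open>f\<close> supported in \<open>E\<close> and a frequency set
  \<open>\<Sigma>\<close>, here with \<open>\<Sigma> = E\<close>. Periodizing a random dilate of \<open>f\<close> with period between \<open>4 |E|\<close> and \<open>8 |E|\<close> produces a
  function on the circle that vanishes on a set of measure at least \<open>3/4\<close>. Its Fourier
  coefficients are samples of the Fourier transform of \<open>f\<close> along a random progression; on average only
  \<open>O(|E| |\<Sigma>|)\<close> of the nonzero sample points fall into \<open>\<Sigma>\<close>, and the samples outside \<open>\<Sigma>\<close>
  have square sum \<open>O(|E| D)\<close>, where \<open>D\<close> is the energy of the transform outside \<open>\<Sigma>\<close>. So on the zero set a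
  trigonometric polynomial with \<open>n = O(1 + |E| |\<Sigma>|)\<close> frequencies is as small as its
  remainder, and the Turan--Nazarov inequality bounds its zeroth coefficient at the price of a
  factor \<open>exp (O(n))\<close>. Modulating \<open>f\<close> bounds the transform at every point, and integration over
  \<open>\<Sigma>\<close> together with the Plancherel inequality gives the theorem.

  For the Turan--Nazarov inequality one passes from a polynomial \<open>p\<close> of degree \<open>d\<close> with \<open>n\<close> nonzero
  coefficients to \<open>z p'(z) / d\<close> or \<open>p - z p'(z) / d\<close>, each of which has a coefficient less. The
  absolute coefficient sums of the two add up to that of \<open>p\<close>, so one of them loses at most a
  factor 2. The quotient by \<open>p\<close> is a logarithmic derivative, hence up to reflection a sum of
  kernels with values in a half plane, and its square root has bounded mean on the circle.
\<close>

subsection \<open>Sums of Moebius kernels on the unit circle\<close>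


text \<open>The solutions are absent or lie in one coset of the integers, hence form a countable
  set. This discards the poles of kernels on the circle and the zeros of a polynomial there.\<close>

lemma AE_cis_neq: "AE t in lborel. cis (2 * pi * t) \<noteq> c"
proof (cases "\<exists>s. cis (2 * pi * s) = c")
  case True
  then obtain s where s: "cis (2 * pi * s) = c" by blast
  have "{t. cis (2 * pi * t) = c} \<subseteq> range (\<lambda>k::int. s + k)"
  proof
    fix t assume "t \<in> {t. cis (2 * pi * t) = c}"
    then have "exp (\<i> * complex_of_real (2 * pi * t)) = exp (\<i> * complex_of_real (2 * pi * s))"
      using s by (simp add: cis_conv_exp)
    then obtain n :: int where
      "\<i> * complex_of_real (2 * pi * t) = \<i> * complex_of_real (2 * pi * s) + of_int (2 * n) * of_real pi * \<i>"
      by (auto simp: exp_eq)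
    then have "Im (\<i> * complex_of_real (2 * pi * t)) = Im (\<i> * complex_of_real (2 * pi * s) + of_int (2 * n) * of_real pi * \<i>)"
      by simp
    then have "pi * t = pi * (s + n)" by (simp add: algebra_simps)
    then have "t = s + n" using pi_neq_zero by (metis mult_left_cancel)
    then show "t \<in> range (\<lambda>k::int. s + k)" by blast
  qed
  then have "countable {t. cis (2 * pi * t) = c}"
    by (rule countable_subset) simp
  then show ?thesis
    by (intro AE_I'[OF countable_imp_null_set_lborel]) auto
qed auto

text \<open>The principal root of a number in the closed right half plane has argument at most pi /
  4 in modulus, and in that sector the real part is at least the modulus divided by sqrt 2.\<close>

lemma Re_csqrt_ge:
  assumes "0 \<le> Re w"
  shows "sqrt (cmod w) \<le> sqrt 2 * Re (csqrt w)"
proof -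
  have "cmod w \<le> 2 * (Re (csqrt w))\<^sup>2"
    using assms by (simp add: abs_of_nonneg)
  then have "sqrt (cmod w) \<le> sqrt (2 * (Re (csqrt w))\<^sup>2)"
    by (rule real_sqrt_le_mono)
  also have "\<dots> = sqrt 2 * \<bar>Re (csqrt w)\<bar>"
    by (simp add: real_sqrt_mult)
  also have "\<bar>Re (csqrt w)\<bar> = Re (csqrt w)"
    using csqrt_principal[of w] by auto
  finally show ?thesis .
qed

lemma circle_mean_value:
  assumes "f holomorphic_on ball 0 1" "0 < r" "r < 1"
  shows "((\<lambda>t. f (of_real r * cis (2 * pi * t))) has_integral f 0) {0..1}"
proof -
  have "((\<lambda>u. f u / (u - 0)) has_contour_integral 2 * of_real pi * \<i> * f 0) (circlepath 0 r)"
    using assms by (intro Cauchy_integral_circlepath_simple)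
      (auto intro: holomorphic_on_subset)
  then have "((\<lambda>t. f (circlepath 0 r t) / circlepath 0 r t * vector_derivative (circlepath 0 r) (at t))
      has_integral 2 * of_real pi * \<i> * f 0) {0..1}"
    by (simp add: has_contour_integral)
  then have "((\<lambda>t. (2 * of_real pi * \<i>) * f (of_real r * cis (2 * pi * t))) has_integral 2 * of_real pi * \<i> * f 0) {0..1}"
    unfolding vector_derivative_circlepath
    using assms by (simp add: circlepath cis_conv_exp field_simps)
  from has_integral_mult_right[OF this, of "1 / (2 * of_real pi * \<i>)"] show ?thesis by simp
qed

text \<open>Each kernel has positive real part in the open disc, hence so has their sum
  \<open>G\<close>, and \<open>csqrt (G z)\<close> is holomorphic there. The modulus of this root is
  at most sqrt 2 times its real part, whose mean over a circle is its value at 0, where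
  \<open>G\<close> counts the kernels. The exponent 1/2 matters: a kernel with
  \<open>cmod a = 1\<close> is not integrable on the unit circle.\<close>

lemma nn_integral_sqrt_sum_reciprocals:
  assumes "\<And>a. a \<in> set as \<Longrightarrow> cmod a \<le> 1"
  shows "(\<integral>\<^sup>+t\<in>{0..1}. ennreal (sqrt (cmod (\<Sum>a\<leftarrow>as. 1 / (1 - a * cis (2 * pi * t))))) \<partial>lborel)
    \<le> ennreal (sqrt 2 * sqrt (length as))"
proof (cases "as = []")
  case False
  define G where "G z = (\<Sum>a\<leftarrow>as. 1 / (1 - a * z))" for z :: complex
  have Re_pos: "0 < Re (1 - a * z)" if "a \<in> set as" "cmod z < 1" for a z
  proof -
    have "cmod (a * z) < 1"
      using assms[OF that(1)] that(2) mult_right_mono[of "cmod a" 1 "cmod z"] by (simp add: norm_mult)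
    then show ?thesis using complex_Re_le_cmod[of "a * z"] by simp
  qed
  have ne: "1 - a * z \<noteq> 0" if "a \<in> set as" "cmod z < 1" for a z
    using Re_pos[OF that] by fastforce
  have Re_inv_pos: "0 < Re (1 / (1 - a * z))" if "a \<in> set as" "cmod z < 1" for a z
    unfolding Re_divide using Re_pos[OF that]
    by (simp only: one_complex.simps mult_1 mult_zero_left add_0_right)
       (auto intro!: divide_pos_pos add_pos_nonneg)
  have sum_Re: "Re (G z) = (\<Sum>a\<leftarrow>as. Re (1 / (1 - a * z)))" for z
    unfolding G_def by (induction as) auto
  have G_pos: "0 < Re (G z)" if "cmod z < 1" for z
  proof -
    have "0 < (\<Sum>b\<leftarrow>bs. Re (1 / (1 - b * z)))" if "bs \<noteq> []" "set bs \<subseteq> set as" for bs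
      using that
    proof (induction bs rule: list_nonempty_induct)
      case (single b)
      then show ?case using Re_inv_pos[of b z] \<open>cmod z < 1\<close> by simp
    next
      case (cons b bs)
      then show ?case using Re_inv_pos[of b z] \<open>cmod z < 1\<close>
        by (auto intro!: add_pos_pos)
    qed
    from this[of as] False show ?thesis by (simp add: sum_Re)
  qed
  have "(\<lambda>z. \<Sum>a\<leftarrow>bs. 1 / (1 - a * z)) holomorphic_on ball 0 1" if "set bs \<subseteq> set as" for bs
    using that
  proof (induction bs)
    case (Cons b bs)
    then show ?case by (auto intro!: holomorphic_intros simp: ne[simplified])
  qed auto
  then have G_hol: "G holomorphic_on ball 0 1"
    unfolding G_def by simp
  have h_hol: "(\<lambda>z. csqrt (G z)) holomorphic_on ball 0 1"
    using G_pos by (intro holomorphic_on_csqrt' G_hol) (auto simp: complex_nonpos_Reals_iff dest: G_pos)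
  \<comment> \<open>The mean is first bounded on circles strictly inside the disc, where
    \<open>G\<close> is holomorphic; Fatou's lemma then carries the bound to radius 1.\<close>
  define I where "I r = (\<integral>\<^sup>+t\<in>{0..1}. ennreal (sqrt (cmod (G (of_real r * cis (2 * pi * t))))) \<partial>lborel)" for r :: real
  have I_le: "I r \<le> ennreal (sqrt 2 * sqrt (length as))" if r: "0 < r" "r < 1" for r
  proof -
    have small: "cmod (of_real r * cis (2 * pi * t)) < 1" for t using r by (simp add: norm_mult)
    have cont: "continuous_on {0..1} (\<lambda>t. G (of_real r * cis (2 * pi * t)))"
      using small by (intro continuous_on_compose2[OF holomorphic_on_imp_continuous_on[OF G_hol]] continuous_intros)
        auto
    have 1: "((\<lambda>t. csqrt (G (of_real r * cis (2 * pi * t)))) has_integral csqrt (G 0)) {0..1}"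
      by (rule circle_mean_value[OF h_hol r])
    have "G 0 = of_nat (length as)" unfolding G_def by (induction as) auto
    then have "Re (csqrt (G 0)) = sqrt (length as)" by simp
    with has_integral_Re[OF 1] have 2: "((\<lambda>t. sqrt 2 * Re (csqrt (G (of_real r * cis (2 * pi * t))))) has_integral sqrt 2 * sqrt (length as)) {0..1}"
      by (intro has_integral_mult_right) simp
    have "I r \<le> (\<integral>\<^sup>+t\<in>{0..1}. ennreal (sqrt 2 * Re (csqrt (G (of_real r * cis (2 * pi * t))))) \<partial>lborel)"
      unfolding I_def using G_pos[OF small]
      by (intro nn_integral_mono mult_right_mono ennreal_leI Re_csqrt_ge) (auto intro: less_imp_le)
    also have "\<dots> = ennreal (sqrt 2 * sqrt (length as))"
      using 2
    proof (rule nn_integral_has_integral_lebesgue'[rotated])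
      show "0 \<le> sqrt 2 * Re (csqrt (G (of_real r * cis (2 * pi * t))))" for t
        using csqrt_principal[of "G (of_real r * cis (2 * pi * t))"] by auto
    qed
    finally show ?thesis .
  qed
  define r where "r n = 1 - 1 / (real n + 2)" for n
  have r: "0 < r n" "r n < 1" for n unfolding r_def by (auto simp: field_simps)
  have r_lim: "r \<longlonglongrightarrow> 1" unfolding r_def by real_asymp
  have meas: "(\<lambda>t. indicator {0..1} t * ennreal (sqrt (cmod (G (of_real s * cis (2 * pi * t)))))) \<in> borel_measurable lborel" for s
  proof -
    have "(\<lambda>t. \<Sum>a\<leftarrow>as. 1 / (1 - a * (of_real s * cis (2 * pi * t)))) \<in> borel_measurable borel"
    proof (induction as)
      case (Cons a as)
      have "(\<lambda>t. 1 / (1 - a * (of_real s * cis (2 * pi * t)))) \<in> borel_measurable borel"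
        by (intro borel_measurable_divide borel_measurable_continuous_onI continuous_intros)
      with Cons show ?case by simp
    qed simp
    then show ?thesis unfolding G_def by measurable
  qed
  \<comment> \<open>Poles on the unit circle occupy a null set of parameters; at every other
    parameter the radial limit of \<open>G\<close> is its value.\<close>
  have "AE t in lborel. \<forall>a\<in>set as. 1 - a * cis (2 * pi * t) \<noteq> 0"
  proof (intro AE_finite_allI)
    fix a assume "a \<in> set as"
    show "AE t in lborel. 1 - a * cis (2 * pi * t) \<noteq> 0"
      using AE_cis_neq[of "1 / a"] by eventually_elim
      (metis eq_iff_diff_eq_0 mult_eq_0_iff nonzero_mult_div_cancel_left zero_neq_one)
  qed simp
  then have "AE t in lborel. indicator {0..1} t * ennreal (sqrt (cmod (G (cis (2 * pi * t)))))
      \<le> liminf (\<lambda>n. indicator {0..1} t * ennreal (sqrt (cmod (G (of_real (r n) * cis (2 * pi * t))))))"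
  proof eventually_elim
    case (elim t)
    have "(\<lambda>n. G (of_real (r n) * cis (2 * pi * t))) \<longlonglongrightarrow> G (of_real 1 * cis (2 * pi * t))"
    proof -
      have "(\<lambda>n. (\<Sum>a\<leftarrow>bs. 1 / (1 - a * (of_real (r n) * cis (2 * pi * t))))) \<longlonglongrightarrow> (\<Sum>a\<leftarrow>bs. 1 / (1 - a * (of_real 1 * cis (2 * pi * t))))"
        if "set bs \<subseteq> set as" for bs
        using that
      proof (induction bs)
        case (Cons b bs)
        moreover have "(\<lambda>n. of_real (r n) * cis (2 * pi * t)) \<longlonglongrightarrow> cis (2 * pi * t)"
          using tendsto_mult[OF tendsto_of_real[OF r_lim] tendsto_const, of "cis (2 * pi * t)"] by simp
        ultimately show ?case using elim Cons.prems
          by (auto intro!: tendsto_intros)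
      qed auto
      then show ?thesis unfolding G_def by simp
    qed
    then have "(\<lambda>n. indicator {0..1} t * ennreal (sqrt (cmod (G (of_real (r n) * cis (2 * pi * t)))))) \<longlonglongrightarrow>
       indicator {0..1} t * ennreal (sqrt (cmod (G (of_real 1 * cis (2 * pi * t)))))"
      by (intro ennreal_tendsto_cmult tendsto_ennrealI tendsto_intros) (auto simp: indicator_def)
    then show ?case by (simp add: lim_imp_Liminf)
  qed
  then have "(\<integral>\<^sup>+t. indicator {0..1} t * ennreal (sqrt (cmod (G (cis (2 * pi * t))))) \<partial>lborel)
     \<le> (\<integral>\<^sup>+t. liminf (\<lambda>n. indicator {0..1} t * ennreal (sqrt (cmod (G (of_real (r n) * cis (2 * pi * t)))))) \<partial>lborel)"
    by (rule nn_integral_mono_AE)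
  also have "\<dots> \<le> liminf (\<lambda>n. I (r n))"
    unfolding I_def mult.commute[of _ "indicator _ _"] by (rule nn_integral_liminf) (rule meas)
  also have "\<dots> \<le> ennreal (sqrt 2 * sqrt (length as))"
    using I_le[OF r] by (intro Liminf_le) auto
  finally show ?thesis by (simp add: G_def mult.commute)
qed simp

subsection \<open>Logarithmic derivatives of polynomials\<close>


text \<open>
  On the circle \<open>z / (z - w)\<close> equals \<open>1 / (1 - w * cnj z)\<close> and \<open>1 - 1 / (1 - z / w)\<close>; the first form is used
  for the roots in the closed disc and the second for the roots outside, so that the parameter \<open>a\<close> of the
  kernels \<open>1 / (1 - a * z)\<close> always satisfies \<open>cmod a \<le> 1\<close>.
\<close>

lemma poly_log_deriv_roots:
  fixes xs :: "complex list"
  defines "U \<equiv> \<lambda>xs z. \<Sum>a\<leftarrow>map cnj (filter (\<lambda>x. cmod x \<le> 1) xs). 1 / (1 - a * z)"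
    and "V \<equiv> \<lambda>xs z. \<Sum>a\<leftarrow>map inverse (filter (\<lambda>x. \<not> cmod x \<le> 1) xs). 1 / (1 - a * z)"
    and "m \<equiv> \<lambda>xs. length (filter (\<lambda>x. \<not> cmod x \<le> 1) xs)"
  assumes z: "cmod z = 1" "z \<notin> set xs"
  shows "z * poly (pderiv (\<Prod>x\<leftarrow>xs. [:- x, 1:])) z
    = poly (\<Prod>x\<leftarrow>xs. [:- x, 1:]) z * (cnj (U xs z) + of_nat (m xs) - V xs z)"
  using z(2)
proof (induction xs)
  case Nil
  then show ?case by (simp add: U_def V_def m_def)
next
  case (Cons x xs)
  have z0: "z \<noteq> 0" using z by auto
  have zx: "z - x \<noteq> 0" using Cons.prems by auto
  have cz: "cnj z = 1 / z"
    using z z0 complex_norm_square[of z] by (simp add: field_simps)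
  define P where "P = (\<Prod>x\<leftarrow>xs. [:- x, 1:])"
  have pd: "z * poly (pderiv ([:- x, 1:] * P)) z = z * poly P z + (z - x) * (z * poly (pderiv P) z)"
    by (simp only: pderiv_mult poly_add poly_mult) (simp add: pderiv_pCons algebra_simps)
  have IH: "z * poly (pderiv P) z = poly P z * (cnj (U xs z) + of_nat (m xs) - V xs z)"
    using Cons.IH Cons.prems unfolding P_def by simp
  \<comment> \<open>The long factor is the increment of the bracket caused by the root
    \<open>x\<close>; in both cases it equals z / (z - x).\<close>
  have split: "z = (z - x) * (cnj (U (x # xs) z) - cnj (U xs z) + (of_nat (m (x # xs)) - of_nat (m xs))
      - (V (x # xs) z - V xs z))"
  proof (cases "cmod x \<le> 1")
    case True
    have "z = (z - x) * cnj (1 / (1 - cnj x * z))"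
    proof -
      have "1 - x * cnj z = (z - x) / z" using z0 by (simp add: cz diff_divide_distrib)
      then show ?thesis using zx by simp
    qed
    with True show ?thesis by (simp add: U_def V_def m_def)
  next
    case False
    have "z = (z - x) * (1 - 1 / (1 - inverse x * z))"
    proof -
      have "x \<noteq> 0" using False by auto
      then have "1 - inverse x * z = - ((z - x) / x)"
        by (simp add: divide_inverse algebra_simps)
      then have *: "1 - 1 / (1 - inverse x * z) = 1 + x / (z - x)"
        by simp
      show ?thesis unfolding * using zx by (simp add: distrib_left)
    qed
    with False show ?thesis by (simp add: U_def V_def m_def)
  qed
  have *: "z * poly P z = (z - x) * (cnj (U (x # xs) z) - cnj (U xs z) + (of_nat (m (x # xs)) - of_nat (m xs))
      - (V (x # xs) z - V xs z)) * poly P z"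
    using split by (rule arg_cong)
  have "z * poly P z + (z - x) * (poly P z * (cnj (U xs z) + of_nat (m xs) - V xs z))
    = (z - x) * poly P z * (cnj (U (x # xs) z) + of_nat (m (x # xs)) - V (x # xs) z)"
    unfolding * by (simp only: algebra_simps)
  then show ?case
    unfolding list.map prod_list.Cons P_def[symmetric] pd IH poly_mult by simp
qed

text \<open>Let k roots lie in the closed disc and m outside, k + m = d, and let U and V be the sums
  over \<open>as\<close> and \<open>bs\<close>. Then z p'/p = cnj U + m - V and d - z p'/p = k - cnj
  U + V. Both obey the same bound, so the recursion may later use either of the two derived
  polynomials.\<close>

lemma poly_log_deriv_bounds:
  fixes p :: "complex poly"
  obtains as bs where "\<And>a. a \<in> set as \<Longrightarrow> cmod a \<le> 1" "\<And>b. b \<in> set bs \<Longrightarrow> cmod b \<le> 1"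
    "length as \<le> degree p" "length bs \<le> degree p"
    "\<And>z. cmod z = 1 \<Longrightarrow> poly p z \<noteq> 0 \<Longrightarrow> cmod (z * poly (pderiv p) z) \<le> cmod (poly p z) *
       (cmod (\<Sum>a\<leftarrow>as. 1 / (1 - a * z)) + cmod (\<Sum>a\<leftarrow>bs. 1 / (1 - a * z)) + degree p)"
    "\<And>z. cmod z = 1 \<Longrightarrow> poly p z \<noteq> 0 \<Longrightarrow> cmod (degree p * poly p z - z * poly (pderiv p) z) \<le> cmod (poly p z) *
       (cmod (\<Sum>a\<leftarrow>as. 1 / (1 - a * z)) + cmod (\<Sum>a\<leftarrow>bs. 1 / (1 - a * z)) + degree p)"
proof -
  obtain A where A: "size A = degree p" "p = smult (lead_coeff p) (\<Prod>x\<in>#A. [:- x, 1:])"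
    using that[of "proots p"] size_proots_complex[of p] complex_poly_decompose_multiset[of p]
    by (metis (no_types))
  obtain xs where xs: "mset xs = A" using ex_mset by blast
  have len: "length xs = degree p" using A(1) xs by (metis size_mset)
  have p: "p = smult (lead_coeff p) (\<Prod>x\<leftarrow>xs. [:- x, 1:])"
  proof -
    have "(\<Prod>x\<in>#A. [:- x, 1:]) = (\<Prod>x\<leftarrow>xs. [:- x, 1:])"
      unfolding xs[symmetric] by (simp flip: prod_mset_prod_list)
    from A(2)[unfolded this] show ?thesis .
  qed
  define as where "as = map cnj (filter (\<lambda>x. cmod x \<le> 1) xs)"
  define bs where "bs = map inverse (filter (\<lambda>x. \<not> cmod x \<le> 1) xs)"
  define m where "m = length (filter (\<lambda>x. \<not> cmod x \<le> 1) xs)"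
  have lens: "length as + m = degree p" "length bs = m"
    using sum_length_filter_compl[of "\<lambda>x. cmod x \<le> 1" xs] len by (auto simp: as_def m_def bs_def)
  have eq: "z * poly (pderiv p) z = poly p z *
       (cnj (\<Sum>a\<leftarrow>as. 1 / (1 - a * z)) + of_nat m - (\<Sum>a\<leftarrow>bs. 1 / (1 - a * z)))"
    if z: "cmod z = 1" "poly p z \<noteq> 0" for z
  proof -
    have "poly (\<Prod>x\<leftarrow>xs. [:- x, 1:]) z \<noteq> 0" using z(2) by (subst (asm) p) auto
    moreover have "poly (\<Prod>x\<leftarrow>ys. [:- x, 1:]) z = 0" if "z \<in> set ys" for ys
      using that by (induction ys) auto
    ultimately have "z \<notin> set xs" by blast
    note roots = poly_log_deriv_roots[OF z(1) this, folded as_def bs_def m_def]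
    have "z * poly (pderiv p) z = lead_coeff p * (z * poly (pderiv (\<Prod>x\<leftarrow>xs. [:- x, 1:])) z)"
      by (subst p) (simp only: pderiv_smult poly_smult mult.left_commute)
    also have "\<dots> = (lead_coeff p * poly (\<Prod>x\<leftarrow>xs. [:- x, 1:]) z) * 
       (cnj (\<Sum>a\<leftarrow>as. 1 / (1 - a * z)) + of_nat m - (\<Sum>a\<leftarrow>bs. 1 / (1 - a * z)))"
      unfolding roots by (simp only: mult.assoc)
    also have "lead_coeff p * poly (\<Prod>x\<leftarrow>xs. [:- x, 1:]) z = poly p z"
      by (subst (2) p) (simp only: poly_smult)
    finally show ?thesis .
  qed
  show thesis
  proof (rule that[of as bs])
    show "cmod a \<le> 1" if "a \<in> set as" for a using that by (auto simp: as_def)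
    show "cmod a \<le> 1" if "a \<in> set bs" for a
      using that by (auto simp: bs_def norm_inverse inverse_le_1_iff)
    show "length as \<le> degree p" "length bs \<le> degree p" using lens by auto
    fix z assume z: "cmod z = 1" "poly p z \<noteq> 0"
    let ?U = "\<Sum>a\<leftarrow>as. 1 / (1 - a * z)" and ?V = "\<Sum>a\<leftarrow>bs. 1 / (1 - a * z)"
    have "cmod (cnj ?U + of_nat m - ?V) \<le> cmod (cnj ?U + of_nat m) + cmod ?V"
      by (rule norm_triangle_ineq4)
    also have "cmod (cnj ?U + of_nat m) \<le> cmod (cnj ?U) + cmod (of_nat m)"
      by (rule norm_triangle_ineq)
    also have "\<dots> \<le> cmod ?U + degree p"
      using lens by simp
    finally show "cmod (z * poly (pderiv p) z) \<le> cmod (poly p z) * (cmod ?U + cmod ?V + degree p)"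
      unfolding eq[OF z] norm_mult by (intro mult_left_mono) auto
    have "degree p * poly p z - z * poly (pderiv p) z = poly p z * (of_nat (length as) - cnj ?U + ?V)"
    proof -
      have "(k + l) * w - w * (u + l - v) = w * (k - u + v)" for k l u v w :: complex
        by (simp add: algebra_simps)
      then show ?thesis
        unfolding eq[OF z] lens(1)[symmetric] of_nat_add of_real_add of_real_of_nat_eq .
    qed
    moreover have "cmod (of_nat (length as) - cnj ?U + ?V) \<le> cmod ?U + cmod ?V + degree p"
    proof -
      have "cmod (of_nat (length as) - cnj ?U + ?V) \<le> cmod (of_nat (length as) - cnj ?U) + cmod ?V"
        by (rule norm_triangle_ineq)
      also have "cmod (of_nat (length as) - cnj ?U) \<le> cmod (of_nat (length as)) + cmod (cnj ?U)"
        by (rule norm_triangle_ineq4)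
      also have "\<dots> \<le> degree p + cmod ?U"
        using lens by simp
      finally show ?thesis by simp
    qed
    ultimately show "cmod (degree p * poly p z - z * poly (pderiv p) z) \<le> cmod (poly p z) * (cmod ?U + cmod ?V + degree p)"
      by (simp add: norm_mult mult_left_mono)
  qed
qed

text \<open>\<open>\<phi>\<close> is made of the square roots of the two kernel sums and of the
  degree. The square of a sum of nonnegative numbers dominates the sum of their squares, which gives
  the pointwise bounds; division by the square root of the degree makes the mean at most 3/2 + 3/2 +
  1 = 4, independently of the degree.\<close>

lemma nn_integral_log_deriv:
  fixes p :: "complex poly"
  assumes d: "0 < degree p"
  obtains \<phi> where "\<phi> \<in> borel_measurable lborel" "\<And>t. 0 \<le> \<phi> t"
    "(\<integral>\<^sup>+t\<in>{0..1}. ennreal (\<phi> t) \<partial>lborel) \<le> 4"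
    "AE t in lborel. cmod (cis (2 * pi * t) * poly (pderiv p) (cis (2 * pi * t)))
       \<le> real (degree p) * (\<phi> t)\<^sup>2 * cmod (poly p (cis (2 * pi * t)))"
    "AE t in lborel. cmod (degree p * poly p (cis (2 * pi * t)) - cis (2 * pi * t) * poly (pderiv p) (cis (2 * pi * t)))
       \<le> real (degree p) * (\<phi> t)\<^sup>2 * cmod (poly p (cis (2 * pi * t)))"
proof -
  from poly_log_deriv_bounds[of p] obtain as bs where
    as: "\<And>a. a \<in> set as \<Longrightarrow> cmod a \<le> 1" and bs: "\<And>b. b \<in> set bs \<Longrightarrow> cmod b \<le> 1"
    and len: "length as \<le> degree p" "length bs \<le> degree p"
    and b1: "\<And>z. cmod z = 1 \<Longrightarrow> poly p z \<noteq> 0 \<Longrightarrow> cmod (z * poly (pderiv p) z) \<le> cmod (poly p z) *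
       (cmod (\<Sum>a\<leftarrow>as. 1 / (1 - a * z)) + cmod (\<Sum>a\<leftarrow>bs. 1 / (1 - a * z)) + degree p)"
    and b2: "\<And>z. cmod z = 1 \<Longrightarrow> poly p z \<noteq> 0 \<Longrightarrow> cmod (degree p * poly p z - z * poly (pderiv p) z) \<le> cmod (poly p z) *
       (cmod (\<Sum>a\<leftarrow>as. 1 / (1 - a * z)) + cmod (\<Sum>a\<leftarrow>bs. 1 / (1 - a * z)) + degree p)"
    by blast
  let ?d = "degree p"
  define s where "s cs t = sqrt (cmod (\<Sum>a\<leftarrow>cs. 1 / (1 - a * cis (2 * pi * t))))" for cs t
  define \<phi> where "\<phi> t = (s as t + s bs t + sqrt ?d) / sqrt ?d" for t
  have s_nonneg [simp]: "0 \<le> s cs t" for cs t by (simp add: s_def)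
  have s_meas [measurable]: "s cs \<in> borel_measurable lborel" for cs
  proof -
    have "(\<lambda>t. \<Sum>a\<leftarrow>cs. 1 / (1 - a * cis (2 * pi * t))) \<in> borel_measurable borel"
    proof (induction cs)
      case (Cons a cs)
      have "(\<lambda>t. 1 / (1 - a * cis (2 * pi * t))) \<in> borel_measurable borel"
        by (intro borel_measurable_divide borel_measurable_continuous_onI continuous_intros)
      with Cons show ?case by simp
    qed simp
    then show ?thesis unfolding s_def[abs_def] by measurable
  qed
  \<comment> \<open>The factor 3/2 is a rational upper bound for sqrt 2.\<close>
  have s_int: "(\<integral>\<^sup>+t\<in>{0..1}. ennreal (s cs t) \<partial>lborel) \<le> ennreal (3 / 2 * sqrt ?d)"
    if "\<And>a. a \<in> set cs \<Longrightarrow> cmod a \<le> 1" "length cs \<le> ?d" for cs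
  proof -
    have "(\<integral>\<^sup>+t\<in>{0..1}. ennreal (s cs t) \<partial>lborel) \<le> ennreal (sqrt 2 * sqrt (length cs))"
      unfolding s_def by (rule nn_integral_sqrt_sum_reciprocals) (rule that)
    also have "\<dots> \<le> ennreal (3 / 2 * sqrt ?d)"
      using that(2) by (intro ennreal_leI mult_mono real_le_lsqrt) (auto simp: power2_eq_square)
    finally show ?thesis .
  qed
  have \<phi>_sq: "s as t * s as t + s bs t * s bs t + ?d \<le> ?d * (\<phi> t)\<^sup>2" for t
  proof -
    have "?d * (\<phi> t)\<^sup>2 = (s as t + s bs t + sqrt ?d)\<^sup>2"
      using d by (simp add: \<phi>_def power_divide)
    moreover have "sqrt ?d * sqrt ?d = ?d" by simp
    moreover have "0 \<le> s as t * s bs t" "0 \<le> s as t * sqrt ?d" "0 \<le> s bs t * sqrt ?d"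
      by (auto intro!: mult_nonneg_nonneg)
    ultimately show ?thesis
      by (simp add: power2_eq_square algebra_simps)
  qed
  have nz: "AE t in lborel. poly p (cis (2 * pi * t)) \<noteq> 0"
  proof -
    have "p \<noteq> 0" using d by auto
    then have "finite {z. poly p z = 0}" by (rule poly_roots_finite)
    then have "AE t in lborel. \<forall>z\<in>{z. poly p z = 0}. cis (2 * pi * t) \<noteq> z"
      by (intro AE_finite_allI AE_cis_neq)
    then show ?thesis by eventually_elim blast
  qed
  have sq: "s cs t * s cs t = cmod (\<Sum>a\<leftarrow>cs. 1 / (1 - a * cis (2 * pi * t)))" for cs t
    by (simp add: s_def)
  show thesis
  proof (rule that[of \<phi>])
    show "\<phi> \<in> borel_measurable lborel" unfolding \<phi>_def[abs_def] by measurable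
    show "0 \<le> \<phi> t" for t unfolding \<phi>_def by (intro divide_nonneg_nonneg add_nonneg_nonneg) auto
    have "(\<integral>\<^sup>+t\<in>{0..1}. ennreal (\<phi> t) \<partial>lborel)
      = ennreal (1 / sqrt ?d) * ((\<integral>\<^sup>+t\<in>{0..1}. ennreal (s as t) \<partial>lborel) + (\<integral>\<^sup>+t\<in>{0..1}. ennreal (s bs t) \<partial>lborel)
         + (\<integral>\<^sup>+t\<in>{0..1::real}. ennreal (sqrt ?d) \<partial>lborel))"
    proof -
      have "ennreal (\<phi> t) * indicator {0..1} t = ennreal (1 / sqrt ?d) * (ennreal (s as t) * indicator {0..1} t + ennreal (s bs t) * indicator {0..1} t + ennreal (sqrt ?d) * indicator {0..1} t)" for t
      proof -
        have "ennreal (\<phi> t) = ennreal (1 / sqrt ?d * (s as t + s bs t + sqrt ?d))" by (simp add: \<phi>_def)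
        also have "\<dots> = ennreal (1 / sqrt ?d) * (ennreal (s as t) + ennreal (s bs t) + ennreal (sqrt ?d))"
          by (subst ennreal_mult) (auto simp: ennreal_plus add_nonneg_nonneg)
        finally show ?thesis by (simp add: distrib_right distrib_left mult.assoc)
      qed
      then show ?thesis by (simp add: nn_integral_cmult nn_integral_add)
    qed
    also have "\<dots> \<le> ennreal (1 / sqrt ?d) * (ennreal (3 / 2 * sqrt ?d) + ennreal (3 / 2 * sqrt ?d) + ennreal (sqrt ?d))"
      by (intro mult_left_mono add_mono s_int as bs len) (auto simp: nn_integral_cmult)
    also have "\<dots> = ennreal 4"
    proof -
      have q: "0 < sqrt ?d" using d by simp
      have "ennreal (3 / 2 * q) + ennreal (3 / 2 * q) = ennreal (3 * q)"
        "ennreal (3 * q) + ennreal q = ennreal (4 * q)"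
        "ennreal (1 / q) * ennreal (4 * q) = ennreal 4" if "0 < q" for q
        using that by (simp_all flip: ennreal_plus ennreal_mult del: ennreal_numeral)
      from this[OF q] show ?thesis by simp
    qed
    finally show "(\<integral>\<^sup>+t\<in>{0..1}. ennreal (\<phi> t) \<partial>lborel) \<le> 4" by simp
    show "AE t in lborel. cmod (cis (2 * pi * t) * poly (pderiv p) (cis (2 * pi * t)))
       \<le> real (degree p) * (\<phi> t)\<^sup>2 * cmod (poly p (cis (2 * pi * t)))"
      using nz
    proof eventually_elim
      case (elim t)
      show ?case using b1[OF norm_cis elim] mult_left_mono[OF \<phi>_sq[of t] norm_ge_zero[of "poly p (cis (2 * pi * t))"]]
        by (simp add: sq mult.commute)
    qed
    show "AE t in lborel. cmod (degree p * poly p (cis (2 * pi * t)) - cis (2 * pi * t) * poly (pderiv p) (cis (2 * pi * t)))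
       \<le> real (degree p) * (\<phi> t)\<^sup>2 * cmod (poly p (cis (2 * pi * t)))"
      using nz
    proof eventually_elim
      case (elim t)
      show ?case using b2[OF norm_cis elim] mult_left_mono[OF \<phi>_sq[of t] norm_ge_zero[of "poly p (cis (2 * pi * t))"]]
        by (simp add: sq mult.commute)
    qed
  qed
qed

subsection \<open>The Turan--Nazarov inequality\<close>


definition wiener_norm :: "complex poly \<Rightarrow> real" where
  "wiener_norm p = (\<Sum>i\<le>degree p. cmod (coeff p i))"

lemma wiener_norm_eq: "degree p \<le> d \<Longrightarrow> wiener_norm p = (\<Sum>i\<le>d. cmod (coeff p i))"
  unfolding wiener_norm_def by (rule sum.mono_neutral_left) (auto simp: coeff_eq_0)

lemma wiener_norm_pCons_0: "wiener_norm (pCons 0 p) = wiener_norm p"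
  by (subst wiener_norm_eq[of _ "Suc (degree p)"])
     (auto simp: degree_pCons_le wiener_norm_def sum.atMost_Suc_shift simp del: sum.atMost_Suc)

lemma wiener_norm_pos: "p \<noteq> 0 \<Longrightarrow> 0 < wiener_norm p"
  unfolding wiener_norm_def
  by (rule sum_pos2[of _ "degree p"]) auto

lemma wiener_norm_0 [simp]: "wiener_norm 0 = 0"
  by (simp add: wiener_norm_def)

lemma finite_coeff_support: "finite {i. coeff p i \<noteq> 0}"
  using MOST_coeff_eq_0[of p] by (simp add: eventually_cofinite)

lemma card_coeff_support_pCons_0: "card {i. coeff (pCons 0 p) i \<noteq> 0} = card {i. coeff p i \<noteq> 0}"
proof -
  have "{i. coeff (pCons 0 p) i \<noteq> 0} = Suc ` {i. coeff p i \<noteq> 0}"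
  proof (rule set_eqI)
    show "i \<in> {i. coeff (pCons 0 p) i \<noteq> 0} \<longleftrightarrow> i \<in> Suc ` {i. coeff p i \<noteq> 0}" for i
      by (cases i) auto
  qed
  then show ?thesis by (simp add: card_image)
qed

text \<open>Since \<phi>^2 \<le> exp (2 \<phi>), a lower bound for |q| becomes one for |p| when 2
  \<phi> is added to the exponent. A further 1 pays for the factor 2 between the Wiener norms,
  because 2 \<le> e. The increment has mean at most 2 * 4 + 1 = 9, below the 10 granted per
  coefficient.\<close>

lemma turan_nazarov_step:
  fixes p q :: "complex poly"
  assumes \<phi>: "\<phi> \<in> borel_measurable lborel" "\<And>t. 0 \<le> \<phi> t" "(\<integral>\<^sup>+t\<in>{0..1}. ennreal (\<phi> t) \<partial>lborel) \<le> 4"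
    and \<Psi>: "\<Psi> \<in> borel_measurable lborel" "\<And>t. 0 \<le> \<Psi> t"
      "(\<integral>\<^sup>+t\<in>{0..1}. ennreal (\<Psi> t) \<partial>lborel) \<le> ennreal (10 * real m)"
      "AE t in lborel. wiener_norm q \<le> cmod (poly q (cis (2 * pi * t))) * exp (\<Psi> t)"
    and q: "AE t in lborel. cmod (poly q (cis (2 * pi * t))) \<le> (\<phi> t)\<^sup>2 * cmod (poly p (cis (2 * pi * t)))"
    and W: "wiener_norm p \<le> 2 * wiener_norm q" and mn: "m < n"
  shows "\<exists>\<Psi>\<in>borel_measurable lborel. (\<forall>t. 0 \<le> \<Psi> t) \<and>
      (\<integral>\<^sup>+t\<in>{0..1}. ennreal (\<Psi> t) \<partial>lborel) \<le> ennreal (10 * real n) \<and>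
      (AE t in lborel. wiener_norm p \<le> cmod (poly p (cis (2 * pi * t))) * exp (\<Psi> t))"
proof (intro bexI conjI allI)
  let ?\<Psi> = "\<lambda>t. \<Psi> t + (2 * \<phi> t + 1)"
  show "?\<Psi> \<in> borel_measurable lborel" using \<phi>(1) \<Psi>(1) by measurable
  show "0 \<le> ?\<Psi> t" for t using \<phi>(2)[of t] \<Psi>(2)[of t] by simp
  have "(\<integral>\<^sup>+t\<in>{0..1}. ennreal (?\<Psi> t) \<partial>lborel) =
     (\<integral>\<^sup>+t\<in>{0..1}. ennreal (\<Psi> t) \<partial>lborel) + (2 * (\<integral>\<^sup>+t\<in>{0..1}. ennreal (\<phi> t) \<partial>lborel) + (\<integral>\<^sup>+t\<in>{0..1::real}. 1 \<partial>lborel))"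
  proof -
    have "ennreal (?\<Psi> t) * indicator {0..1} t = ennreal (\<Psi> t) * indicator {0..1} t + (2 * (ennreal (\<phi> t) * indicator {0..1} t) + 1 * indicator {0..1} t)" for t
      using \<phi>(2)[of t] \<Psi>(2)[of t] by (simp add: ennreal_mult indicator_def)
    then show ?thesis using \<phi>(1) \<Psi>(1)
      by (simp add: nn_integral_cmult nn_integral_add)
  qed
  also have "\<dots> \<le> ennreal (10 * real m) + (2 * 4 + 1)"
    by (intro add_mono mult_left_mono \<phi> \<Psi>) auto
  also have "\<dots> = ennreal (10 * real m + 9)"
    by (subst ennreal_plus) auto
  also have "\<dots> \<le> ennreal (10 * real n)"
    using mn by (intro ennreal_leI) auto
  finally show "(\<integral>\<^sup>+t\<in>{0..1}. ennreal (?\<Psi> t) \<partial>lborel) \<le> ennreal (10 * real n)" .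
  show "AE t in lborel. wiener_norm p \<le> cmod (poly p (cis (2 * pi * t))) * exp (?\<Psi> t)"
    using q \<Psi>(4)
  proof eventually_elim
    case (elim t)
    let ?p = "cmod (poly p (cis (2 * pi * t)))" and ?q = "cmod (poly q (cis (2 * pi * t)))"
    have "(\<phi> t)\<^sup>2 \<le> (exp (\<phi> t))\<^sup>2"
      using \<phi>(2)[of t] exp_ge_add_one_self[of "\<phi> t"] by (intro power_mono) linarith+
    also have "\<dots> = exp (2 * \<phi> t)"
      by (simp add: exp_double)
    finally have "?q \<le> exp (2 * \<phi> t) * ?p"
      using elim(1) by (meson mult_right_mono norm_ge_zero order_trans)
    then have "?q * exp (\<Psi> t) \<le> exp (2 * \<phi> t) * ?p * exp (\<Psi> t)"
      by (rule mult_right_mono) simp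
    then have "wiener_norm p \<le> 2 * (exp (2 * \<phi> t) * ?p * exp (\<Psi> t))"
      using W elim(2) by linarith
    also have "\<dots> \<le> exp 1 * (exp (2 * \<phi> t) * ?p * exp (\<Psi> t))"
      using exp_ge_add_one_self[of 1] by (intro mult_right_mono) auto
    also have "\<dots> = ?p * exp (?\<Psi> t)"
      by (simp add: exp_add algebra_simps)
    finally show ?case .
  qed
qed

text \<open>
  The mean of \<open>\<Psi>\<close> grows by a constant in each step of the recursion. Bounding every quotient off an
  exceptional set of measure \<open>1 / n\<close> instead would lose a factor \<open>n ^ n\<close>.
\<close>

lemma turan_nazarov:
  fixes p :: "complex poly"
  assumes "p \<noteq> 0"
  shows "\<exists>\<Psi>\<in>borel_measurable lborel. (\<forall>t. 0 \<le> \<Psi> t) \<and>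
      (\<integral>\<^sup>+t\<in>{0..1}. ennreal (\<Psi> t) \<partial>lborel) \<le> ennreal (10 * real (card {i. coeff p i \<noteq> 0})) \<and>
      (AE t in lborel. wiener_norm p \<le> cmod (poly p (cis (2 * pi * t))) * exp (\<Psi> t))"
  using assms
\<comment> \<open>Removing a factor z keeps the number of coefficients and lowers the degree; the
  main step lowers the number of coefficients without raising the degree. The sum of both decreases
  in either case.\<close>
proof (induction "card {i. coeff p i \<noteq> 0} + degree p" arbitrary: p rule: less_induct)
  case less
  let ?d = "degree p"
  consider "?d = 0" | "?d > 0" "coeff p 0 = 0" | "?d > 0" "coeff p 0 \<noteq> 0" by blast
  then show ?case
  proof cases
    case 1
    then obtain c where "p = [:c:]" by (auto elim: degree_eq_zeroE)
    then show ?thesis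
      by (intro bexI[of _ "\<lambda>_. 0"]) (auto simp: wiener_norm_def)
  next
    case 2
    obtain q where p: "p = pCons 0 q" using 2(2) by (metis coeff_pCons_0 pCons_cases)
    have q: "q \<noteq> 0" using p 2 by auto
    have "card {i. coeff q i \<noteq> 0} + degree q < card {i. coeff p i \<noteq> 0} + degree p"
      using q unfolding p card_coeff_support_pCons_0 by simp
    from less.hyps[OF this q] show ?thesis
      unfolding p card_coeff_support_pCons_0 wiener_norm_pCons_0 by (simp add: norm_mult)
  next
    case 3
    from nn_integral_log_deriv[OF 3(1)] obtain \<phi> where
      \<phi>: "\<phi> \<in> borel_measurable lborel" "\<And>t. 0 \<le> \<phi> t" "(\<integral>\<^sup>+t\<in>{0..1}. ennreal (\<phi> t) \<partial>lborel) \<le> 4"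
      and b1: "AE t in lborel. cmod (cis (2 * pi * t) * poly (pderiv p) (cis (2 * pi * t)))
         \<le> real (degree p) * (\<phi> t)\<^sup>2 * cmod (poly p (cis (2 * pi * t)))"
      and b2: "AE t in lborel. cmod (degree p * poly p (cis (2 * pi * t)) - cis (2 * pi * t) * poly (pderiv p) (cis (2 * pi * t)))
         \<le> real (degree p) * (\<phi> t)\<^sup>2 * cmod (poly p (cis (2 * pi * t)))"
      by blast
    have d0: "real ?d > 0" using 3 by simp
    \<comment> \<open>The coefficients of \<open>q1\<close> and \<open>q2\<close> are those of
      \<open>p\<close> with weights i / d and 1 - i / d. These are nonnegative with sum 1, which is
      why the Wiener norms add up.\<close>
    define q1 where "q1 = smult (1 / of_nat ?d) (pCons 0 (pderiv p))"
    define q2 where "q2 = p - q1"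
    have c1: "coeff q1 i = of_real (i / ?d) * coeff p i" for i
      unfolding q1_def by (cases i) (auto simp: coeff_pderiv)
    have c2: "coeff q2 i = of_real (1 - i / ?d) * coeff p i" for i
      unfolding q2_def by (simp add: c1 algebra_simps)
    have deg: "degree q1 \<le> ?d" "degree q2 \<le> ?d"
      by (auto intro!: degree_le simp: c1 c2 coeff_eq_0)
    have "wiener_norm q1 + wiener_norm q2 = wiener_norm p"
    proof -
      have "cmod (coeff q1 i) + cmod (coeff q2 i) = cmod (coeff p i)" if "i \<le> ?d" for i
      proof -
        have "0 \<le> 1 - i / ?d" using that d0 by simp
        then have "cmod (coeff q2 i) = (1 - i / ?d) * cmod (coeff p i)"
          unfolding c2 norm_mult by (simp only: norm_of_real abs_of_nonneg)
        moreover have "cmod (coeff q1 i) = (i / ?d) * cmod (coeff p i)"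
          unfolding c1 norm_mult norm_of_real by simp
        ultimately show ?thesis by (simp add: algebra_simps)
      qed
      then show ?thesis
        unfolding wiener_norm_eq[OF deg(1)] wiener_norm_eq[OF deg(2)] wiener_norm_def[of p]
        by (simp flip: sum.distrib)
    qed
    then consider "wiener_norm p \<le> 2 * wiener_norm q1" | "wiener_norm p \<le> 2 * wiener_norm q2"
      by linarith
    then obtain q where W: "wiener_norm p \<le> 2 * wiener_norm q" and q: "q = q1 \<or> q = q2"
      by metis
    have qn: "q \<noteq> 0" using W wiener_norm_pos[OF less.prems] by auto
    \<comment> \<open>\<open>q1\<close> loses the constant coefficient, which is nonzero in this
      case, and \<open>q2\<close> loses the leading one, so the support shrinks strictly whichever
      is chosen.\<close>
    have "coeff p ?d \<noteq> 0" "coeff q1 0 = 0" "coeff q2 ?d = 0"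
      using less.prems d0 by (auto simp: c1 c2)
    then obtain j where "coeff p j \<noteq> 0" "coeff q j = 0"
      using q 3(2) by metis
    moreover have "{i. coeff q i \<noteq> 0} \<subseteq> {i. coeff p i \<noteq> 0}"
      using q by (auto simp: c1 c2)
    ultimately have "{i. coeff q i \<noteq> 0} \<subset> {i. coeff p i \<noteq> 0}"
      by blast
    then have card: "card {i. coeff q i \<noteq> 0} < card {i. coeff p i \<noteq> 0}"
      by (rule psubset_card_mono[OF finite_coeff_support])
    have "card {i. coeff q i \<noteq> 0} + degree q < card {i. coeff p i \<noteq> 0} + degree p"
      using card deg q by auto
    from less.hyps[OF this qn] obtain \<Psi> where \<Psi>: "\<Psi> \<in> borel_measurable lborel" "\<And>t. 0 \<le> \<Psi> t"
      "(\<integral>\<^sup>+t\<in>{0..1}. ennreal (\<Psi> t) \<partial>lborel) \<le> ennreal (10 * real (card {i. coeff q i \<noteq> 0}))"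
      "AE t in lborel. wiener_norm q \<le> cmod (poly q (cis (2 * pi * t))) * exp (\<Psi> t)"
      by blast
    have e1: "poly q1 z = z * poly (pderiv p) z / ?d" for z
      unfolding q1_def by simp
    have e2: "poly q2 z = (?d * poly p z - z * poly (pderiv p) z) / ?d" for z
      unfolding q2_def using d0 by (simp add: e1 diff_divide_distrib)
    have "AE t in lborel. cmod (poly q (cis (2 * pi * t))) \<le> (\<phi> t)\<^sup>2 * cmod (poly p (cis (2 * pi * t)))"
      using b1 b2
    proof eventually_elim
      case (elim t)
      show ?case
        using q elim d0 by (auto simp: e1 e2 norm_divide pos_divide_le_eq mult_ac)
    qed
    from turan_nazarov_step[OF \<phi> \<Psi> this W card] show ?thesis .
  qed
qed

subsection \<open>Fourier coefficients on the unit interval\<close>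


text \<open>The half-open interval is a fundamental domain: its integer translates tile the line
  without overlap, so sums over translates unfold exactly.\<close>

abbreviation unit_measure :: "real measure" where
  "unit_measure \<equiv> restrict_space lborel {0..<1}"

definition trig :: "int \<Rightarrow> real \<Rightarrow> complex" where
  "trig m t = cis (2 * pi * of_int m * t)"

lemma norm_trig [simp]: "cmod (trig m t) = 1"
  by (simp add: trig_def)

lemma trig_0 [simp]: "trig 0 t = 1"
  by (simp add: trig_def)

lemma trig_add: "trig (m + n) t = trig m t * trig n t"
  by (simp add: trig_def cis_mult algebra_simps)

lemma cnj_trig: "cnj (trig m t) = trig (- m) t"
  by (simp add: trig_def cis_cnj)

lemma trig_diff: "trig m t * cnj (trig k t) = trig (m - k) t"
  using trig_add[of m "- k" t] by (simp add: cnj_trig)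

lemma continuous_on_trig [continuous_intros]: "continuous_on A (trig m)"
  unfolding trig_def[abs_def] by (intro continuous_intros)

lemma borel_measurable_trig [measurable]: "trig m \<in> borel_measurable borel"
  by (intro borel_measurable_continuous_onI continuous_intros)

lemma trig_add_of_int: "trig m (t + of_int k) = trig m t"
proof -
  have "trig m (t + of_int k) = cis (2 * pi * of_int m * t) * cis (2 * pi * of_int (m * k))"
    by (simp add: trig_def cis_mult algebra_simps)
  also have "cis (2 * pi * of_int (m * k)) = 1"
    by (rule cis_multiple_2pi) simp
  finally show ?thesis by (simp add: trig_def)
qed

lemma AE_unit_interval: "AE t in lborel. indicator {0..<1::real} t = (indicator {0..1} t :: 'a :: zero_neq_one)"
  using AE_lborel_singleton[of 1] by eventually_elim (auto simp: indicator_def)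

lemma finite_measure_unit: "finite_measure unit_measure"
  by (rule finite_measureI) (simp add: emeasure_restrict_space space_restrict_space)

lemma integral_trig: "(LINT t|unit_measure. trig m t) = (if m = 0 then 1 else 0)"
proof -
  have 1: "(LINT t|unit_measure. trig m t) = (LINT t|lborel. indicator {0..1} t *\<^sub>R trig m t)"
  proof (subst integral_restrict_space, simp, rule integral_cong_AE)
    show "AE t in lborel. indicat_real {0..<1} t *\<^sub>R trig m t = indicat_real {0..1} t *\<^sub>R trig m t"
      using AE_unit_interval[where 'a = real] by eventually_elim simp
  qed auto
  show ?thesis
  proof (cases "m = 0")
    case True
    then show ?thesis unfolding 1 by simp
  next
    case False
    let ?F = "\<lambda>t. trig m t / (2 * pi * of_int m * \<i>)"
    have "(?F has_vector_derivative trig m t) (at t within {0..1})" for t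
      unfolding trig_def using False
      by (auto intro!: derivative_eq_intros simp: has_vector_derivative_def fun_eq_iff scaleR_conv_of_real mult_ac)
    then have "(LINT t|lborel. indicator {0..1} t *\<^sub>R trig m t) = ?F 1 - ?F 0"
      by (intro integral_FTC_Icc continuous_intros) auto
    also have "?F 1 = ?F 0" using trig_add_of_int[of m 0 1] by simp
    finally show ?thesis using False by (simp add: 1)
  qed
qed

section \<open>Bounded Borel functions and their integrability on the unit interval\<close>

definition bdd_borel :: "(real \<Rightarrow> complex) \<Rightarrow> bool" where
  "bdd_borel f \<longleftrightarrow> f \<in> borel_measurable borel \<and> (\<exists>B. \<forall>t. cmod (f t) \<le> B)"

lemma bdd_borelI: "f \<in> borel_measurable borel \<Longrightarrow> (\<And>t. cmod (f t) \<le> B) \<Longrightarrow> bdd_borel f"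
  by (auto simp: bdd_borel_def)

lemma bdd_borel_measurable: "bdd_borel f \<Longrightarrow> f \<in> borel_measurable borel"
  by (simp add: bdd_borel_def)

lemma bdd_borel_trig [simp]: "bdd_borel (trig m)"
  by (rule bdd_borelI[where B = 1]) auto

lemma bdd_borelE:
  assumes "bdd_borel f"
  obtains B where "f \<in> borel_measurable borel" "\<And>t. cmod (f t) \<le> B" "0 \<le> B"
proof -
  from assms obtain B where "f \<in> borel_measurable borel" and B: "\<And>t. cmod (f t) \<le> B"
    unfolding bdd_borel_def by blast
  moreover have "0 \<le> B" using B[of 0] norm_ge_zero[of "f 0"] by linarith
  ultimately show thesis using that by blast
qed

lemma bdd_borel_mult:
  assumes "bdd_borel f" "bdd_borel g"
  shows "bdd_borel (\<lambda>t. f t * g t)"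
proof -
  obtain B C where f: "f \<in> borel_measurable borel" "\<And>t. cmod (f t) \<le> B" "0 \<le> B"
    and g: "g \<in> borel_measurable borel" "\<And>t. cmod (g t) \<le> C"
    using assms by (metis bdd_borelE)
  show ?thesis
    using f g by (intro bdd_borelI[where B = "B * C"] borel_measurable_times) (auto simp: norm_mult intro!: mult_mono)
qed

lemma bdd_borel_add:
  assumes "bdd_borel f" "bdd_borel g"
  shows "bdd_borel (\<lambda>t. f t + g t)"
proof -
  obtain B C where f: "f \<in> borel_measurable borel" "\<And>t. cmod (f t) \<le> B"
    and g: "g \<in> borel_measurable borel" "\<And>t. cmod (g t) \<le> C"
    using assms by (metis bdd_borelE)
  show ?thesis
    using f g by (intro bdd_borelI[where B = "B + C"] borel_measurable_add) (auto intro!: norm_triangle_mono)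
qed

lemma bdd_borel_const [simp]: "bdd_borel (\<lambda>t. c)"
  by (rule bdd_borelI[where B = "cmod c"]) auto

lemma bdd_borel_diff: "bdd_borel f \<Longrightarrow> bdd_borel g \<Longrightarrow> bdd_borel (\<lambda>t. f t - g t)"
  using bdd_borel_add[OF _ bdd_borel_mult[OF bdd_borel_const[of "-1"]], of f g] by simp

lemma bdd_borel_cnj:
  assumes "bdd_borel f"
  shows "bdd_borel (\<lambda>t. cnj (f t))"
proof -
  obtain B where f: "f \<in> borel_measurable borel" "\<And>t. cmod (f t) \<le> B"
    using assms by (metis bdd_borelE)
  have "cnj \<in> borel_measurable borel"
    by (intro borel_measurable_continuous_onI continuous_intros)
  from measurable_compose[OF f(1) this] show ?thesis
    using f(2) by (intro bdd_borelI[where B = B]) auto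
qed

lemma bdd_borel_sum: "(\<And>i. i \<in> I \<Longrightarrow> bdd_borel (f i)) \<Longrightarrow> bdd_borel (\<lambda>t. \<Sum>i\<in>I. f i t)"
  by (induction I rule: infinite_finite_induct) (simp_all add: bdd_borel_add)

lemma bdd_borel_integrable:
  assumes "bdd_borel f"
  shows "integrable unit_measure f"
proof -
  obtain B where f: "f \<in> borel_measurable borel" "\<And>t. cmod (f t) \<le> B"
    using assms by (metis bdd_borelE)
  show ?thesis
    using f by (intro finite_measure.integrable_const_bound[OF finite_measure_unit, of _ B] AE_I2
        measurable_restrict_space1) simp_all
qed

section \<open>Fourier coefficients and orthogonality\<close>

definition fcoeff :: "(real \<Rightarrow> complex) \<Rightarrow> int \<Rightarrow> complex" where
  "fcoeff h m = (LINT t|unit_measure. h t * trig (- m) t)"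

text \<open>Expansion of the square, orthonormality of the characters, and completion of the square
  in \<open>b\<close>. The choice \<open>b = fcoeff h\<close> gives Bessel's inequality; a general
  \<open>b\<close> shows that the partial Fourier sum is the best approximation with frequencies in
  \<open>M\<close>.\<close>

lemma integral_norm_diff_trig:
  assumes h: "bdd_borel h" and M: "finite M"
  shows "(LINT t|unit_measure. (cmod (h t - (\<Sum>m\<in>M. b m * trig m t)))\<^sup>2) =
    (LINT t|unit_measure. (cmod (h t))\<^sup>2) - (\<Sum>m\<in>M. (cmod (fcoeff h m))\<^sup>2) + (\<Sum>m\<in>M. (cmod (b m - fcoeff h m))\<^sup>2)"
proof -
  let ?T = "\<lambda>t. \<Sum>m\<in>M. b m * trig m t"
  have T: "bdd_borel ?T" by (intro bdd_borel_sum bdd_borel_mult) auto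
  note int = bdd_borel_integrable
  have hT: "(LINT t|unit_measure. h t * cnj (?T t)) = (\<Sum>m\<in>M. cnj (b m) * fcoeff h m)"
  proof -
    have "h t * cnj (?T t) = (\<Sum>m\<in>M. cnj (b m) * (h t * trig (- m) t))" for t
      by (simp add: cnj_sum cnj_trig sum_distrib_left mult_ac)
    then show ?thesis
      by (simp add: fcoeff_def Bochner_Integration.integral_sum int bdd_borel_mult h)
  qed
  have Th: "(LINT t|unit_measure. cnj (h t) * ?T t) = cnj (\<Sum>m\<in>M. cnj (b m) * fcoeff h m)"
    unfolding hT[symmetric] Bochner_Integration.integral_cnj[symmetric] by (simp del: cnj_sum)
  have TT: "(LINT t|unit_measure. ?T t * cnj (?T t)) = (\<Sum>m\<in>M. b m * cnj (b m))"
  proof -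
    have "?T t * cnj (?T t) = (\<Sum>m\<in>M. \<Sum>k\<in>M. b m * cnj (b k) * trig (m - k) t)" for t
      unfolding cnj_sum sum_product
      by (intro sum.cong refl) (simp add: trig_diff[symmetric])
    then have "(LINT t|unit_measure. ?T t * cnj (?T t)) = (LINT t|unit_measure. (\<Sum>m\<in>M. \<Sum>k\<in>M. b m * cnj (b k) * trig (m - k) t))"
      by (simp only:)
    also have "\<dots> = (\<Sum>m\<in>M. LINT t|unit_measure. (\<Sum>k\<in>M. b m * cnj (b k) * trig (m - k) t))"
      by (intro Bochner_Integration.integral_sum int bdd_borel_sum bdd_borel_mult) auto
    also have "\<dots> = (\<Sum>m\<in>M. \<Sum>k\<in>M. LINT t|unit_measure. b m * cnj (b k) * trig (m - k) t)"
      by (intro sum.cong Bochner_Integration.integral_sum int bdd_borel_mult) auto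
    also have "\<dots> = (\<Sum>m\<in>M. \<Sum>k\<in>M. b m * cnj (b k) * (if m - k = 0 then 1 else 0))"
      by (simp only: integral_mult_right_zero integral_trig)
    also have "\<dots> = (\<Sum>m\<in>M. \<Sum>k\<in>M. if m = k then b m * cnj (b k) else 0)"
      by (intro sum.cong refl) auto
    also have "\<dots> = (\<Sum>m\<in>M. b m * cnj (b m))"
      using M by (simp add: sum.delta)
    finally show ?thesis .
  qed
  have sq: "complex_of_real ((cmod z)\<^sup>2) = z * cnj z" for z
    by (rule complex_norm_square)
  have ints: "integrable unit_measure (\<lambda>t. h t * cnj (h t))" "integrable unit_measure (\<lambda>t. h t * cnj (?T t))"
    "integrable unit_measure (\<lambda>t. cnj (h t) * ?T t)" "integrable unit_measure (\<lambda>t. ?T t * cnj (?T t))"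
    by (rule int, intro bdd_borel_mult bdd_borel_cnj h T)+
  have "complex_of_real (LINT t|unit_measure. (cmod (h t - ?T t))\<^sup>2) = (LINT t|unit_measure. (h t - ?T t) * cnj (h t - ?T t))"
    unfolding sq[symmetric] by (rule integral_complex_of_real[symmetric])
  also have "\<dots> = (LINT t|unit_measure. (h t * cnj (h t) - h t * cnj (?T t)) - (cnj (h t) * ?T t - ?T t * cnj (?T t)))"
    by (intro Bochner_Integration.integral_cong refl) (simp add: algebra_simps del: cnj_sum)
  also have "\<dots> = ((LINT t|unit_measure. h t * cnj (h t)) - (LINT t|unit_measure. h t * cnj (?T t))) -
      ((LINT t|unit_measure. cnj (h t) * ?T t) - (LINT t|unit_measure. ?T t * cnj (?T t)))"
    using ints by (simp only: Bochner_Integration.integral_diff Bochner_Integration.integrable_diff)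
  also have "\<dots> = (LINT t|unit_measure. h t * cnj (h t)) - (\<Sum>m\<in>M. fcoeff h m * cnj (fcoeff h m))
      + (\<Sum>m\<in>M. (b m - fcoeff h m) * cnj (b m - fcoeff h m))"
    unfolding hT Th TT by (simp add: algebra_simps sum.distrib sum_subtractf)
  also have "\<dots> = complex_of_real ((LINT t|unit_measure. (cmod (h t))\<^sup>2) - (\<Sum>m\<in>M. (cmod (fcoeff h m))\<^sup>2) + (\<Sum>m\<in>M. (cmod (b m - fcoeff h m))\<^sup>2))"
  proof -
    have "(LINT t|unit_measure. h t * cnj (h t)) = complex_of_real (LINT t|unit_measure. (cmod (h t))\<^sup>2)"
      unfolding sq[symmetric] by (rule integral_complex_of_real)
    then show ?thesis by (simp only: of_real_add of_real_diff of_real_sum sq)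
  qed
  finally show ?thesis by (simp only: of_real_eq_iff)
qed

text \<open>Generation from monomials by addition turns closure under products into a double
  induction; \<open>trig_poly_sumE\<close> recovers the form with a finite set of
  frequencies.\<close>

inductive trig_poly :: "(real \<Rightarrow> complex) \<Rightarrow> bool" where
  monomial: "trig_poly (\<lambda>t. c * trig m t)"
| add: "trig_poly f \<Longrightarrow> trig_poly g \<Longrightarrow> trig_poly (\<lambda>t. f t + g t)"

lemma trig_poly_const: "trig_poly (\<lambda>t. c)"
  using trig_poly.monomial[of c 0] by simp

lemma trig_poly_mult: "trig_poly f \<Longrightarrow> trig_poly g \<Longrightarrow> trig_poly (\<lambda>t. f t * g t)"
proof (induction rule: trig_poly.induct)
  case (monomial c m)
  then show ?case
  proof (induction rule: trig_poly.induct)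
    case (monomial d k)
    have "(\<lambda>t. c * trig m t * (d * trig k t)) = (\<lambda>t. (c * d) * trig (m + k) t)"
      by (auto simp: trig_add)
    then show ?case using trig_poly.monomial by metis
  next
    case (add f g)
    then show ?case by (simp add: distrib_left trig_poly.add)
  qed
next
  case (add f g)
  then show ?case by (simp add: distrib_right trig_poly.add)
qed

lemma trig_poly_sumE:
  assumes "trig_poly f"
  obtains M b where "finite M" "f = (\<lambda>t. \<Sum>m\<in>M. b m * trig m t)"
proof -
  from assms have "\<exists>M b. finite M \<and> f = (\<lambda>t. \<Sum>m\<in>M. b m * trig m t)"
  proof (induction rule: trig_poly.induct)
    case (monomial c m)
    show ?case by (rule exI[of _ "{m}"], rule exI[of _ "\<lambda>_. c"]) auto
  next
    case (add f g)
    then obtain M b N c where MN: "finite M" "finite N" and f: "f = (\<lambda>t. \<Sum>m\<in>M. b m * trig m t)"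
      and g: "g = (\<lambda>t. \<Sum>m\<in>N. c m * trig m t)" by blast
    let ?b = "\<lambda>m. (if m \<in> M then b m else 0)" and ?c = "\<lambda>m. (if m \<in> N then c m else 0)"
    have "f t = (\<Sum>m\<in>M \<union> N. ?b m * trig m t)" for t
      unfolding f using MN by (intro sum.mono_neutral_cong_left) auto
    moreover have "g t = (\<Sum>m\<in>M \<union> N. ?c m * trig m t)" for t
      unfolding g using MN by (intro sum.mono_neutral_cong_left) auto
    ultimately have "(\<lambda>t. f t + g t) = (\<lambda>t. \<Sum>m\<in>M \<union> N. (?b m + ?c m) * trig m t)"
      by (simp add: sum.distrib distrib_right)
    then show ?case using MN by (intro exI[of _ "M \<union> N"] exI[of _ "\<lambda>m. ?b m + ?c m"]) auto
  qed
  with that show thesis by blast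
qed

text \<open>A real linear functional on the plane is a complex combination of z and its conjugate,
  and on the circle these are the characters \<open>trig 1\<close> and \<open>trig (- 1)\<close>.
  Closure under sums and products does the rest.\<close>

lemma trig_poly_real_polynomial_function:
  assumes "real_polynomial_function q"
  shows "trig_poly (\<lambda>t. complex_of_real (q (trig 1 t)))"
  using assms
proof (induction rule: real_polynomial_function.induct)
  case (linear f)
  then interpret bounded_linear f .
  have "complex_of_real (f (trig 1 t)) = ((f 1 - \<i> * f \<i>) / 2) * trig 1 t + ((f 1 + \<i> * f \<i>) / 2) * trig (- 1) t" for t
  proof -
    have f: "f (x *\<^sub>R 1 + y *\<^sub>R \<i>) = x * f 1 + y * f \<i>" for x y
      by (simp only: add scaleR real_scaleR_def)
    have "trig 1 t = Re (trig 1 t) *\<^sub>R 1 + Im (trig 1 t) *\<^sub>R \<i>" by (simp add: complex_eq_iff)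
    from arg_cong[OF this, of f] have "f (trig 1 t) = Re (trig 1 t) * f 1 + Im (trig 1 t) * f \<i>"
      unfolding f .
    moreover have "trig (- 1) t = cnj (trig 1 t)" by (simp add: cnj_trig)
    ultimately show ?thesis by (simp add: complex_eq_iff field_simps)
  qed
  note eq = this
  show ?case unfolding eq by (intro trig_poly.add trig_poly.monomial)
next
  case (const c)
  then show ?case by (rule trig_poly_const)
qed (simp_all add: trig_poly.add trig_poly_mult)

lemma trig_poly_polynomial_function:
  fixes q :: "complex \<Rightarrow> complex"
  assumes "polynomial_function q"
  shows "trig_poly (\<lambda>t. q (trig 1 t))"
proof -
  have "real_polynomial_function (Re \<circ> q)" "real_polynomial_function (Im \<circ> q)"
    using assms by (auto simp: polynomial_function_def bounded_linear_Re bounded_linear_Im)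
  from this[THEN trig_poly_real_polynomial_function]
  have "trig_poly (\<lambda>t. complex_of_real (Re (q (trig 1 t))) + \<i> * complex_of_real (Im (q (trig 1 t))))"
    by (intro trig_poly.add trig_poly_mult trig_poly_const) (auto simp: o_def)
  then show ?thesis by (simp flip: complex_eq)
qed



text \<open>The first factor vanishes at \<open>z = 1\<close>, where \<^const>\<open>Arg2pi\<close> jumps.\<close>

lemma continuous_on_circle_lift:
  fixes c :: "real \<Rightarrow> complex"
  assumes c: "continuous_on UNIV c" and B: "\<And>t. cmod (c t) \<le> B"
  shows "continuous_on (sphere 0 1) (\<lambda>z. complex_of_real (min 1 (a * (1 - Re z))) * c (Arg2pi z / (2 * pi)))"
  unfolding continuous_on_eq_continuous_within
proof
  fix z :: complex assume z: "z \<in> sphere 0 1"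
  let ?\<chi> = "\<lambda>z. complex_of_real (min 1 (a * (1 - Re z)))"
  have \<chi>: "isCont ?\<chi> z" for z
    by (intro continuous_intros linear_continuous_at bounded_linear_Re)
  show "continuous (at z within sphere 0 1) (\<lambda>z. ?\<chi> z * c (Arg2pi z / (2 * pi)))"
  proof (cases "z \<in> \<real>\<^sub>\<ge>\<^sub>0")
    case False
    have c': "isCont c s" for s using c by (simp add: continuous_on_eq_continuous_at)
    have "isCont (\<lambda>z. Arg2pi z / (2 * pi)) z"
      by (intro isCont_divide continuous_at_Arg2pi[OF False] continuous_const) simp
    then have "isCont (\<lambda>z. c (Arg2pi z / (2 * pi))) z"
      by (rule isCont_o2[OF _ c'])
    then have "isCont (\<lambda>z. ?\<chi> z * c (Arg2pi z / (2 * pi))) z"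
      by (intro continuous_mult \<chi>)
    then show ?thesis by (rule continuous_at_imp_continuous_within)
  next
    case True
    then have z1: "z = 1" using z by (auto simp: nonneg_Reals_def)
    have lim: "(\<lambda>w. ?\<chi> w * c (Arg2pi w / (2 * pi))) \<midarrow>1\<rightarrow> 0"
    proof (rule Lim_null_comparison)
      show "\<forall>\<^sub>F w in at 1. cmod (?\<chi> w * c (Arg2pi w / (2 * pi))) \<le> cmod (?\<chi> w) * B"
        unfolding norm_mult using B by (intro always_eventually allI mult_left_mono) auto
      have "((\<lambda>w. cmod (?\<chi> w) * B) \<longlongrightarrow> cmod (?\<chi> 1) * B) (at 1)"
        using \<chi>[of 1] unfolding isCont_def by (intro tendsto_intros)
      then show "((\<lambda>w. cmod (?\<chi> w) * B) \<longlongrightarrow> 0) (at 1)" by simp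
    qed
    have "?\<chi> 1 * c (Arg2pi 1 / (2 * pi)) = 0" by simp
    with lim have "isCont (\<lambda>w. ?\<chi> w * c (Arg2pi w / (2 * pi))) 1"
      unfolding isCont_def by (simp only:)
    then show ?thesis unfolding z1 by (rule continuous_at_imp_continuous_within)
  qed
qed

section \<open>Mean square density of trigonometric polynomials\<close>

lemma space_unit: "space unit_measure = {0..<1}"
  by (simp add: space_restrict_space)

lemma AE_unit: "(AE t in lborel. P t) \<Longrightarrow> (AE t in unit_measure. P t)"
  by (subst AE_restrict_space_iff) (auto elim: AE_mp)

text \<open>Measurability gives continuous functions on the line converging to \<open>h\<close>
  almost everywhere. They are made bounded, cut off near the point where the interval closes up to a
  circle, and compared with \<open>h\<close> by dominated convergence; Stone-Weierstrass on the
  circle replaces one of them by a polynomial.\<close>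

lemma trig_poly_dense:
  assumes h: "bdd_borel h" and \<epsilon>: "0 < \<epsilon>"
  obtains T where "trig_poly T" "(LINT t|unit_measure. (cmod (h t - T t))\<^sup>2) \<le> \<epsilon>"
proof -
  obtain B where hm: "h \<in> borel_measurable borel" and hB: "\<And>t. cmod (h t) \<le> B" and B0: "0 \<le> B"
    using h by (metis bdd_borelE)
  have "h measurable_on UNIV"
    using hm by (intro lebesgue_measurable_imp_measurable_on) (auto intro: measurable_completion)
  then obtain N g where N: "negligible N" and g: "\<And>n::nat. continuous_on UNIV (g n)"
    and lim: "\<And>x. x \<notin> N \<Longrightarrow> (\<lambda>n. g n x) \<longlonglongrightarrow> h x"
    unfolding measurable_on_def by auto
  have cp: "continuous_on A (closest_point (cball 0 B))" for A :: "complex set"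
    using B0 by (intro continuous_on_closest_point) auto
  \<comment> \<open>Projection onto the closed disc of radius \<open>B\<close> is continuous and
    fixes the values of \<open>h\<close>, so convergence survives while the approximants acquire the
    common bound \<open>B\<close>.\<close>
  define c where "c n t = closest_point (cball 0 B) (g n t)" for n t
  have c_cont: "continuous_on UNIV (c n)" for n
    unfolding c_def[abs_def] by (rule continuous_on_compose2[OF cp[of UNIV] g]) auto
  have c_bd: "cmod (c n t) \<le> B" for n t
    using closest_point_in_set[of "cball 0 B :: complex set" "g n t"] B0 by (auto simp: c_def)
  have c_lim: "(\<lambda>n. c n t) \<longlonglongrightarrow> h t" if "t \<notin> N" for t
  proof -
    have "isCont (closest_point (cball 0 B)) (h t)"
      using cp[of UNIV] by (simp add: continuous_on_eq_continuous_at)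
    from isCont_tendsto_compose[OF this lim[OF that]] show ?thesis
      using hB[of t] by (simp add: c_def closest_point_self)
  qed
  \<comment> \<open>\<open>Arg2pi\<close> recovers the parameter in [0, 1) of a point of the circle.
    The cutoff restores continuity at z = 1, and at every other point of the circle it equals 1 for
    large \<open>n\<close>.\<close>
  define F where "F n z = complex_of_real (min 1 (real n * (1 - Re z))) * c n (Arg2pi z / (2 * pi))" for n z
  have F_cont: "continuous_on (sphere 0 1) (F n)" for n
    unfolding F_def[abs_def] by (rule continuous_on_circle_lift[OF c_cont c_bd])
  have F_bd: "cmod (F n (trig 1 t)) \<le> B" for n t
  proof -
    have "Re (trig 1 t) \<le> 1" using complex_Re_le_cmod[of "trig 1 t"] by simp
    then have "0 \<le> real n * (1 - Re (trig 1 t))" by simp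
    then have "\<bar>min 1 (real n * (1 - Re (trig 1 t)))\<bar> \<le> 1" by (simp add: abs_if min_def)
    then have "cmod (F n (trig 1 t)) \<le> 1 * B"
      unfolding F_def norm_mult by (intro mult_mono c_bd) auto
    then show ?thesis by simp
  qed
  have F_cont': "continuous_on UNIV (\<lambda>t. F n (trig 1 t))" for n
    by (rule continuous_on_compose2[OF F_cont]) (auto intro: continuous_intros)
  have F_bb: "bdd_borel (\<lambda>t. F n (trig 1 t))" for n
    by (rule bdd_borelI[OF borel_measurable_continuous_onI[OF F_cont'] F_bd])
  have F_lim: "(\<lambda>n. F n (trig 1 t)) \<longlonglongrightarrow> h t" if t: "t \<notin> N" "0 < t" "t < 1" for t
  proof -
    have "Arg2pi (trig 1 t) = 2 * pi * t"
      using t by (intro Arg2pi_unique[of 1]) (auto simp: trig_def cis_conv_exp)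
    then have Arg: "Arg2pi (trig 1 t) / (2 * pi) = t" by simp
    have "Re (trig 1 t) < 1"
    proof -
      have "Re (trig 1 t) \<noteq> 1"
      proof
        assume "Re (trig 1 t) = 1"
        moreover from this have "Im (trig 1 t) = 0" using cmod_power2[of "trig 1 t"] by simp
        ultimately have "trig 1 t = 1" by (simp add: complex_eq_iff)
        then have "Arg2pi (trig 1 t) = 0" by (intro Arg2pi_unique[of 1]) auto
        then show False using Arg t by simp
      qed
      with complex_Re_le_cmod[of "trig 1 t"] show ?thesis by simp
    qed
    then obtain k :: nat where k: "1 < k * (1 - Re (trig 1 t))"
      using reals_Archimedean3[of "1 - Re (trig 1 t)"] by auto
    have "F n (trig 1 t) = c n t" if "k \<le> n" for n
    proof -
      have "real k * (1 - Re (trig 1 t)) \<le> real n * (1 - Re (trig 1 t))"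
        using that \<open>Re (trig 1 t) < 1\<close> by (intro mult_right_mono) auto
      then show ?thesis unfolding F_def Arg using k by (simp add: min_def)
    qed
    then have "\<forall>\<^sub>F n in sequentially. c n t = F n (trig 1 t)"
      unfolding eventually_sequentially by (metis)
    then show ?thesis using c_lim[OF t(1)] by (rule Lim_transform_eventually[rotated])
  qed
  have AE_lim: "AE t in unit_measure. (\<lambda>n. (cmod (h t - F n (trig 1 t)))\<^sup>2) \<longlonglongrightarrow> 0"
  proof -
    have "AE t in lborel. t \<notin> N"
      using N by (subst AE_completion_iff[symmetric]) (simp add: negligible_iff_null_sets AE_not_in)
    then have 1: "AE t in unit_measure. t \<notin> N" by (rule AE_unit)
    have 2: "AE t in unit_measure. t \<noteq> 0" by (intro AE_unit AE_lborel_singleton)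
    have 3: "AE t in unit_measure. t \<in> {0..<1}" using AE_space[of unit_measure] by (simp add: space_unit)
    from 1 2 3 show ?thesis
    proof eventually_elim
      case (elim t)
      then have "(\<lambda>n. (cmod (h t - F n (trig 1 t)))\<^sup>2) \<longlonglongrightarrow> (cmod (h t - h t))\<^sup>2"
        by (intro tendsto_intros F_lim) auto
      then show ?case by simp
    qed
  qed
  have bb: "bdd_borel (\<lambda>t. complex_of_real ((cmod (f t))\<^sup>2))" if "bdd_borel f" for f
    using bdd_borel_mult[OF that bdd_borel_cnj[OF that]] by (simp add: complex_norm_square del: of_real_power)
  have sq_int: "integrable unit_measure (\<lambda>t. (cmod (f t))\<^sup>2)" if "bdd_borel f" for f
    using integrable_Re[OF bdd_borel_integrable[OF bb[OF that]]] by (simp del: of_real_power)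
  have "(\<lambda>n. LINT t|unit_measure. (cmod (h t - F n (trig 1 t)))\<^sup>2) \<longlonglongrightarrow> (LINT t|unit_measure. 0)"
  proof (rule integral_dominated_convergence[where w = "\<lambda>_. (2 * B)\<^sup>2"])
    show "(\<lambda>t. (cmod (h t - F n (trig 1 t)))\<^sup>2) \<in> borel_measurable unit_measure" for n
      by (rule borel_measurable_integrable[OF sq_int[OF bdd_borel_diff[OF h F_bb]]])
    show "AE t in unit_measure. norm ((cmod (h t - F n (trig 1 t)))\<^sup>2) \<le> (2 * B)\<^sup>2" for n
    proof (intro AE_I2)
      fix t
      have "cmod (h t - F n (trig 1 t)) \<le> 2 * B"
        using norm_triangle_ineq4[of "h t" "F n (trig 1 t)"] hB[of t] F_bd[of n t] by linarith
      from power_mono[OF this norm_ge_zero, of 2]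
      show "norm ((cmod (h t - F n (trig 1 t)))\<^sup>2) \<le> (2 * B)\<^sup>2" by simp
    qed
    show "integrable unit_measure (\<lambda>_. (2 * B)\<^sup>2)"
      by (rule finite_measure.integrable_const[OF finite_measure_unit])
  qed (simp, rule AE_lim)
  then have "\<forall>\<^sub>F n in sequentially. (LINT t|unit_measure. (cmod (h t - F n (trig 1 t)))\<^sup>2) < \<epsilon> / 4"
    using \<epsilon> by (intro order_tendstoD(2)) auto
  then obtain n where n: "(LINT t|unit_measure. (cmod (h t - F n (trig 1 t)))\<^sup>2) < \<epsilon> / 4"
    by (auto simp: eventually_sequentially)
  \<comment> \<open>The squared error is at most twice the sum of the two squared errors; with a
    mean of at most \<epsilon>/4 for each, the total stays within \<epsilon>.\<close>
  obtain q where q: "polynomial_function q" and qF: "\<And>z. z \<in> sphere 0 1 \<Longrightarrow> cmod (F n z - q z) < sqrt (\<epsilon> / 4)"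
    using Stone_Weierstrass_polynomial_function[OF compact_sphere F_cont[of n], of "sqrt (\<epsilon> / 4)"] \<epsilon> by auto
  have T: "trig_poly (\<lambda>t. q (trig 1 t))" by (rule trig_poly_polynomial_function[OF q])
  from trig_poly_sumE[OF T] obtain M b where "(\<lambda>t. q (trig 1 t)) = (\<lambda>t. \<Sum>m\<in>M. b m * trig m t)" by blast
  then have T_bb: "bdd_borel (\<lambda>t. q (trig 1 t))" by (simp add: bdd_borel_sum bdd_borel_mult)
  have "(LINT t|unit_measure. (cmod (h t - q (trig 1 t)))\<^sup>2)
     \<le> (LINT t|unit_measure. 2 * (cmod (h t - F n (trig 1 t)))\<^sup>2 + \<epsilon> / 2)"
  proof (rule integral_mono)
    fix t
    have "cmod (h t - q (trig 1 t)) \<le> cmod (h t - F n (trig 1 t)) + cmod (F n (trig 1 t) - q (trig 1 t))"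
      using norm_triangle_ineq[of "h t - F n (trig 1 t)" "F n (trig 1 t) - q (trig 1 t)"] by simp
    then have "(cmod (h t - q (trig 1 t)))\<^sup>2 \<le> (cmod (h t - F n (trig 1 t)) + cmod (F n (trig 1 t) - q (trig 1 t)))\<^sup>2"
      by (rule power_mono) simp
    also have "\<dots> \<le> 2 * (cmod (h t - F n (trig 1 t)))\<^sup>2 + 2 * (cmod (F n (trig 1 t) - q (trig 1 t)))\<^sup>2"
      using zero_le_power2[of "cmod (h t - F n (trig 1 t)) - cmod (F n (trig 1 t) - q (trig 1 t))"]
      unfolding power2_sum power2_diff by linarith
    also have "(cmod (F n (trig 1 t) - q (trig 1 t)))\<^sup>2 \<le> (sqrt (\<epsilon> / 4))\<^sup>2"
      using qF[of "trig 1 t"] by (intro power_mono) auto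
    finally show "(cmod (h t - q (trig 1 t)))\<^sup>2 \<le> 2 * (cmod (h t - F n (trig 1 t)))\<^sup>2 + \<epsilon> / 2"
      using \<epsilon> by simp
  qed (intro sq_int bdd_borel_diff h T_bb F_bb Bochner_Integration.integrable_add integrable_mult_right
       finite_measure.integrable_const[OF finite_measure_unit])+
  also have "\<dots> = 2 * (LINT t|unit_measure. (cmod (h t - F n (trig 1 t)))\<^sup>2) + \<epsilon> / 2"
  proof -
    have "measure unit_measure (space unit_measure) = 1"
      by (simp add: space_unit measure_restrict_space)
    then show ?thesis
      by (subst Bochner_Integration.integral_add)
         (simp_all add: sq_int bdd_borel_diff h F_bb finite_measure.integrable_const[OF finite_measure_unit])
  qed
  also have "\<dots> \<le> \<epsilon>" using n by simp
  finally show thesis using that T by blast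
qed

section \<open>Bessel's inequality and the energy of the residual\<close>

lemma bessel_unit:
  assumes "bdd_borel h" "finite M"
  shows "(\<Sum>m\<in>M. (cmod (fcoeff h m))\<^sup>2) \<le> (LINT t|unit_measure. (cmod (h t))\<^sup>2)"
proof -
  have "0 \<le> (LINT t|unit_measure. (cmod (h t - (\<Sum>m\<in>M. fcoeff h m * trig m t)))\<^sup>2)"
    by (rule integral_nonneg_AE) simp
  then show ?thesis unfolding integral_norm_diff_trig[OF assms] by simp
qed

text \<open>The upper half of Parseval's identity. By density some finite set \<open>N\<close> of
  frequencies captures the energy of \<open>h\<close> up to \<epsilon>; the part of \<open>N\<close>
  inside \<open>M\<close> is subtracted, and the part outside contributes at most
  \<open>D\<close>.\<close>

lemma residual_le:
  assumes h: "bdd_borel h" and M: "finite M"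
    and D: "\<And>N. finite N \<Longrightarrow> N \<inter> M = {} \<Longrightarrow> (\<Sum>m\<in>N. (cmod (fcoeff h m))\<^sup>2) \<le> D"
  shows "(LINT t|unit_measure. (cmod (h t - (\<Sum>m\<in>M. fcoeff h m * trig m t)))\<^sup>2) \<le> D"
proof (rule field_le_epsilon)
  fix \<epsilon> :: real assume "0 < \<epsilon>"
  from trig_poly_dense[OF h this] obtain T where "trig_poly T"
    and T: "(LINT t|unit_measure. (cmod (h t - T t))\<^sup>2) \<le> \<epsilon>" by blast
  then obtain N b where N: "finite N" and b: "T = (\<lambda>t. \<Sum>m\<in>N. b m * trig m t)"
    by (auto elim: trig_poly_sumE)
  have "(LINT t|unit_measure. (cmod (h t))\<^sup>2) - (\<Sum>m\<in>N. (cmod (fcoeff h m))\<^sup>2) \<le> \<epsilon>"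
    using T sum_nonneg[of N "\<lambda>m. (cmod (b m - fcoeff h m))\<^sup>2"]
    unfolding b integral_norm_diff_trig[OF h N] by simp
  moreover have "(\<Sum>m\<in>N. (cmod (fcoeff h m))\<^sup>2) \<le> (\<Sum>m\<in>M \<union> (N - M). (cmod (fcoeff h m))\<^sup>2)"
    using M N by (intro sum_mono2) auto
  moreover have "\<dots> = (\<Sum>m\<in>M. (cmod (fcoeff h m))\<^sup>2) + (\<Sum>m\<in>N - M. (cmod (fcoeff h m))\<^sup>2)"
    using M N by (intro sum.union_disjoint) auto
  moreover have "(\<Sum>m\<in>N - M. (cmod (fcoeff h m))\<^sup>2) \<le> D"
    using N by (intro D) auto
  ultimately show "(LINT t|unit_measure. (cmod (h t - (\<Sum>m\<in>M. fcoeff h m * trig m t)))\<^sup>2) \<le> D + \<epsilon>"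
    unfolding integral_norm_diff_trig[OF h M] by simp
qed



text \<open>Multiplication by the character of frequency \<open>l = - Min M\<close> makes all
  frequencies nonnegative and leaves the modulus unchanged, so the sum becomes a polynomial on the
  circle. As \<open>a 0\<close> is one of its coefficients, the Wiener norm dominates it.\<close>

lemma turan_nazarov_trigonometric:
  fixes a :: "int \<Rightarrow> complex"
  assumes M: "finite M" "0 \<in> M"
  shows "\<exists>\<Psi>\<in>borel_measurable lborel. (\<forall>t. 0 \<le> \<Psi> t) \<and>
      (\<integral>\<^sup>+t\<in>{0..1}. ennreal (\<Psi> t) \<partial>lborel) \<le> ennreal (10 * real (card M)) \<and>
      (AE t in lborel. cmod (a 0) \<le> cmod (\<Sum>m\<in>M. a m * trig m t) * exp (\<Psi> t))"
proof (cases "a 0 = 0")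
  case True
  then show ?thesis by (intro bexI[of _ "\<lambda>_. 0"]) auto
next
  case False
  define l where "l = - Min M"
  have l: "0 \<le> m + l" if "m \<in> M" for m using M that by (simp add: l_def)
  define p where "p = (\<Sum>m\<in>M. monom (a m) (nat (m + l)))"
  have coeff_p: "coeff p i = (\<Sum>m\<in>M. if nat (m + l) = i then a m else 0)" for i
    by (simp add: p_def coeff_sum)
  have "coeff p (nat l) = (\<Sum>m\<in>M. if m = 0 then a m else 0)"
    unfolding coeff_p using l l[OF M(2)] by (intro sum.cong refl) (auto simp: nat_eq_iff)
  then have c0: "coeff p (nat l) = a 0" using M by simp
  then have p: "p \<noteq> 0" using False by auto
  have "{i. coeff p i \<noteq> 0} \<subseteq> (\<lambda>m. nat (m + l)) ` M"
  proof
    fix i assume "i \<in> {i. coeff p i \<noteq> 0}"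
    then have "\<exists>m\<in>M. (if nat (m + l) = i then a m else 0) \<noteq> 0"
      unfolding coeff_p mem_Collect_eq by (rule contrapos_np) (auto intro: sum.neutral)
    then show "i \<in> (\<lambda>m. nat (m + l)) ` M" by (auto split: if_splits)
  qed
  then have card: "card {i. coeff p i \<noteq> 0} \<le> card M"
    using M by (meson card_image_le card_mono finite_imageI order_trans)
  have "cmod (a 0) \<le> wiener_norm p"
  proof -
    have "nat l \<le> degree p" using c0 False by (intro le_degree) auto
    then have "cmod (coeff p (nat l)) \<le> (\<Sum>i\<le>degree p. cmod (coeff p i))"
      by (intro member_le_sum) auto
    then show ?thesis by (simp add: c0 wiener_norm_def)
  qed
  have poly: "cmod (poly p (cis (2 * pi * t))) = cmod (\<Sum>m\<in>M. a m * trig m t)" for t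
  proof -
    have "poly p (cis (2 * pi * t)) = (\<Sum>m\<in>M. a m * trig (m + l) t)"
      unfolding p_def poly_sum
    proof (intro sum.cong refl)
      fix m assume "m \<in> M"
      have "cis (2 * pi * t) ^ nat (m + l) = cis (real (nat (m + l)) * (2 * pi * t))"
        by (rule Complex.DeMoivre)
      also have "real (nat (m + l)) = real_of_int (m + l)" using l[OF \<open>m \<in> M\<close>] by simp
      finally show "poly (monom (a m) (nat (m + l))) (cis (2 * pi * t)) = a m * trig (m + l) t"
        by (simp add: poly_monom trig_def mult_ac)
    qed
    also have "\<dots> = (\<Sum>m\<in>M. a m * trig m t) * trig l t"
      by (simp only: trig_add sum_distrib_right mult.assoc)
    finally show ?thesis by (simp add: norm_mult)
  qed
  from turan_nazarov[OF p] obtain \<Psi> where \<Psi>: "\<Psi> \<in> borel_measurable lborel" "\<forall>t. 0 \<le> \<Psi> t"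
    "(\<integral>\<^sup>+t\<in>{0..1}. ennreal (\<Psi> t) \<partial>lborel) \<le> ennreal (10 * real (card {i. coeff p i \<noteq> 0}))"
    "AE t in lborel. wiener_norm p \<le> cmod (poly p (cis (2 * pi * t))) * exp (\<Psi> t)" by blast
  show ?thesis
  proof (intro bexI[of _ \<Psi>] conjI \<Psi>)
    show "(\<integral>\<^sup>+t\<in>{0..1}. ennreal (\<Psi> t) \<partial>lborel) \<le> ennreal (10 * real (card M))"
      using card by (intro order_trans[OF \<Psi>(3)] ennreal_leI) simp
    show "AE t in lborel. cmod (a 0) \<le> cmod (\<Sum>m\<in>M. a m * trig m t) * exp (\<Psi> t)"
      using \<Psi>(4) unfolding poly
      by eventually_elim (use \<open>cmod (a 0) \<le> wiener_norm p\<close> in linarith)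
  qed
qed

text \<open>Let \<open>P\<close> be the part of the Fourier series with frequencies in
  \<open>M\<close>. Where \<open>h\<close> vanishes, |h - P| = |P|, and where moreover
  \<open>\<Psi>\<close> is below 40 n this is at least |fcoeff h 0| exp (- 40 n). These points fill
  at least half of the interval, while the mean square of h - P is at most \<open>D\<close>.\<close>

lemma fcoeff_0_le:
  assumes h: "bdd_borel h" and M: "finite M" "0 \<in> M"
    and Z: "emeasure lborel {t\<in>{0..<1}. h t \<noteq> 0} \<le> 1 / 4"
    and D: "\<And>N. finite N \<Longrightarrow> N \<inter> M = {} \<Longrightarrow> (\<Sum>m\<in>N. (cmod (fcoeff h m))\<^sup>2) \<le> D"
  shows "(cmod (fcoeff h 0))\<^sup>2 \<le> 2 * exp (80 * card M) * D"
proof -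
  define n where "n = real (card M)"
  have n: "1 \<le> n" using M by (auto simp: n_def Suc_le_eq card_gt_0_iff)
  define P where "P t = (\<Sum>m\<in>M. fcoeff h m * trig m t)" for t
  have P_bb: "bdd_borel P" unfolding P_def[abs_def] by (intro bdd_borel_sum bdd_borel_mult) auto
  obtain \<Psi> where \<Psi>m: "\<Psi> \<in> borel_measurable lborel" and \<Psi>0: "\<forall>t. 0 \<le> \<Psi> t"
    and \<Psi>i: "(\<integral>\<^sup>+t\<in>{0..1}. ennreal (\<Psi> t) \<partial>lborel) \<le> ennreal (10 * n)"
    and \<Psi>P: "AE t in lborel. cmod (fcoeff h 0) \<le> cmod (P t) * exp (\<Psi> t)"
    using turan_nazarov_trigonometric[OF M, of "fcoeff h"] unfolding n_def P_def by blast
  define A where "A = {t\<in>{0..<1}. h t \<noteq> 0}"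
  \<comment> \<open>The mean of \<open>\<Psi>\<close> is at most 10 n, so by Markov's inequality the
    level 40 n is reached on measure at most 1/4. Together with the 1/4 allowed for the support of
    \<open>h\<close> this leaves 1/2 for \<open>G\<close>.\<close>
  define B where "B = {t\<in>{0..<1}. 40 * n \<le> \<Psi> t}"
  define G where "G = {t\<in>{0..<1}. h t = 0 \<and> \<Psi> t < 40 * n}"
  have hm [measurable]: "h \<in> borel_measurable borel" by (rule bdd_borel_measurable[OF h])
  have \<Psi>m' [measurable]: "\<Psi> \<in> borel_measurable borel" using \<Psi>m by simp
  have sets [measurable]: "A \<in> sets borel" "B \<in> sets borel" "G \<in> sets borel"
    unfolding A_def B_def G_def by measurable
  have "emeasure lborel B \<le> ennreal (1 / 4)"
  proof -
    have "emeasure lborel B \<le> emeasure lborel {t\<in>{0..1}. 1 \<le> ennreal (1 / (40 * n)) * ennreal (\<Psi> t)}"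
    proof (rule emeasure_mono)
      show "B \<subseteq> {t\<in>{0..1}. 1 \<le> ennreal (1 / (40 * n)) * ennreal (\<Psi> t)}"
        unfolding B_def using n \<Psi>0 by (auto simp flip: ennreal_mult ennreal_1 simp: field_simps simp del: ennreal_1)
    qed measurable
    also have "\<dots> \<le> ennreal (1 / (40 * n)) * (\<integral>\<^sup>+t\<in>{0..1}. ennreal (\<Psi> t) \<partial>lborel)"
      by (intro nn_integral_Markov_inequality) measurable
    also have "\<dots> \<le> ennreal (1 / (40 * n)) * ennreal (10 * n)"
      by (intro mult_left_mono \<Psi>i) simp
    also have "\<dots> = ennreal (1 / 4)" using n by (simp flip: ennreal_mult)
    finally show ?thesis .
  qed
  moreover have "emeasure lborel A \<le> ennreal (1 / 4)"
    using Z unfolding A_def by (simp add: ennreal_divide_numeral[symmetric])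
  moreover have "1 \<le> emeasure lborel G + (emeasure lborel A + emeasure lborel B)"
  proof -
    have "1 = emeasure lborel {0..<1::real}" by simp
    also have "\<dots> \<le> emeasure lborel (G \<union> (A \<union> B))"
      by (intro emeasure_mono) (auto simp: A_def B_def G_def)
    also have "\<dots> \<le> emeasure lborel G + emeasure lborel (A \<union> B)"
      by (intro emeasure_subadditive) auto
    also have "emeasure lborel (A \<union> B) \<le> emeasure lborel A + emeasure lborel B"
      by (intro emeasure_subadditive) auto
    finally show ?thesis by (simp add: add_left_mono)
  qed
  ultimately have "1 \<le> emeasure lborel G + ennreal (1 / 2)"
  proof -
    assume 1: "emeasure lborel B \<le> ennreal (1 / 4)" "emeasure lborel A \<le> ennreal (1 / 4)"
      "1 \<le> emeasure lborel G + (emeasure lborel A + emeasure lborel B)"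
    have "emeasure lborel A + emeasure lborel B \<le> ennreal (1 / 4) + ennreal (1 / 4)"
      using 1 by (intro add_mono)
    also have "\<dots> = ennreal (1 / 2)" by (subst ennreal_plus[symmetric]) auto
    finally show ?thesis using 1(3) by (meson add_left_mono order_trans)
  qed
  moreover have G_fin: "emeasure lborel G \<le> 1"
  proof -
    have "G \<subseteq> {0..<1}" by (auto simp: G_def)
    from emeasure_mono[OF this, of lborel] show ?thesis by simp
  qed
  then have "emeasure lborel G = ennreal (measure lborel G)"
    by (intro emeasure_eq_ennreal_measure) (auto simp: top_unique)
  ultimately have "ennreal 1 \<le> ennreal (measure lborel G + 1 / 2)"
    by (subst ennreal_plus) simp_all
  then have mG: "1 / 2 \<le> measure lborel G"
    by (subst (asm) ennreal_le_iff) simp_all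
  have mG': "measure unit_measure G = measure lborel G"
    by (intro measure_restrict_space) (auto simp: G_def)
  have G_sets: "G \<in> sets unit_measure"
    by (auto simp: sets_restrict_space G_def intro!: image_eqI[of _ _ G] sets(3)[unfolded G_def])
  have res: "(LINT t|unit_measure. (cmod (h t - P t))\<^sup>2) \<le> D"
    unfolding P_def by (rule residual_le[OF h M(1) D])
  have "(cmod (fcoeff h 0))\<^sup>2 * (1 / 2) \<le> (cmod (fcoeff h 0))\<^sup>2 * measure unit_measure G"
    using mG mG' by (intro mult_left_mono) auto
  also have "\<dots> = (LINT t|unit_measure. (cmod (fcoeff h 0))\<^sup>2 * indicator G t)"
    using G_sets sets.sets_into_space[OF G_sets] by (simp add: Int_absorb2)
  also have "\<dots> \<le> (LINT t|unit_measure. exp (80 * n) * (cmod (h t - P t))\<^sup>2)"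
  proof (rule integral_mono_AE)
    show "integrable unit_measure (\<lambda>t. (cmod (fcoeff h 0))\<^sup>2 * indicator G t)"
      using G_sets finite_measure.emeasure_finite[OF finite_measure_unit, of G]
      by (intro integrable_mult_right integrable_real_indicator) (auto simp: top.not_eq_extremum)
    have "bdd_borel (\<lambda>t. (h t - P t) * cnj (h t - P t))"
      by (intro bdd_borel_mult bdd_borel_cnj bdd_borel_diff h P_bb)
    then have "integrable unit_measure (\<lambda>t. complex_of_real ((cmod (h t - P t))\<^sup>2))"
      unfolding complex_norm_square by (rule bdd_borel_integrable)
    from integrable_Re[OF this] show "integrable unit_measure (\<lambda>t. exp (80 * n) * (cmod (h t - P t))\<^sup>2)"
      by (intro integrable_mult_right) (simp del: of_real_power)
    show "AE t in unit_measure. (cmod (fcoeff h 0))\<^sup>2 * indicator G t \<le> exp (80 * n) * (cmod (h t - P t))\<^sup>2"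
      using AE_unit[OF \<Psi>P]
    proof eventually_elim
      case (elim t)
      show ?case
      proof (cases "t \<in> G")
        case True
        then have t: "h t = 0" "\<Psi> t < 40 * n" by (auto simp: G_def)
        have "cmod (fcoeff h 0) \<le> cmod (P t) * exp (40 * n)"
          using t(2) by (intro order_trans[OF elim] mult_left_mono) auto
        then have "(cmod (fcoeff h 0))\<^sup>2 \<le> (cmod (P t) * exp (40 * n))\<^sup>2"
          by (rule power_mono) simp
        also have "\<dots> = exp (80 * n) * (cmod (P t))\<^sup>2"
          by (simp add: power_mult_distrib exp_double[symmetric])
        finally show ?thesis using True t by simp
      qed simp
    qed
  qed
  also have "\<dots> \<le> exp (80 * n) * D"
    using res by simp
  finally show ?thesis by (simp add: n_def)
qed

subsection \<open>Periodization and the Fourier integral\<close>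


text \<open>Bounded support makes periodizations finite sums and boundedness makes every integral
  converge; square integrable functions are reached from this class by truncation at the
  end.\<close>

definition bdd_bounded_supp :: "(real \<Rightarrow> complex) \<Rightarrow> bool" where
  "bdd_bounded_supp f \<longleftrightarrow> bdd_borel f \<and> (\<exists>L. \<forall>x. f x \<noteq> 0 \<longrightarrow> \<bar>x\<bar> \<le> L)"

text \<open>The sign of the exponent is that of the truncated operator. There is no normalising
  factor, whence the factor 2 pi in Plancherel's inequality.\<close>

definition ft :: "(real \<Rightarrow> complex) \<Rightarrow> real \<Rightarrow> complex" where
  "ft f y = (LINT x|lborel. f x * cis (y * x))"

lemma bdd_bounded_suppE:
  assumes "bdd_bounded_supp f"
  obtains n :: nat where "bdd_borel f" "0 < n" "\<And>x. f x \<noteq> 0 \<Longrightarrow> \<bar>x\<bar> < n"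
proof -
  obtain L where L: "\<And>x. f x \<noteq> 0 \<Longrightarrow> \<bar>x\<bar> \<le> L" using assms by (auto simp: bdd_bounded_supp_def)
  obtain n :: nat where "max 0 L < n" using reals_Archimedean2 by blast
  then show thesis using that[of n] L assms by (fastforce simp: bdd_bounded_supp_def)
qed

lemma measurable_cis_mult: "(\<lambda>x. cis (y * x)) \<in> borel_measurable borel"
  by (intro borel_measurable_continuous_onI continuous_intros)

lemma bdd_borel_cis: "bdd_borel (\<lambda>x. cis (y * x))"
  by (rule bdd_borelI[OF measurable_cis_mult, of _ 1]) simp

lemma bdd_bounded_supp_mult: "bdd_bounded_supp f \<Longrightarrow> bdd_borel g \<Longrightarrow> bdd_bounded_supp (\<lambda>x. f x * g x)"
  unfolding bdd_bounded_supp_def by (auto intro: bdd_borel_mult)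

lemma bdd_bounded_supp_integrable:
  assumes "bdd_bounded_supp f"
  shows "integrable lborel f"
proof -
  obtain n :: nat where f: "bdd_borel f" and n: "\<And>x. f x \<noteq> 0 \<Longrightarrow> \<bar>x\<bar> < n"
    using assms by (metis bdd_bounded_suppE)
  obtain B where B: "f \<in> borel_measurable borel" "\<And>t. cmod (f t) \<le> B" "0 \<le> B" using f by (metis bdd_borelE)
  have "integrable lborel (\<lambda>x. B * indicator {- real n..real n} x)"
    by (intro integrable_mult_right integrable_real_indicator) (auto simp: emeasure_lborel_Icc_eq)
  then show ?thesis
  proof (rule Bochner_Integration.integrable_bound)
    show "AE x in lborel. cmod (f x) \<le> norm (B * indicator {- real n..real n} x)"
    proof (intro AE_I2)
      fix x
      show "cmod (f x) \<le> norm (B * indicator {- real n..real n} x)"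
        using B n[of x] by (cases "f x = 0") (auto simp: indicator_def abs_if split: if_splits)
    qed
  qed (use B in simp)
qed

lemma bdd_bounded_supp_affine:
  assumes "bdd_bounded_supp f" "c \<noteq> 0"
  shows "bdd_bounded_supp (\<lambda>x. f (a + c * x))"
proof -
  obtain n :: nat where f: "bdd_borel f" and n: "\<And>x. f x \<noteq> 0 \<Longrightarrow> \<bar>x\<bar> < n"
    using assms by (metis bdd_bounded_suppE)
  obtain B where B: "f \<in> borel_measurable borel" "\<And>t. cmod (f t) \<le> B" using f by (metis bdd_borelE)
  have "(\<lambda>x. f (a + c * x)) \<in> borel_measurable borel" using B(1) by measurable
  moreover have "\<bar>x\<bar> \<le> (n + \<bar>a\<bar>) / \<bar>c\<bar>" if "f (a + c * x) \<noteq> 0" for x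
  proof -
    have "\<bar>c * x\<bar> \<le> \<bar>a + c * x\<bar> + \<bar>a\<bar>" by linarith
    then have "\<bar>c\<bar> * \<bar>x\<bar> \<le> n + \<bar>a\<bar>" using n[OF that] by (simp add: abs_mult)
    then show ?thesis using assms(2) by (simp add: field_simps)
  qed
  ultimately show ?thesis unfolding bdd_bounded_supp_def bdd_borel_def using B(2) by blast
qed

lemma ft_affine:
  assumes "bdd_bounded_supp f" "c \<noteq> 0"
  shows "ft f y = complex_of_real \<bar>c\<bar> * cis (y * a) * ft (\<lambda>x. f (a + c * x)) (y * c)"
proof -
  have "ft f y = \<bar>c\<bar> *\<^sub>R (LINT x|lborel. f (a + c * x) * cis (y * (a + c * x)))"
    unfolding ft_def by (rule lborel_integral_real_affine[OF assms(2)])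
  also have "(\<lambda>x. f (a + c * x) * cis (y * (a + c * x))) = (\<lambda>x. cis (y * a) * (f (a + c * x) * cis (y * c * x)))"
    by (auto simp: distrib_left cis_mult[symmetric] mult_ac)
  finally show ?thesis unfolding ft_def by (simp add: scaleR_conv_of_real mult_ac)
qed

lemma measurable_ft [measurable]:
  assumes [measurable]: "f \<in> borel_measurable borel"
  shows "ft f \<in> borel_measurable borel"
proof -
  have [measurable]: "cis \<in> borel_measurable borel"
    by (intro borel_measurable_continuous_onI continuous_intros)
  have "(\<lambda>y. LINT x|lborel. f x * cis (y * x)) \<in> borel_measurable borel"
    by (rule lborel.borel_measurable_lebesgue_integral) measurable
  then show ?thesis unfolding ft_def[abs_def] .
qed

text \<open>The only translate containing x is the one with index floor x. The indices from - K to K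
  cover [- K, K + 1), which is not symmetric.\<close>

lemma indicator_tiling:
  "(\<Sum>k\<in>{- int K..int K}. indicator {of_int k..<of_int k + 1} x) = (indicator {- real K..<real K + 1} x :: real)"
proof -
  have "(\<Sum>k\<in>{- int K..int K}. indicator {of_int k..<of_int k + 1} x) = (\<Sum>k\<in>{- int K..int K}. if \<lfloor>x\<rfloor> = k then 1 else 0 :: real)"
    by (intro sum.cong refl) (auto simp: indicator_def floor_eq_iff)
  also have "\<dots> = (if \<lfloor>x\<rfloor> \<in> {- int K..int K} then 1 else 0)" by simp
  also have "\<dots> = indicator {- real K..<real K + 1} x"
    by (auto simp: indicator_def le_floor_iff floor_le_iff)
  finally show ?thesis .
qed

lemma nn_integral_tiling:
  assumes [measurable]: "w \<in> borel_measurable borel"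
  shows "(\<integral>\<^sup>+t. (\<Sum>k\<in>{- int K..int K}. w (t + of_int k)) \<partial>unit_measure)
    = (\<integral>\<^sup>+x\<in>{- real K..<real K + 1}. w x \<partial>lborel)"
proof -
  have "(\<integral>\<^sup>+x\<in>{- real K..<real K + 1}. w x \<partial>lborel)
    = (\<integral>\<^sup>+x. (\<Sum>k\<in>{- int K..int K}. w x * indicator {of_int k..<of_int k + 1} x) \<partial>lborel)"
  proof (intro nn_integral_cong)
    fix x
    have "w x * indicator {- real K..<real K + 1} x = w x * ennreal (indicator {- real K..<real K + 1} x)"
      by (simp add: ennreal_indicator)
    also have "\<dots> = w x * (\<Sum>k\<in>{- int K..int K}. ennreal (indicator {of_int k..<of_int k + 1} x))"
      unfolding indicator_tiling[symmetric] by (subst sum_ennreal) auto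
    finally show "w x * indicator {- real K..<real K + 1} x = (\<Sum>k\<in>{- int K..int K}. w x * indicator {of_int k..<of_int k + 1} x)"
      by (simp add: sum_distrib_left ennreal_indicator)
  qed
  also have "\<dots> = (\<Sum>k\<in>{- int K..int K}. \<integral>\<^sup>+x. w x * indicator {of_int k..<of_int k + 1} x \<partial>lborel)"
    by (intro nn_integral_sum) measurable
  also have "\<dots> = (\<Sum>k\<in>{- int K..int K}. \<integral>\<^sup>+t. w (t + of_int k) \<partial>unit_measure)"
  proof (intro sum.cong refl)
    fix k :: int
    have "(\<integral>\<^sup>+x. w x * indicator {of_int k..<of_int k + 1} x \<partial>lborel)
      = ennreal \<bar>1\<bar> * (\<integral>\<^sup>+t. w (of_int k + 1 * t) * indicator {of_int k..<of_int k + 1} (of_int k + 1 * t) \<partial>lborel)"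
      by (rule nn_integral_real_affine) auto
    also have "\<dots> = (\<integral>\<^sup>+t. w (t + of_int k) * indicator {0..<1} t \<partial>lborel)"
      by (auto intro!: nn_integral_cong simp: indicator_def add.commute)
    also have "\<dots> = (\<integral>\<^sup>+t. w (t + of_int k) \<partial>unit_measure)"
      by (rule nn_integral_restrict_space[symmetric]) simp
    finally show "(\<integral>\<^sup>+x. w x * indicator {of_int k..<of_int k + 1} x \<partial>lborel) = (\<integral>\<^sup>+t. w (t + of_int k) \<partial>unit_measure)" .
  qed
  also have "\<dots> = (\<integral>\<^sup>+t. (\<Sum>k\<in>{- int K..int K}. w (t + of_int k)) \<partial>unit_measure)"
    by (intro nn_integral_sum[symmetric] measurable_restrict_space1) measurable
  finally show ?thesis by simp
qed

lemma fcoeff_eq_ft: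
  assumes "\<And>x. g x \<noteq> 0 \<Longrightarrow> 0 \<le> x \<and> x < 1"
  shows "fcoeff g m = ft g (- 2 * pi * of_int m)"
proof -
  have "fcoeff g m = (LINT t|lborel. indicator {0..<1} t *\<^sub>R (g t * trig (- m) t))"
    unfolding fcoeff_def by (rule integral_restrict_space) simp
  also have "\<dots> = (LINT t|lborel. g t * cis (- 2 * pi * of_int m * t))"
    using assms by (intro Bochner_Integration.integral_cong refl) (auto simp: indicator_def trig_def)
  finally show ?thesis by (simp add: ft_def)
qed

text \<open>On [0, 1) this is the full sum over all integer translates as soon as the support of
  \<open>g\<close> lies in |x| < K; only the values there are used.\<close>

definition periodize :: "nat \<Rightarrow> (real \<Rightarrow> complex) \<Rightarrow> real \<Rightarrow> complex" where
  "periodize K g t = (\<Sum>k\<in>{- int K..int K}. g (t + of_int k))"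

lemma bdd_borel_shift:
  assumes "bdd_borel g"
  shows "bdd_borel (\<lambda>t. g (t + a))"
proof -
  obtain B where g [measurable]: "g \<in> borel_measurable borel" and B: "\<And>t. cmod (g t) \<le> B"
    using assms by (metis bdd_borelE)
  show ?thesis using B by (intro bdd_borelI[of _ B]) simp_all
qed

text \<open>The unfolding behind Poisson summation: the characters have period 1, so integrating the
  sum of translates over one period is integrating over the line. Coefficients of the periodization
  are thus samples of the transform.\<close>

lemma fcoeff_periodize:
  assumes g: "bdd_bounded_supp g" and K: "\<And>x. g x \<noteq> 0 \<Longrightarrow> \<bar>x\<bar> < real K"
  shows "fcoeff (periodize K g) m = ft g (- 2 * pi * of_int m)"
proof -
  define G where "G x = g x * trig (- m) x" for x
  have G: "bdd_bounded_supp G" unfolding G_def[abs_def] by (rule bdd_bounded_supp_mult[OF g]) simp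
  then have G_bb: "bdd_borel G" by (simp add: bdd_bounded_supp_def)
  have "periodize K g t * trig (- m) t = (\<Sum>k\<in>{- int K..int K}. G (t + of_int k))" for t
    by (simp add: periodize_def sum_distrib_right G_def trig_add_of_int)
  then have "fcoeff (periodize K g) m = (LINT t|unit_measure. (\<Sum>k\<in>{- int K..int K}. G (t + of_int k)))"
    by (simp add: fcoeff_def)
  also have "\<dots> = (\<Sum>k\<in>{- int K..int K}. LINT t|unit_measure. G (t + of_int k))"
    by (intro Bochner_Integration.integral_sum bdd_borel_integrable bdd_borel_shift G_bb)
  also have "\<dots> = (\<Sum>k\<in>{- int K..int K}. LINT x|lborel. indicator {of_int k..<of_int k + 1} x *\<^sub>R G x)"
  proof (intro sum.cong refl)
    fix k :: int
    have "(LINT x|lborel. indicator {of_int k..<of_int k + 1} x *\<^sub>R G x)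
      = \<bar>1\<bar> *\<^sub>R (LINT t|lborel. indicator {of_int k..<of_int k + 1} (of_int k + 1 * t) *\<^sub>R G (of_int k + 1 * t))"
      by (rule lborel_integral_real_affine) simp
    also have "\<dots> = (LINT t|lborel. indicator {0..<1} t *\<^sub>R G (t + of_int k))"
      by (simp add: indicator_def add.commute)
    also have "\<dots> = (LINT t|unit_measure. G (t + of_int k))"
      by (rule integral_restrict_space[symmetric]) simp
    finally show "(LINT t|unit_measure. G (t + of_int k)) = (LINT x|lborel. indicator {of_int k..<of_int k + 1} x *\<^sub>R G x)" by simp
  qed
  also have "\<dots> = (LINT x|lborel. (\<Sum>k\<in>{- int K..int K}. indicator {of_int k..<of_int k + 1} x *\<^sub>R G x))"
    by (intro Bochner_Integration.integral_sum[symmetric] integrable_mult_indicator bdd_bounded_supp_integrable G) simp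
  also have "\<dots> = (LINT x|lborel. g x * cis (- 2 * pi * of_int m * x))"
  proof (intro Bochner_Integration.integral_cong refl)
    fix x
    have "(\<Sum>k\<in>{- int K..int K}. indicator {of_int k..<of_int k + 1} x *\<^sub>R G x) = indicator {- real K..<real K + 1} x *\<^sub>R G x"
      unfolding indicator_tiling[symmetric] by (simp add: scaleR_sum_left)
    also have "\<dots> = G x" using K[of x] by (cases "g x = 0") (auto simp: G_def indicator_def)
    finally show "(\<Sum>k\<in>{- int K..int K}. indicator {of_int k..<of_int k + 1} x *\<^sub>R G x) = g x * cis (- 2 * pi * of_int m * x)"
      by (simp add: G_def trig_def)
  qed
  finally show ?thesis by (simp add: ft_def)
qed

text \<open>The periodization is nonzero only where some translate of \<open>g\<close> is, and
  unfolding bounds the measure of that set by the measure of the support. Hence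
  \<open>fcoeff_0_le\<close> applies to the periodization.\<close>

lemma ft_0_le_periodic:
  assumes g: "bdd_bounded_supp g" and S: "emeasure lborel {x. g x \<noteq> 0} \<le> 1 / 4"
    and M: "finite M" "0 \<in> M"
    and D: "\<And>N. finite N \<Longrightarrow> N \<inter> M = {} \<Longrightarrow> (\<Sum>m\<in>N. (cmod (ft g (- 2 * pi * of_int m)))\<^sup>2) \<le> D"
  shows "(cmod (ft g 0))\<^sup>2 \<le> 2 * exp (80 * card M) * D"
proof -
  obtain K :: nat where g_bb: "bdd_borel g" and K: "\<And>x. g x \<noteq> 0 \<Longrightarrow> \<bar>x\<bar> < K"
    using g by (metis bdd_bounded_suppE)
  have fc: "fcoeff (periodize K g) m = ft g (- 2 * pi * of_int m)" for m
    by (rule fcoeff_periodize[OF g]) (rule K)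
  let ?h = "periodize K g"
  have [measurable]: "g \<in> borel_measurable borel" by (rule bdd_borel_measurable[OF g_bb])
  have h_bb: "bdd_borel ?h"
    unfolding periodize_def[abs_def] by (intro bdd_borel_sum bdd_borel_shift g_bb)
  then have [measurable]: "?h \<in> borel_measurable borel" by (rule bdd_borel_measurable)
  have "emeasure lborel {t\<in>{0..<1}. ?h t \<noteq> 0} = (\<integral>\<^sup>+t. indicator {t\<in>{0..<1}. ?h t \<noteq> 0} t \<partial>lborel)"
    by (rule nn_integral_indicator[symmetric]) measurable
  also have "\<dots> \<le> (\<integral>\<^sup>+t\<in>{0..<1}. (\<Sum>k\<in>{- int K..int K}. indicator {x. g x \<noteq> 0} (t + of_int k)) \<partial>lborel)"
  proof (intro nn_integral_mono)
    fix t :: real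
    show "indicator {t\<in>{0..<1}. ?h t \<noteq> 0} t \<le> (\<Sum>k\<in>{- int K..int K}. indicator {x. g x \<noteq> 0} (t + of_int k)) * (indicator {0..<1} t :: ennreal)"
    proof (cases "t \<in> {t\<in>{0..<1}. ?h t \<noteq> 0}")
      case True
      then obtain k where k: "k \<in> {- int K..int K}" "g (t + of_int k) \<noteq> 0"
        unfolding periodize_def by (auto elim: sum.not_neutral_contains_not_neutral)
      then have "(1::ennreal) \<le> indicator {x. g x \<noteq> 0} (t + of_int k)" by simp
      also have "\<dots> \<le> (\<Sum>k\<in>{- int K..int K}. indicator {x. g x \<noteq> 0} (t + of_int k))"
        by (rule member_le_sum[OF k(1)]) auto
      finally show ?thesis using True by simp
    qed simp
  qed
  also have "\<dots> = (\<integral>\<^sup>+t. (\<Sum>k\<in>{- int K..int K}. indicator {x. g x \<noteq> 0} (t + of_int k)) \<partial>unit_measure)"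
    by (rule nn_integral_restrict_space[symmetric]) simp
  also have "\<dots> = (\<integral>\<^sup>+x\<in>{- real K..<real K + 1}. indicator {x. g x \<noteq> 0} x \<partial>lborel)"
    by (rule nn_integral_tiling) measurable
  also have "\<dots> \<le> (\<integral>\<^sup>+x. indicator {x. g x \<noteq> 0} x \<partial>lborel)"
    by (intro nn_integral_mono) (auto simp: indicator_def)
  also have "\<dots> = emeasure lborel {x. g x \<noteq> 0}"
    by (rule nn_integral_indicator) measurable
  finally have Z: "emeasure lborel {t\<in>{0..<1}. ?h t \<noteq> 0} \<le> 1 / 4"
    using S by (rule order_trans)
  have "(cmod (fcoeff ?h 0))\<^sup>2 \<le> 2 * exp (80 * card M) * D"
    by (rule fcoeff_0_le[OF h_bb M Z]) (unfold fc, rule D)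
  then show ?thesis unfolding fc by simp
qed

text \<open>Bessel's inequality for a rescaled copy of \<open>f\<close> supported in [0, 1) bounds
  the square sum of the transform over a lattice, and modulation extends this to every translate of
  the lattice. Integration over the translates unfolds to an integral over the line.\<close>

lemma plancherel_le:
  assumes f: "bdd_bounded_supp f"
  shows "(\<integral>\<^sup>+y. ennreal ((cmod (ft f y))\<^sup>2) \<partial>lborel) \<le> ennreal (2 * pi * (LINT x|lborel. (cmod (f x))\<^sup>2))"
proof -
  obtain n :: nat where f_bb: "bdd_borel f" and n0: "0 < n" and n: "\<And>x. f x \<noteq> 0 \<Longrightarrow> \<bar>x\<bar> < n"
    using f by (metis bdd_bounded_suppE)
  \<comment> \<open>The support lies in (- n, n), an interval of length \<open>L\<close>; the
    substitution in \<open>g\<close> carries it into [0, 1).\<close>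
  define L where "L = 2 * real n"
  have L: "0 < L" using n0 by (simp add: L_def)
  define g where "g x = f (- real n + L * x)" for x
  have g: "bdd_bounded_supp g" unfolding g_def[abs_def] using L by (intro bdd_bounded_supp_affine f) simp
  have gs: "0 \<le> x \<and> x < 1" if "g x \<noteq> 0" for x
  proof -
    have "\<bar>- real n + 2 * real n * x\<bar> < n" using n that by (auto simp: g_def L_def)
    then have "0 < real n * x" "real n * x < real n * 1" by auto
    then show ?thesis using n0 by (simp add: zero_less_mult_iff)
  qed
  define I where "I = (LINT x|lborel. (cmod (f x))\<^sup>2)"
  have g_int: "(LINT t|unit_measure. (cmod (g t))\<^sup>2) = I / L"
  proof -
    have "I = \<bar>L\<bar> *\<^sub>R (LINT x|lborel. (cmod (g x))\<^sup>2)"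
      unfolding I_def g_def using L by (intro lborel_integral_real_affine) simp
    moreover have "(LINT t|unit_measure. (cmod (g t))\<^sup>2) = (LINT t|lborel. indicator {0..<1} t *\<^sub>R (cmod (g t))\<^sup>2)"
      by (rule integral_restrict_space) simp
    moreover have "\<dots> = (LINT t|lborel. (cmod (g t))\<^sup>2)"
      using gs by (intro Bochner_Integration.integral_cong refl) (auto simp: indicator_def)
    ultimately show ?thesis using L by (simp add: field_simps)
  qed
  define w where "w u = ennreal ((cmod (ft f (- 2 * pi / L * u)))\<^sup>2)" for u
  have fm [measurable]: "f \<in> borel_measurable borel" by (rule bdd_borel_measurable[OF f_bb])
  have wm [measurable]: "w \<in> borel_measurable borel" unfolding w_def[abs_def] by measurable
  have le: "(\<Sum>k\<in>{- int K..int K}. w (t + of_int k)) \<le> ennreal (L * I)" for t K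
  proof -
    \<comment> \<open>Modulation by \<open>t\<close> moves the sample points from the integers to
      the integers shifted by \<open>t\<close>, without changing the energy.\<close>
    define gt where "gt x = g x * cis (- 2 * pi * t * x)" for x
    have gt: "bdd_borel gt" unfolding gt_def[abs_def]
      using g by (intro bdd_borel_mult bdd_borel_cis) (simp add: bdd_bounded_supp_def)
    have fcgt: "fcoeff gt k = ft g (- 2 * pi * (t + of_int k))" for k
    proof -
      have "fcoeff gt k = ft gt (- 2 * pi * of_int k)"
        by (rule fcoeff_eq_ft) (use gs in \<open>auto simp: gt_def\<close>)
      also have "\<dots> = ft g (- 2 * pi * (t + of_int k))"
        unfolding ft_def gt_def by (simp add: mult.assoc cis_mult) (simp add: algebra_simps)
      finally show ?thesis .
    qed
    have eq: "(cmod (ft f (- 2 * pi / L * (t + of_int k))))\<^sup>2 = L\<^sup>2 * (cmod (fcoeff gt k))\<^sup>2" for k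
    proof -
      have "ft f (- 2 * pi / L * (t + of_int k)) = complex_of_real \<bar>L\<bar> * cis (- 2 * pi / L * (t + of_int k) * (- real n)) * ft g (- 2 * pi / L * (t + of_int k) * L)"
        unfolding g_def[abs_def] using L by (intro ft_affine f) simp
      also have "- 2 * pi / L * (t + of_int k) * L = - 2 * pi * (t + of_int k)" using L by simp
      finally show ?thesis using L by (simp add: norm_mult power_mult_distrib fcgt)
    qed
    have "(\<Sum>k\<in>{- int K..int K}. w (t + of_int k)) = ennreal (L\<^sup>2 * (\<Sum>k\<in>{- int K..int K}. (cmod (fcoeff gt k))\<^sup>2))"
      unfolding w_def eq by (subst sum_ennreal) (auto simp: sum_distrib_left)
    also have "\<dots> \<le> ennreal (L\<^sup>2 * (LINT t|unit_measure. (cmod (gt t))\<^sup>2))"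
      by (intro ennreal_leI mult_left_mono bessel_unit gt) auto
    also have "(LINT t|unit_measure. (cmod (gt t))\<^sup>2) = I / L"
      unfolding g_int[symmetric] by (simp add: gt_def norm_mult)
    also have "L\<^sup>2 * (I / L) = L * I" using L by (simp add: power2_eq_square)
    finally show ?thesis .
  qed
  have part: "(\<integral>\<^sup>+x\<in>{- real K..<real K + 1}. w x \<partial>lborel) \<le> ennreal (L * I)" for K
  proof -
    have "(\<integral>\<^sup>+x\<in>{- real K..<real K + 1}. w x \<partial>lborel) = (\<integral>\<^sup>+t. (\<Sum>k\<in>{- int K..int K}. w (t + of_int k)) \<partial>unit_measure)"
      by (rule nn_integral_tiling[symmetric]) measurable
    also have "\<dots> \<le> (\<integral>\<^sup>+t. ennreal (L * I) \<partial>unit_measure)"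
      by (intro nn_integral_mono le)
    also have "\<dots> = ennreal (L * I)"
      by (simp add: space_unit emeasure_restrict_space)
    finally show ?thesis .
  qed
  have "(\<integral>\<^sup>+x. w x \<partial>lborel) = (\<integral>\<^sup>+x. (SUP K. w x * indicator {- real K..<real K + 1} x) \<partial>lborel)"
  proof (intro nn_integral_cong antisym)
    fix x :: real
    obtain K :: nat where "\<bar>x\<bar> < K" using reals_Archimedean2 by blast
    then have "x \<in> {- real K..<real K + 1}" by auto
    then have "w x = w x * indicator {- real K..<real K + 1} x" by simp
    also have "\<dots> \<le> (SUP K. w x * indicator {- real K..<real K + 1} x)" by (rule SUP_upper) simp
    finally show "w x \<le> (SUP K. w x * indicator {- real K..<real K + 1} x)" .
    show "(SUP K. w x * indicator {- real K..<real K + 1} x) \<le> w x"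
      by (intro SUP_least) (simp add: indicator_def)
  qed
  also have "\<dots> = (SUP K. \<integral>\<^sup>+x\<in>{- real K..<real K + 1}. w x \<partial>lborel)"
    by (intro nn_integral_monotone_convergence_SUP)
       (auto simp: incseq_def le_fun_def indicator_def intro!: mult_left_mono)
  also have "\<dots> \<le> ennreal (L * I)" by (intro SUP_least part)
  finally have "(\<integral>\<^sup>+x. w x \<partial>lborel) \<le> ennreal (L * I)" .
  moreover have "(\<integral>\<^sup>+y. ennreal ((cmod (ft f y))\<^sup>2) \<partial>lborel) = ennreal \<bar>- 2 * pi / L\<bar> * (\<integral>\<^sup>+x. w x \<partial>lborel)"
  proof -
    have "(\<integral>\<^sup>+y. ennreal ((cmod (ft f y))\<^sup>2) \<partial>lborel) = ennreal \<bar>- 2 * pi / L\<bar> * (\<integral>\<^sup>+x. ennreal ((cmod (ft f (0 + - 2 * pi / L * x)))\<^sup>2) \<partial>lborel)"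
      using L by (intro nn_integral_real_affine) auto
    then show ?thesis by (simp add: w_def)
  qed
  ultimately have "(\<integral>\<^sup>+y. ennreal ((cmod (ft f y))\<^sup>2) \<partial>lborel) \<le> ennreal \<bar>- 2 * pi / L\<bar> * ennreal (L * I)"
    by (simp add: mult_left_mono)
  also have "\<dots> = ennreal (\<bar>- 2 * pi / L\<bar> * (L * I))"
    by (rule ennreal_mult[symmetric]) (use L in \<open>auto simp: I_def intro!: mult_nonneg_nonneg\<close>)
  also have "\<bar>- 2 * pi / L\<bar> * (L * I) = 2 * pi * I" using L by (simp add: abs_mult)
  finally show ?thesis unfolding I_def .
qed

subsection \<open>Random dilations\<close>


text \<open>The interval [r / 2, r] holds at most r / 2 + 1 integers with reciprocals at most 2 / r
  each, so the sum is at most 1 + 2 / r, and r \<ge> 1 unless there is nothing to sum.\<close>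

lemma sum_inverse_dyadic_le:
  fixes r :: real and A :: "int set"
  assumes A: "finite A" "\<And>m. m \<in> A \<Longrightarrow> 1 \<le> m \<and> real_of_int m \<le> r \<and> r \<le> 2 * real_of_int m"
  shows "(\<Sum>m\<in>A. 1 / real_of_int m) \<le> 3"
proof (cases "A = {}")
  case False
  then have r: "1 \<le> r" using A(2) by force
  have "A \<subseteq> {\<lceil>r / 2\<rceil>..\<lfloor>r\<rfloor>}"
  proof
    fix m assume "m \<in> A"
    from A(2)[OF this] show "m \<in> {\<lceil>r / 2\<rceil>..\<lfloor>r\<rfloor>}" by (auto simp: le_floor_iff ceiling_le_iff)
  qed
  then have "card A \<le> nat (\<lfloor>r\<rfloor> - \<lceil>r / 2\<rceil> + 1)"
    using card_mono[of "{\<lceil>r / 2\<rceil>..\<lfloor>r\<rfloor>}" A] by simp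
  moreover have "real (nat (\<lfloor>r\<rfloor> - \<lceil>r / 2\<rceil> + 1)) \<le> r / 2 + 1"
    using r by linarith
  ultimately have card: "real (card A) \<le> r / 2 + 1" by linarith
  have "(\<Sum>m\<in>A. 1 / real_of_int m) \<le> of_nat (card A) * (2 / r)"
  proof (rule sum_bounded_above)
    fix m assume "m \<in> A"
    from A(2)[OF this] r show "1 / real_of_int m \<le> 2 / r" by (simp add: field_simps)
  qed
  also have "\<dots> \<le> (r / 2 + 1) * (2 / r)"
    using card r by (intro mult_right_mono) auto
  also have "\<dots> \<le> 3" using r by (simp add: field_simps)
  finally show ?thesis .
qed simp

text \<open>All members of \<open>A\<close> have the sign of \<open>r\<close>, so taking absolute
  values is injective on \<open>A\<close> and reduces to the positive case.\<close>

lemma sum_inverse_dyadic_le_sgn: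
  fixes r :: real and A :: "int set"
  assumes A: "finite A" "\<And>m. m \<in> A \<Longrightarrow> m \<noteq> 0 \<and> 1 \<le> r / of_int m \<and> r / of_int m \<le> 2"
  shows "(\<Sum>m\<in>A. 1 / \<bar>real_of_int m\<bar>) \<le> 3"
proof -
  have pos: "(0 < r \<longrightarrow> 0 < m) \<and> (r < 0 \<longrightarrow> m < 0) \<and> r \<noteq> 0 \<and> \<bar>real_of_int m\<bar> \<le> \<bar>r\<bar> \<and> \<bar>r\<bar> \<le> 2 * \<bar>real_of_int m\<bar>"
    if "m \<in> A" for m
  proof -
    have q: "0 < r / of_int m" using A(2)[OF that] by linarith
    then have "\<bar>r\<bar> = r / of_int m * \<bar>real_of_int m\<bar>"
      by (metis abs_div abs_mult abs_of_pos divide_eq_0_iff nonzero_eq_divide_eq order_less_irrefl)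
    moreover have "1 * \<bar>real_of_int m\<bar> \<le> r / of_int m * \<bar>real_of_int m\<bar>"
      "r / of_int m * \<bar>real_of_int m\<bar> \<le> 2 * \<bar>real_of_int m\<bar>"
      using A(2)[OF that] by (intro mult_right_mono; simp)+
    ultimately show ?thesis using q by (auto simp: zero_less_divide_iff)
  qed
  have inj: "inj_on abs A"
  proof (rule inj_onI)
    fix m k assume mk: "m \<in> A" "k \<in> A" "\<bar>m\<bar> = \<bar>k\<bar>"
    show "m = k" using pos[OF mk(1)] pos[OF mk(2)] mk(3) by linarith
  qed
  have "(\<Sum>m\<in>A. 1 / \<bar>real_of_int m\<bar>) = (\<Sum>m\<in>abs ` A. 1 / real_of_int m)"
    using inj by (simp add: sum.reindex)
  also have "\<dots> \<le> 3"
  proof (rule sum_inverse_dyadic_le[where r = "\<bar>r\<bar>"])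
    fix m assume "m \<in> abs ` A"
    then obtain k where "k \<in> A" "m = \<bar>k\<bar>" by blast
    with pos[of k] A(2)[of k] show "1 \<le> m \<and> real_of_int m \<le> \<bar>r\<bar> \<and> \<bar>r\<bar> \<le> 2 * real_of_int m" by auto
  qed (use A in simp)
  finally show ?thesis .
qed

text \<open>After the exchange of sum and integral, the substitution x = c u m in each term gives
  \<open>w x\<close> the total weight of all 1 / |c m| with x / (c m) in [1, 2]. These m form a
  dyadic block, where the sum of reciprocals is at most 3. The index 0 is excluded because no
  dilation moves the point 0.\<close>

lemma nn_integral_dilations_le:
  fixes w :: "real \<Rightarrow> ennreal"
  assumes [measurable]: "w \<in> borel_measurable borel" and c: "c \<noteq> 0"
  shows "(\<integral>\<^sup>+u\<in>{1..2}. (\<integral>\<^sup>+m. w (c * u * of_int m) \<partial>count_space (UNIV - {0::int})) \<partial>lborel)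
    \<le> ennreal (3 / \<bar>c\<bar>) * (\<integral>\<^sup>+x. w x \<partial>lborel)"
proof -
  let ?C = "count_space (UNIV - {0::int})"
  have "(\<integral>\<^sup>+u\<in>{1..2}. (\<integral>\<^sup>+m. w (c * u * of_int m) \<partial>?C) \<partial>lborel)
    = (\<integral>\<^sup>+u. (\<integral>\<^sup>+m. w (c * u * of_int m) * indicator {1..2} u \<partial>?C) \<partial>lborel)"
    by (intro nn_integral_cong nn_integral_multc[symmetric]) simp
  also have "\<dots> = (\<integral>\<^sup>+m. (\<integral>\<^sup>+u. w (c * u * of_int m) * indicator {1..2} u \<partial>lborel) \<partial>?C)"
    by (rule nn_integral_count_space_nn_integral) auto
  also have "\<dots> = (\<integral>\<^sup>+m. (\<integral>\<^sup>+x. w x * ennreal (1 / \<bar>c * of_int m\<bar>) * indicator {1..2} (x / (c * of_int m)) \<partial>lborel) \<partial>?C)"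
  proof (rule nn_integral_cong)
    fix m assume "m \<in> space ?C"
    then have m: "m \<noteq> 0" by simp
    let ?d = "1 / (c * of_int m)"
    have d: "?d \<noteq> 0" using m c by simp
    have "(\<integral>\<^sup>+u. w (c * u * of_int m) * indicator {1..2} u \<partial>lborel) =
      ennreal \<bar>?d\<bar> * (\<integral>\<^sup>+x. w (c * (0 + ?d * x) * of_int m) * indicator {1..2} (0 + ?d * x) \<partial>lborel)"
      by (rule nn_integral_real_affine[OF _ d]) measurable
    also have "\<dots> = (\<integral>\<^sup>+x. ennreal \<bar>?d\<bar> * (w (c * (0 + ?d * x) * of_int m) * indicator {1..2} (0 + ?d * x)) \<partial>lborel)"
      by (rule nn_integral_cmult[symmetric]) measurable
    also have "\<dots> = (\<integral>\<^sup>+x. w x * ennreal (1 / \<bar>c * of_int m\<bar>) * indicator {1..2} (x / (c * of_int m)) \<partial>lborel)"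
    proof (rule nn_integral_cong)
      fix x
      have "c * (0 + ?d * x) * of_int m = x" "0 + ?d * x = x / (c * of_int m)" "\<bar>?d\<bar> = 1 / \<bar>c * of_int m\<bar>"
        using m c by auto
      then show "ennreal \<bar>?d\<bar> * (w (c * (0 + ?d * x) * of_int m) * indicator {1..2} (0 + ?d * x))
        = w x * ennreal (1 / \<bar>c * of_int m\<bar>) * indicator {1..2} (x / (c * of_int m))"
        by (simp only: mult_ac)
    qed
    finally show "(\<integral>\<^sup>+u. w (c * u * of_int m) * indicator {1..2} u \<partial>lborel)
      = (\<integral>\<^sup>+x. w x * ennreal (1 / \<bar>c * of_int m\<bar>) * indicator {1..2} (x / (c * of_int m)) \<partial>lborel)" .
  qed
  also have "\<dots> = (\<integral>\<^sup>+x. (\<integral>\<^sup>+m. w x * ennreal (1 / \<bar>c * of_int m\<bar>) * indicator {1..2} (x / (c * of_int m)) \<partial>?C) \<partial>lborel)"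
    by (rule nn_integral_count_space_nn_integral[symmetric]) auto
  also have "\<dots> \<le> (\<integral>\<^sup>+x. ennreal (3 / \<bar>c\<bar>) * w x \<partial>lborel)"
  proof (rule nn_integral_mono)
    fix x
    have eq: "(\<integral>\<^sup>+m. w x * ennreal (1 / \<bar>c * of_int m\<bar>) * indicator {1..2} (x / (c * of_int m)) \<partial>?C)
      = w x * (\<integral>\<^sup>+m. ennreal (1 / \<bar>c * of_int m\<bar>) * indicator {1..2} (x / (c * of_int m)) \<partial>?C)"
      unfolding mult.assoc by (rule nn_integral_cmult) simp
    have le: "(\<integral>\<^sup>+m. ennreal (1 / \<bar>c * of_int m\<bar>) * indicator {1..2} (x / (c * of_int m)) \<partial>?C) \<le> ennreal (3 / \<bar>c\<bar>)"
    proof -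
      define r where "r = x / c"
      define A where "A = {m::int. m \<noteq> 0 \<and> 1 \<le> r / of_int m \<and> r / of_int m \<le> 2}"
      have "A \<subseteq> {- \<lceil>\<bar>r\<bar>\<rceil>..\<lceil>\<bar>r\<bar>\<rceil>}"
      proof
        fix m assume "m \<in> A"
        then have m: "m \<noteq> 0" "1 \<le> r / of_int m" by (auto simp: A_def)
        then have "1 \<le> \<bar>r / of_int m\<bar>" by linarith
        then have "1 * \<bar>real_of_int m\<bar> \<le> \<bar>r / of_int m\<bar> * \<bar>real_of_int m\<bar>"
          by (rule mult_right_mono) simp
        also have "\<dots> = \<bar>r\<bar>" using m by (simp add: abs_divide)
        finally have "\<bar>real_of_int m\<bar> \<le> of_int \<lceil>\<bar>r\<bar>\<rceil>" by linarith
        then show "m \<in> {- \<lceil>\<bar>r\<bar>\<rceil>..\<lceil>\<bar>r\<bar>\<rceil>}" by simp linarith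
      qed
      then have A: "finite A" by (rule finite_subset) simp
      have rx: "x / (c * of_int m) = r / of_int m" for m by (simp add: r_def)
      have "(\<integral>\<^sup>+m. ennreal (1 / \<bar>c * of_int m\<bar>) * indicator {1..2} (x / (c * of_int m)) \<partial>?C)
        = (\<Sum>m\<in>A. ennreal (1 / \<bar>c * of_int m\<bar>) * indicator {1..2} (x / (c * of_int m)))"
      proof (rule nn_integral_count_space'[OF A])
        show "A \<subseteq> UNIV - {0}" by (auto simp: A_def)
      qed (auto simp: A_def rx indicator_def)
      also have "\<dots> = (\<Sum>m\<in>A. ennreal (1 / \<bar>c * of_int m\<bar>))"
        by (intro sum.cong refl) (auto simp: A_def rx indicator_def)
      also have "\<dots> = ennreal (1 / \<bar>c\<bar> * (\<Sum>m\<in>A. 1 / \<bar>real_of_int m\<bar>))"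
        by (subst sum_ennreal) (auto simp: sum_distrib_left abs_mult)
      also have "\<dots> \<le> ennreal (1 / \<bar>c\<bar> * 3)"
        by (intro ennreal_leI mult_left_mono sum_inverse_dyadic_le_sgn[OF A, of r]) (auto simp: A_def)
      finally show ?thesis by simp
    qed
    show "(\<integral>\<^sup>+m. w x * ennreal (1 / \<bar>c * of_int m\<bar>) * indicator {1..2} (x / (c * of_int m)) \<partial>?C) \<le> ennreal (3 / \<bar>c\<bar>) * w x"
      unfolding eq mult.commute[of _ "w x"] using le by (rule mult_left_mono) simp
  qed
  also have "\<dots> = ennreal (3 / \<bar>c\<bar>) * (\<integral>\<^sup>+x. w x \<partial>lborel)"
    by (rule nn_integral_cmult) simp
  finally show ?thesis .
qed

text \<open>The average over u in [1, 2] is at most 6 / |c|. If every u gave at least 7 / |c| the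
  average would be too large, so some dilation stays within that bound.\<close>

lemma good_dilation:
  fixes w :: "real \<Rightarrow> ennreal"
  assumes w [measurable]: "w \<in> borel_measurable borel" and c: "c \<noteq> 0"
    and le: "(\<integral>\<^sup>+x. w x \<partial>lborel) \<le> 2"
  obtains u where "1 \<le> u" "u \<le> 2"
    "\<And>N. finite N \<Longrightarrow> 0 \<notin> N \<Longrightarrow> (\<Sum>m\<in>N. w (c * u * of_int m)) \<le> ennreal (7 / \<bar>c\<bar>)"
proof -
  define X where "X u = (\<integral>\<^sup>+m. w (c * u * of_int m) \<partial>count_space (UNIV - {0::int}))" for u
  have "\<exists>u\<in>{1..2}. X u \<le> ennreal (7 / \<bar>c\<bar>)"
  proof (rule ccontr)
    assume "\<not> ?thesis"
    then have X: "\<And>u. u \<in> {1..2} \<Longrightarrow> ennreal (7 / \<bar>c\<bar>) \<le> X u" by (auto simp: not_le intro: less_imp_le)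
    have "ennreal (7 / \<bar>c\<bar>) = (\<integral>\<^sup>+u\<in>{1..2::real}. ennreal (7 / \<bar>c\<bar>) \<partial>lborel)"
      by (simp add: nn_integral_cmult)
    also have "\<dots> \<le> (\<integral>\<^sup>+u\<in>{1..2}. X u \<partial>lborel)"
      using X by (intro nn_integral_mono) (auto simp: indicator_def)
    also have "\<dots> \<le> ennreal (3 / \<bar>c\<bar>) * (\<integral>\<^sup>+x. w x \<partial>lborel)"
      unfolding X_def by (rule nn_integral_dilations_le[OF w c])
    also have "\<dots> \<le> ennreal (3 / \<bar>c\<bar>) * ennreal 2"
      using le by (intro mult_left_mono) auto
    also have "\<dots> = ennreal (6 / \<bar>c\<bar>)"
      by (subst ennreal_mult[symmetric]) auto
    finally show False using c by (simp add: ennreal_le_iff divide_le_cancel)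
  qed
  then obtain u where u: "u \<in> {1..2}" "X u \<le> ennreal (7 / \<bar>c\<bar>)" by blast
  have "(\<Sum>m\<in>N. w (c * u * of_int m)) \<le> ennreal (7 / \<bar>c\<bar>)" if N: "finite N" "0 \<notin> N" for N
  proof -
    have "(\<Sum>m\<in>N. w (c * u * of_int m)) = (\<integral>\<^sup>+m. w (c * u * of_int m) * indicator N m \<partial>count_space (UNIV - {0::int}))"
      using N by (subst nn_integral_count_space'[of N]) auto
    also have "\<dots> \<le> X u"
      unfolding X_def by (intro nn_integral_mono) (auto simp: indicator_def)
    finally show ?thesis using u(2) by (rule order_trans)
  qed
  with u(1) that show thesis by auto
qed

subsection \<open>The uncertainty inequality\<close>


text \<open>A single dilation must make two things small: the number of nonzero sample points in
  \<open>\<Sigma>\<close>, and the energy of the samples outside. Both are read off from one weight,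
  to which \<open>good_dilation\<close> is applied; \<open>ft_0_le_periodic\<close> then takes the
  samples in \<open>\<Sigma>\<close> as its exceptional frequencies.\<close>

lemma ft_0_le:
  assumes f: "bdd_bounded_supp f" and s: "0 < s" "emeasure lborel {x. f x \<noteq> 0} \<le> ennreal s"
    and \<Sigma> [measurable]: "\<Sigma> \<in> sets borel" and \<sigma>: "0 < \<sigma>" "emeasure lborel \<Sigma> \<le> ennreal \<sigma>"
    and D: "0 < D" "(\<integral>\<^sup>+y\<in>-\<Sigma>. ennreal ((cmod (ft f y))\<^sup>2) \<partial>lborel) \<le> ennreal D"
  shows "(cmod (ft f 0))\<^sup>2 \<le> 20 * s * exp (80 + 800 * (s * \<sigma>)) * D"
proof -
  have [measurable]: "f \<in> borel_measurable borel"
    using f by (auto simp: bdd_bounded_supp_def bdd_borel_def)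
  \<comment> \<open>Compressing \<open>f\<close> by v = u / (8 s) turns the frequencies - 2 pi m
    into c u m for this \<open>c\<close>. The bound 7 / |c| = 28 s / pi \<le> 10 s follows from pi >
    3.\<close>
  define c where "c = - pi / (4 * s)"
  have c: "c \<noteq> 0" "7 / \<bar>c\<bar> \<le> 10 * s"
    using s(1) pi_gt3 by (auto simp: c_def field_simps)
  \<comment> \<open>Both summands are normalised to have integral at most 1.\<close>
  define w where "w x = ennreal (1 / \<sigma>) * indicator \<Sigma> x
      + ennreal (1 / D) * (ennreal ((cmod (ft f x))\<^sup>2) * indicator (- \<Sigma>) x)" for x
  have wm: "w \<in> borel_measurable borel" unfolding w_def[abs_def] by measurable
  have "(\<integral>\<^sup>+x. w x \<partial>lborel) = ennreal (1 / \<sigma>) * emeasure lborel \<Sigma>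
      + ennreal (1 / D) * (\<integral>\<^sup>+y\<in>-\<Sigma>. ennreal ((cmod (ft f y))\<^sup>2) \<partial>lborel)"
    unfolding w_def by (simp add: nn_integral_add nn_integral_cmult nn_integral_cmult_indicator)
  also have "\<dots> \<le> ennreal (1 / \<sigma>) * ennreal \<sigma> + ennreal (1 / D) * ennreal D"
    by (intro add_mono mult_left_mono \<sigma> D) auto
  also have "\<dots> = 2" using \<sigma> D by (simp flip: ennreal_mult)
  finally have "(\<integral>\<^sup>+x. w x \<partial>lborel) \<le> 2" .
  from good_dilation[OF wm c(1) this] obtain u where u: "1 \<le> u" "u \<le> 2"
    and N: "\<And>N. finite N \<Longrightarrow> 0 \<notin> N \<Longrightarrow> (\<Sum>m\<in>N. w (c * u * of_int m)) \<le> ennreal (7 / \<bar>c\<bar>)"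
    by blast
  have N: "(\<Sum>m\<in>N. w (c * u * of_int m)) \<le> ennreal (10 * s)" if "finite N" "0 \<notin> N" for N
    using N[OF that] c(2) by (meson ennreal_leI order_trans)
  \<comment> \<open>Since u \<le> 2, the compressed support has measure at most v s = u / 8 \<le>
    1/4, as the periodization requires.\<close>
  define v where "v = u / (8 * s)"
  have v: "0 < v" using u s by (simp add: v_def)
  have vs: "v * s \<le> 1 / 4" using u s by (simp add: v_def)
  define g where "g x = f (0 + 1 / v * x)" for x
  have g: "bdd_bounded_supp g" unfolding g_def[abs_def] using v by (intro bdd_bounded_supp_affine f) simp
  have [measurable]: "g \<in> borel_measurable borel"
    using g by (auto simp: bdd_bounded_supp_def bdd_borel_def)
  have gS: "emeasure lborel {x. g x \<noteq> 0} \<le> 1 / 4"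
  proof -
    have "(\<integral>\<^sup>+x. indicator {x. f x \<noteq> 0} x \<partial>lborel) = ennreal \<bar>1 / v\<bar> * (\<integral>\<^sup>+x. indicator {x. f x \<noteq> 0} (0 + 1 / v * x) \<partial>lborel)"
      using v by (intro nn_integral_real_affine) auto
    also have "(\<lambda>x. indicator {x. f x \<noteq> 0} (0 + 1 / v * x)) = (indicator {x. g x \<noteq> 0} :: real \<Rightarrow> ennreal)"
      by (auto simp: g_def indicator_def)
    finally have "emeasure lborel {x. f x \<noteq> 0} = ennreal (1 / v) * emeasure lborel {x. g x \<noteq> 0}"
      using v by simp
    then have "ennreal v * emeasure lborel {x. f x \<noteq> 0} = ennreal v * ennreal (1 / v) * emeasure lborel {x. g x \<noteq> 0}"
      by (simp add: mult.assoc)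
    also have "ennreal v * ennreal (1 / v) = 1"
      using v by (simp flip: ennreal_mult)
    finally have Eg: "emeasure lborel {x. g x \<noteq> 0} = ennreal v * emeasure lborel {x. f x \<noteq> 0}"
      by simp
    have "emeasure lborel {x. g x \<noteq> 0} \<le> ennreal v * ennreal s"
      unfolding Eg using s(2) by (rule mult_left_mono) simp
    also have "\<dots> = ennreal (v * s)" using v s by (simp add: ennreal_mult)
    also have "\<dots> \<le> ennreal (1 / 4)" by (rule ennreal_leI[OF vs])
    also have "\<dots> = 1 / 4" by (simp add: ennreal_divide_numeral[symmetric])
    finally show ?thesis .
  qed
  have norm_g: "(cmod (ft g (- 2 * pi * of_int m)))\<^sup>2 = v\<^sup>2 * (cmod (ft f (c * u * of_int m)))\<^sup>2" for m
  proof -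
    have "ft f (c * u * of_int m) = complex_of_real \<bar>1 / v\<bar> * cis (c * u * of_int m * 0) * ft g (c * u * of_int m * (1 / v))"
      unfolding g_def[abs_def] using v by (intro ft_affine f) simp
    also have "c * u * of_int m * (1 / v) = - 2 * pi * of_int m"
      using s u by (simp add: c_def v_def field_simps)
    finally have "ft f (c * u * of_int m) = complex_of_real (1 / v) * ft g (- 2 * pi * of_int m)" using v by simp
    then have "cmod (ft g (- 2 * pi * of_int m)) = v * cmod (ft f (c * u * of_int m))"
      using v by (simp add: norm_mult norm_divide)
    then show ?thesis by (simp only: power_mult_distrib)
  qed
  define M0 where "M0 = {m::int. m \<noteq> 0 \<and> c * u * of_int m \<in> \<Sigma>}"
  have "finite M0 \<and> card M0 \<le> nat \<lfloor>10 * (s * \<sigma>)\<rfloor>"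
  \<comment> \<open>Every sample point in \<open>\<Sigma>\<close> costs 1 / \<sigma> out of a budget
    of 10 s. The bound holds for all finite subsets, which also yields finiteness.\<close>
  proof (rule finite_if_finite_subsets_card_bdd)
    fix G assume G: "G \<subseteq> M0" "finite G"
    have "ennreal (card G / \<sigma>) = (\<Sum>m\<in>G. ennreal (1 / \<sigma>))"
      using \<sigma> by (simp add: ennreal_of_nat_eq_real_of_nat flip: ennreal_mult)
    also have "\<dots> \<le> (\<Sum>m\<in>G. w (c * u * of_int m))"
      using G by (intro sum_mono) (auto simp: M0_def w_def)
    also have "\<dots> \<le> ennreal (10 * s)" using G by (intro N) (auto simp: M0_def)
    finally have "card G / \<sigma> \<le> 10 * s" using s by (simp add: ennreal_le_iff)
    then have "card G \<le> 10 * (s * \<sigma>)" using \<sigma> by (simp add: field_simps)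
    then show "card G \<le> nat \<lfloor>10 * (s * \<sigma>)\<rfloor>" by (simp add: le_nat_floor)
  qed
  then have M0: "finite M0" "card M0 \<le> nat \<lfloor>10 * (s * \<sigma>)\<rfloor>" by auto
  have "real (card M0) \<le> 10 * (s * \<sigma>)"
  proof -
    have "0 \<le> 10 * (s * \<sigma>)" using s(1) \<sigma>(1) by simp
    from of_nat_floor[OF this] show ?thesis using M0(2) by linarith
  qed
  moreover have "card (insert 0 M0) \<le> Suc (card M0)" by (rule card_insert_le_m1) auto
  ultimately have cardM: "real (card (insert 0 M0)) \<le> 1 + 10 * (s * \<sigma>)" by linarith
  have "(cmod (ft g 0))\<^sup>2 \<le> 2 * exp (80 * card (insert 0 M0)) * (v\<^sup>2 * (10 * s * D))"
  proof (rule ft_0_le_periodic[OF g gS])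
    fix N assume N': "finite N" "N \<inter> insert 0 M0 = {}"
    have "ennreal ((\<Sum>m\<in>N. (cmod (ft f (c * u * of_int m)))\<^sup>2) / D) = (\<Sum>m\<in>N. ennreal (1 / D) * ennreal ((cmod (ft f (c * u * of_int m)))\<^sup>2))"
      using D by (simp add: sum_divide_distrib flip: ennreal_mult)
    also have "\<dots> \<le> (\<Sum>m\<in>N. w (c * u * of_int m))"
    proof (rule sum_mono)
      fix m assume "m \<in> N"
      then have "c * u * of_int m \<notin> \<Sigma>" using N' by (auto simp: M0_def)
      then show "ennreal (1 / D) * ennreal ((cmod (ft f (c * u * of_int m)))\<^sup>2) \<le> w (c * u * of_int m)"
        by (simp add: w_def)
    qed
    also have "\<dots> \<le> ennreal (10 * s)" using N' by (intro N) auto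
    finally have "(\<Sum>m\<in>N. (cmod (ft f (c * u * of_int m)))\<^sup>2) / D \<le> 10 * s" using s by (simp add: ennreal_le_iff)
    then have "(\<Sum>m\<in>N. (cmod (ft f (c * u * of_int m)))\<^sup>2) \<le> 10 * s * D" using D by (simp add: field_simps)
    then show "(\<Sum>m\<in>N. (cmod (ft g (- 2 * pi * of_int m)))\<^sup>2) \<le> v\<^sup>2 * (10 * s * D)"
      unfolding norm_g sum_distrib_left[symmetric] by (rule mult_left_mono) simp
  qed (use M0 in auto)
  also have "\<dots> \<le> 2 * exp (80 + 800 * (s * \<sigma>)) * (v\<^sup>2 * (10 * s * D))"
    using cardM s D by (intro mult_right_mono mult_left_mono) auto
  finally have "v\<^sup>2 * (cmod (ft f 0))\<^sup>2 \<le> v\<^sup>2 * (20 * s * exp (80 + 800 * (s * \<sigma>)) * D)"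
    using norm_g[of 0] by (simp add: mult_ac)
  then show ?thesis using v by simp
qed

text \<open>Modulating \<open>f\<close> by \<xi> keeps its support and translates its transform.
  With \<open>\<Sigma>\<close> translated accordingly, the estimate at 0 becomes one at every \<xi>
  with the same constants, and integration over \<open>\<Sigma>\<close> contributes the factor
  \<sigma>.\<close>

lemma nazarov:
  assumes f: "bdd_bounded_supp f" and s: "0 < s" "emeasure lborel {x. f x \<noteq> 0} \<le> ennreal s"
    and \<Sigma> [measurable]: "\<Sigma> \<in> sets borel" and \<sigma>: "0 < \<sigma>" "emeasure lborel \<Sigma> \<le> ennreal \<sigma>"
    and D: "0 < D" "(\<integral>\<^sup>+y\<in>-\<Sigma>. ennreal ((cmod (ft f y))\<^sup>2) \<partial>lborel) \<le> ennreal D"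
  shows "(\<integral>\<^sup>+y\<in>\<Sigma>. ennreal ((cmod (ft f y))\<^sup>2) \<partial>lborel) \<le> ennreal (20 * (s * \<sigma>) * exp (80 + 800 * (s * \<sigma>)) * D)"
proof -
  have [measurable]: "f \<in> borel_measurable borel"
    using f by (auto simp: bdd_bounded_supp_def bdd_borel_def)
  have pt: "(cmod (ft f \<xi>))\<^sup>2 \<le> 20 * s * exp (80 + 800 * (s * \<sigma>)) * D" for \<xi>
  proof -
    define h where "h x = f x * cis (\<xi> * x)" for x
    have h: "bdd_bounded_supp h" unfolding h_def[abs_def] by (intro bdd_bounded_supp_mult f bdd_borel_cis)
    have [measurable]: "h \<in> borel_measurable borel"
      using h by (auto simp: bdd_bounded_supp_def bdd_borel_def)
    have fth: "ft h y = ft f (\<xi> + y)" for y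
      unfolding ft_def h_def by (simp add: mult.assoc cis_mult distrib_right)
    define T where "T = {y. \<xi> + y \<in> \<Sigma>}"
    have T [measurable]: "T \<in> sets borel" unfolding T_def by measurable
    have aff: "(\<integral>\<^sup>+y. F y \<partial>lborel) = (\<integral>\<^sup>+y. F (\<xi> + y) \<partial>lborel)" if "F \<in> borel_measurable borel" for F :: "real \<Rightarrow> ennreal"
      using nn_integral_real_affine[OF that, of 1 \<xi>] by simp
    have "emeasure lborel T = (\<integral>\<^sup>+y. indicator T y \<partial>lborel)"
      by (rule nn_integral_indicator[symmetric]) measurable
    also have "indicator T = (\<lambda>y. indicator \<Sigma> (\<xi> + y) :: ennreal)"
      by (auto simp: T_def indicator_def)
    also have "(\<integral>\<^sup>+y. indicator \<Sigma> (\<xi> + y) \<partial>lborel) = emeasure lborel \<Sigma>"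
      by (subst aff[symmetric]) auto
    finally have T\<sigma>: "emeasure lborel T \<le> ennreal \<sigma>" using \<sigma> by simp
    have "(\<integral>\<^sup>+y\<in>-T. ennreal ((cmod (ft h y))\<^sup>2) \<partial>lborel) = (\<integral>\<^sup>+y\<in>-\<Sigma>. ennreal ((cmod (ft f y))\<^sup>2) \<partial>lborel)"
      by (subst (2) aff) (auto simp: T_def indicator_def fth intro!: nn_integral_cong)
    then have TD: "(\<integral>\<^sup>+y\<in>-T. ennreal ((cmod (ft h y))\<^sup>2) \<partial>lborel) \<le> ennreal D" using D by simp
    have hs: "emeasure lborel {x. h x \<noteq> 0} \<le> ennreal s" using s by (simp add: h_def)
    from ft_0_le[OF h s(1) hs T \<sigma>(1) T\<sigma> D(1) TD] show ?thesis by (simp add: fth)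
  qed
  have "(\<integral>\<^sup>+y\<in>\<Sigma>. ennreal ((cmod (ft f y))\<^sup>2) \<partial>lborel) \<le> (\<integral>\<^sup>+y\<in>\<Sigma>. ennreal (20 * s * exp (80 + 800 * (s * \<sigma>)) * D) \<partial>lborel)"
    using pt by (intro nn_integral_mono mult_right_mono ennreal_leI) auto
  also have "\<dots> = ennreal (20 * s * exp (80 + 800 * (s * \<sigma>)) * D) * emeasure lborel \<Sigma>"
    by (rule nn_integral_cmult_indicator) measurable
  also have "\<dots> \<le> ennreal (20 * s * exp (80 + 800 * (s * \<sigma>)) * D) * ennreal \<sigma>"
    by (intro mult_left_mono \<sigma>) simp
  also have "\<dots> = ennreal (20 * s * exp (80 + 800 * (s * \<sigma>)) * D * \<sigma>)"
    using s \<sigma> D by (intro ennreal_mult[symmetric]) auto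
  finally show ?thesis by (simp add: mult_ac)
qed



text \<open>Write a and d for the energies of the transform on \<open>E\<close> and off it. Then a
  \<le> K d by the uncertainty inequality and a + d \<le> I by Plancherel; eliminating d gives a
  \<le> K / (1 + K) I.\<close>

lemma nazarov_fraction:
  assumes f: "bdd_bounded_supp f" and E [measurable]: "E \<in> sets borel" and s: "0 < s" "emeasure lborel E \<le> ennreal s"
    and supp: "\<And>x. f x \<noteq> 0 \<Longrightarrow> x \<in> E"
  defines "K \<equiv> 20 * s\<^sup>2 * exp (80 + 800 * s\<^sup>2)"
  shows "(\<integral>\<^sup>+y\<in>E. ennreal ((cmod (ft f y))\<^sup>2) \<partial>lborel) \<le> ennreal (K / (1 + K) * (2 * pi * (LINT x|lborel. (cmod (f x))\<^sup>2)))"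
proof -
  have [measurable]: "f \<in> borel_measurable borel"
    using f by (auto simp: bdd_bounded_supp_def bdd_borel_def)
  define I where "I = 2 * pi * (LINT x|lborel. (cmod (f x))\<^sup>2)"
  have I0: "0 \<le> I" by (simp add: I_def)
  have K: "0 \<le> K" by (simp add: K_def)
  let ?w = "\<lambda>y. ennreal ((cmod (ft f y))\<^sup>2)"
  have "(\<integral>\<^sup>+y\<in>E. ?w y \<partial>lborel) + (\<integral>\<^sup>+y\<in>-E. ?w y \<partial>lborel) = (\<integral>\<^sup>+y. ?w y \<partial>lborel)"
    by (subst nn_integral_add[symmetric]) (auto intro!: nn_integral_cong simp: indicator_def)
  then have sum: "(\<integral>\<^sup>+y\<in>E. ?w y \<partial>lborel) + (\<integral>\<^sup>+y\<in>-E. ?w y \<partial>lborel) \<le> ennreal I"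
    using plancherel_le[OF f] by (simp add: I_def)
  have "(\<integral>\<^sup>+y\<in>E. ?w y \<partial>lborel) \<le> ennreal I"
    by (rule order_trans[OF add_increasing2[OF zero_le order_refl] sum])
  then obtain a where a: "0 \<le> a" "(\<integral>\<^sup>+y\<in>E. ?w y \<partial>lborel) = ennreal a"
    unfolding le_ennreal_iff[OF I0] by blast
  have "(\<integral>\<^sup>+y\<in>-E. ?w y \<partial>lborel) \<le> ennreal I"
    by (rule order_trans[OF add_increasing[OF zero_le order_refl] sum])
  then obtain d where d: "0 \<le> d" "(\<integral>\<^sup>+y\<in>-E. ?w y \<partial>lborel) = ennreal d"
    unfolding le_ennreal_iff[OF I0] by blast
  have ad: "a + d \<le> I" using sum a d I0 by (simp flip: ennreal_plus)
  have "emeasure lborel {x. f x \<noteq> 0} \<le> emeasure lborel E"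
    using supp by (intro emeasure_mono) auto
  then have S: "emeasure lborel {x. f x \<noteq> 0} \<le> ennreal s" using s(2) by (rule order_trans)
  \<comment> \<open>The uncertainty inequality is stated for a positive energy bound, and
    \<open>d\<close> may be 0; hence \<open>d\<close> is enlarged by \<delta>, chosen so that K
    \<delta> \<le> \<epsilon>.\<close>
  have "a \<le> K * d + \<epsilon>" if \<epsilon>: "0 < \<epsilon>" for \<epsilon>
  proof -
    define \<delta> where "\<delta> = \<epsilon> / (K + 1)"
    have \<delta>: "0 < \<delta>" "K * \<delta> \<le> \<epsilon>" using \<epsilon> K by (auto simp: \<delta>_def field_simps)
    have "(\<integral>\<^sup>+y\<in>E. ?w y \<partial>lborel) \<le> ennreal (20 * (s * s) * exp (80 + 800 * (s * s)) * (d + \<delta>))"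
      using d \<delta> by (intro nazarov[OF f s(1) S E s]) (auto intro!: ennreal_leI)
    then have "a \<le> K * (d + \<delta>)"
      using a d \<delta> K by (simp add: K_def power2_eq_square)
    then show ?thesis using \<delta>(2) by (simp add: distrib_left)
  qed
  then have "a \<le> K * d" by (rule field_le_epsilon)
  also have "\<dots> \<le> K * (I - a)" using ad K by (intro mult_left_mono) auto
  finally have "a \<le> K / (1 + K) * I" using K by (simp add: field_simps)
  then show ?thesis unfolding a(2) I_def by (rule ennreal_leI)
qed

text \<open>As K / (1 + K) = 1 - 1 / (1 + K), the claim is 1 + K \<le> A exp (A s^2). The factor s^2
  is absorbed by exp (s^2), turning 800 into 801; the constants 1 and 20 add up to 21, and A exceeds
  801.\<close>

lemma fraction_le:
  fixes s :: real
  assumes s: "0 < s"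
  defines "K \<equiv> 20 * s\<^sup>2 * exp (80 + 800 * s\<^sup>2)" and "A \<equiv> 21 * exp 80"
  shows "K / (1 + K) \<le> 1 - inverse A * exp (- A * s\<^sup>2)"
proof -
  have A: "801 \<le> A" using exp_ge_add_one_self[of 80] by (simp add: A_def)
  have e: "exp (80 + 800 * s\<^sup>2) * s\<^sup>2 \<le> exp (80 + 800 * s\<^sup>2) * exp (s\<^sup>2)"
  proof (rule mult_left_mono)
    show "s\<^sup>2 \<le> exp (s\<^sup>2)" using exp_ge_add_one_self[of "s\<^sup>2"] by linarith
  qed simp
  have "1 + K \<le> exp (80 + 801 * s\<^sup>2) + 20 * exp (80 + 801 * s\<^sup>2)"
    using e by (intro add_mono) (auto simp: K_def exp_add[symmetric] algebra_simps)
  also have "\<dots> = A * exp (801 * s\<^sup>2)" by (simp add: A_def exp_add)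
  also have "\<dots> \<le> A * exp (A * s\<^sup>2)"
    using A by (intro mult_left_mono) (auto intro!: mult_right_mono)
  finally have "1 + K \<le> A * exp (A * s\<^sup>2)" .
  moreover have K: "0 \<le> K" by (simp add: K_def)
  ultimately have "1 / (A * exp (A * s\<^sup>2)) \<le> 1 / (1 + K)"
    by (intro divide_left_mono) (use A in auto)
  moreover have "1 / (A * exp (A * s\<^sup>2)) = inverse A * exp (- A * s\<^sup>2)"
    by (simp add: exp_minus divide_inverse)
  moreover have "K / (1 + K) = 1 - 1 / (1 + K)" using K by (simp add: field_simps)
  ultimately show ?thesis by linarith
qed

text \<open>Truncation in height and range keeps the support in \<open>E\<close> and does not
  increase the energy. Integrability of \<open>f\<close> gives pointwise convergence of the
  transforms by dominated convergence, and Fatou's lemma preserves the bound.\<close>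

lemma nazarov_fraction_L2:
  assumes f [measurable]: "f \<in> borel_measurable borel" and f1: "integrable lborel f"
    and f2: "integrable lborel (\<lambda>x. (cmod (f x))\<^sup>2)"
    and E [measurable]: "E \<in> sets borel" and s: "0 < s" "emeasure lborel E \<le> ennreal s"
    and supp: "\<And>x. f x \<noteq> 0 \<Longrightarrow> x \<in> E"
  defines "A \<equiv> 21 * exp 80 :: real"
  shows "(\<integral>\<^sup>+y\<in>E. ennreal ((cmod (ft f y))\<^sup>2) \<partial>lborel)
    \<le> ennreal ((1 - inverse A * exp (- A * s\<^sup>2)) * (2 * pi * (LINT x|lborel. (cmod (f x))\<^sup>2)))"
proof -
  let ?K = "20 * s\<^sup>2 * exp (80 + 800 * s\<^sup>2)"
  let ?J = "LINT x|lborel. (cmod (f x))\<^sup>2"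
  define F where "F n x = (if cmod (f x) \<le> real n \<and> \<bar>x\<bar> \<le> real n then f x else 0)" for n x
  have Fm [measurable]: "F n \<in> borel_measurable borel" for n unfolding F_def[abs_def] by measurable
  have F_bbs: "bdd_bounded_supp (F n)" for n
    unfolding bdd_bounded_supp_def
  proof
    show "bdd_borel (F n)" by (rule bdd_borelI[OF Fm, of _ "real n"]) (simp add: F_def)
    show "\<exists>L. \<forall>x. F n x \<noteq> 0 \<longrightarrow> \<bar>x\<bar> \<le> L" by (rule exI[of _ "real n"]) (simp add: F_def)
  qed
  have F_le: "cmod (F n x) \<le> cmod (f x)" for n x by (simp add: F_def)
  have F_lim: "(\<lambda>n. F n x) \<longlonglongrightarrow> f x" for x
  proof -
    obtain k :: nat where "max (cmod (f x)) \<bar>x\<bar> \<le> k" using real_arch_simple by blast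
    then have "\<forall>n\<ge>k. f x = F n x" by (auto simp: F_def)
    then have "\<forall>\<^sub>F n in sequentially. f x = F n x" unfolding eventually_sequentially by blast
    then show ?thesis by (rule Lim_transform_eventually[OF tendsto_const])
  qed
  have ft_lim: "(\<lambda>n. ft (F n) y) \<longlonglongrightarrow> ft f y" for y
    unfolding ft_def
  proof (rule integral_dominated_convergence[where w = "\<lambda>x. cmod (f x)"])
    have cm [measurable]: "(\<lambda>x. cis (y * x)) \<in> borel_measurable borel" by (rule measurable_cis_mult)
    show "(\<lambda>x. f x * cis (y * x)) \<in> borel_measurable lborel" by measurable
    show "(\<lambda>x. F n x * cis (y * x)) \<in> borel_measurable lborel" for n by measurable
    show "integrable lborel (\<lambda>x. cmod (f x))" using f1 by (rule integrable_norm)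
    show "AE x in lborel. (\<lambda>n. F n x * cis (y * x)) \<longlonglongrightarrow> f x * cis (y * x)"
      by (intro AE_I2 tendsto_mult F_lim tendsto_const)
    show "AE x in lborel. cmod (F n x * cis (y * x)) \<le> cmod (f x)" for n
      by (intro AE_I2) (simp add: norm_mult F_le)
  qed
  have part: "(\<integral>\<^sup>+y\<in>E. ennreal ((cmod (ft (F n) y))\<^sup>2) \<partial>lborel)
      \<le> ennreal ((1 - inverse A * exp (- A * s\<^sup>2)) * (2 * pi * ?J))" for n
  proof -
    have "(LINT x|lborel. (cmod (F n x))\<^sup>2) \<le> ?J"
    proof (rule integral_mono[OF Bochner_Integration.integrable_bound[OF f2]])
      show "AE x in lborel. norm ((cmod (F n x))\<^sup>2) \<le> norm ((cmod (f x))\<^sup>2)"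
        by (intro AE_I2) (simp add: F_le power_mono)
    qed (auto simp: F_le power_mono f2)
    moreover have "0 \<le> ?K / (1 + ?K)" by (intro divide_nonneg_nonneg add_nonneg_nonneg) auto
    moreover have "0 \<le> (LINT x|lborel. (cmod (F n x))\<^sup>2)" by simp
    moreover have "?K / (1 + ?K) \<le> 1 - inverse A * exp (- A * s\<^sup>2)"
      unfolding A_def by (rule fraction_le[OF s(1)])
    moreover from calculation have "0 \<le> 1 - inverse A * exp (- A * s\<^sup>2)"
      by (meson order_trans)
    ultimately have "?K / (1 + ?K) * (2 * pi * (LINT x|lborel. (cmod (F n x))\<^sup>2)) \<le> (1 - inverse A * exp (- A * s\<^sup>2)) * (2 * pi * ?J)"
      by (intro mult_mono[of _ _ "2 * pi * _"] mult_left_mono mult_nonneg_nonneg) simp_all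
    then show ?thesis
      by (intro order_trans[OF nazarov_fraction[OF F_bbs E s] ennreal_leI])
        (auto simp: F_def supp split: if_splits)
  qed
  have "(\<integral>\<^sup>+y\<in>E. ennreal ((cmod (ft f y))\<^sup>2) \<partial>lborel)
    = (\<integral>\<^sup>+y. liminf (\<lambda>n. ennreal ((cmod (ft (F n) y))\<^sup>2) * indicator E y) \<partial>lborel)"
  proof (rule nn_integral_cong)
    fix y
    have "(\<lambda>n. ennreal ((cmod (ft (F n) y))\<^sup>2) * indicator E y) \<longlonglongrightarrow> ennreal ((cmod (ft f y))\<^sup>2) * indicator E y"
      by (cases "y \<in> E") (auto intro!: tendsto_ennrealI tendsto_intros ft_lim)
    then show "ennreal ((cmod (ft f y))\<^sup>2) * indicator E y = liminf (\<lambda>n. ennreal ((cmod (ft (F n) y))\<^sup>2) * indicator E y)"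
      by (simp add: lim_imp_Liminf)
  qed
  also have "\<dots> \<le> liminf (\<lambda>n. \<integral>\<^sup>+y\<in>E. ennreal ((cmod (ft (F n) y))\<^sup>2) \<partial>lborel)"
    by (rule nn_integral_liminf) measurable
  also have "\<dots> \<le> ennreal ((1 - inverse A * exp (- A * s\<^sup>2)) * (2 * pi * ?J))"
    by (intro Liminf_le always_eventually allI part) simp
  finally show ?thesis .
qed

subsection \<open>Passage to Lebesgue measurable data\<close>


lemma completion_ex_borel_measurable_complex:
  fixes g :: "'a \<Rightarrow> complex"
  assumes g: "g \<in> borel_measurable (completion M)"
  shows "\<exists>g'\<in>borel_measurable M. AE x in M. g x = g' x"
proof -
  have "(\<lambda>x. Re (g x)) \<in> borel_measurable (completion M)" "(\<lambda>x. Im (g x)) \<in> borel_measurable (completion M)"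
    using g by (auto intro: borel_measurable_Re borel_measurable_Im measurable_compose)
  then obtain u v where u: "u \<in> borel_measurable M" "AE x in M. Re (g x) = u x"
    and v: "v \<in> borel_measurable M" "AE x in M. Im (g x) = v x"
    by (metis completion_ex_borel_measurable_real)
  have "AE x in M. g x = Complex (u x) (v x)"
    using u(2) v(2) by eventually_elim (simp add: complex_eq_iff)
  moreover have "(\<lambda>x. Complex (u x) (v x)) \<in> borel_measurable M"
    unfolding Complex_eq using u(1) v(1) by measurable
  ultimately show ?thesis by (intro bexI[of _ "\<lambda>x. Complex (u x) (v x)"])
qed

lemma completion_ex_borel_set:
  assumes "E \<in> sets (completion M)"
  obtains S where "S \<in> sets M" "AE x in M. x \<in> E \<longleftrightarrow> x \<in> S"
proof -
  have "(indicator E :: _ \<Rightarrow> real) \<in> borel_measurable (completion M)"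
    using assms by simp
  then obtain g' where g': "g' \<in> borel_measurable M" "AE x in M. indicator E x = (g' x :: real)"
    by (metis completion_ex_borel_measurable_real)
  define S where "S = {x \<in> space M. g' x = 1}"
  have "S \<in> sets M" using g'(1) unfolding S_def by measurable
  moreover have "AE x in M. x \<in> E \<longleftrightarrow> x \<in> S"
    using g'(2) AE_space by eventually_elim (auto simp: S_def indicator_def split: if_splits)
  ultimately show thesis by (rule that)
qed

lemma L2_norm_sq: "(L2_norm E x)\<^sup>2 = (LINT t:E|lebesgue. (cmod (x t))\<^sup>2)"
  unfolding L2_norm_def by (simp add: set_lebesgue_integral_def)

text \<open>The set and the function are replaced by Borel versions that agree almost everywhere,
  which changes neither the norms nor the transform. The normalising factor 1 / sqrt (2 pi) squared
  cancels the 2 pi of Plancherel's inequality.\<close>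

lemma truncated_fourier_bound:
  fixes E :: "real set"
  assumes E: "E \<in> sets lebesgue" "emeasure lebesgue E < \<infinity>" and x: "x \<in> L2 E"
  shows "(L2_norm E (truncated_fourier E x))\<^sup>2
    \<le> (1 - inverse (21 * exp 80) * exp (- (21 * exp 80) * (measure lebesgue E)\<^sup>2)) * (L2_norm E x)\<^sup>2"
\<comment> \<open>For a null set both norms are 0; otherwise s > 0, as the estimate demands.\<close>
proof (cases "measure lebesgue E = 0")
  case True
  then have "emeasure lebesgue E = 0" using E(2) by (simp add: measure_eq_emeasure_eq_ennreal emeasure_eq_ennreal_measure less_top)
  then have "AE t in lebesgue. t \<notin> E" using E(1) by (intro AE_not_in) (auto simp: null_sets_def)
  then have "(LINT t:E|lebesgue. (cmod (y t))\<^sup>2) = 0" for y :: "real \<Rightarrow> complex"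
    unfolding set_lebesgue_integral_def by (intro integral_eq_zero_AE) (auto elim: AE_mp)
  then show ?thesis by (simp add: L2_norm_sq)
next
  case False
  define s where "s = measure lebesgue E"
  have s: "0 < s" using False by (simp add: s_def zero_less_measure_iff)
  have Es: "emeasure lebesgue E = ennreal s"
    using E(2) unfolding s_def by (intro emeasure_eq_ennreal_measure) auto
  obtain S where S [measurable]: "S \<in> sets borel" and ES: "AE t in lborel. t \<in> E \<longleftrightarrow> t \<in> S"
    using completion_ex_borel_set[of E lborel] E(1) by auto
  have ES': "AE t in lebesgue. t \<in> E \<longleftrightarrow> t \<in> S" using ES by (rule AE_completion)
  have "emeasure lebesgue E = emeasure lebesgue S"
    using ES' E(1) S by (intro emeasure_eq_AE) auto
  also have "\<dots> = emeasure lborel S" using S by (simp add: emeasure_completion)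
  finally have Ss: "emeasure lborel S \<le> ennreal s" using Es by simp
  have "(\<lambda>t. indicator E t *\<^sub>R x t) \<in> borel_measurable lebesgue"
    using x by (simp add: L2_def set_borel_measurable_def)
  then obtain f0 where f0 [measurable]: "f0 \<in> borel_measurable lborel"
    and xf0: "AE t in lborel. indicator E t *\<^sub>R x t = f0 t"
    by (metis completion_ex_borel_measurable_complex)
  \<comment> \<open>The function is set to 0 off \<open>S\<close>, because the support condition is
    required at every point and not only almost everywhere.\<close>
  define f where "f t = (if t \<in> S then f0 t else 0)" for t
  have fm [measurable]: "f \<in> borel_measurable borel"
    using f0 S unfolding f_def[abs_def] by (intro measurable_If_set) auto
  have xf: "AE t in lborel. indicator E t *\<^sub>R x t = f t"
    using xf0 ES by eventually_elim (auto simp: f_def indicator_def split: if_splits)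
  have xf': "AE t in lebesgue. indicator E t *\<^sub>R x t = f t" using xf by (rule AE_completion)
  have f1: "integrable lborel f"
  proof -
    have "integrable lebesgue f"
      using L2_set_integrable[OF E x] xf' unfolding set_integrable_def
      by (subst integrable_cong_AE[symmetric]) (auto intro: borel_measurable_integrable measurable_completion)
    then show ?thesis by (simp add: integrable_completion)
  qed
  have sqf: "AE t in lebesgue. indicator E t *\<^sub>R (cmod (x t))\<^sup>2 = (cmod (f t))\<^sup>2"
    using xf' by eventually_elim (auto simp: indicator_def split: if_splits)
  have f2m: "(\<lambda>t. (cmod (f t))\<^sup>2) \<in> borel_measurable lebesgue"
    by (intro measurable_completion) measurable
  have x2: "set_integrable lebesgue E (\<lambda>t. (cmod (x t))\<^sup>2)" using x by (simp add: L2_def)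
  have f2: "integrable lborel (\<lambda>t. (cmod (f t))\<^sup>2)"
  proof -
    have "integrable lebesgue (\<lambda>t. (cmod (f t))\<^sup>2)"
      using x2 sqf f2m unfolding set_integrable_def
      by (subst integrable_cong_AE[symmetric]) (auto intro: borel_measurable_integrable)
    then show ?thesis by (simp add: integrable_completion)
  qed
  have norm_x: "(L2_norm E x)\<^sup>2 = (LINT t|lborel. (cmod (f t))\<^sup>2)"
  proof -
    have "(L2_norm E x)\<^sup>2 = (LINT t|lebesgue. (cmod (f t))\<^sup>2)"
      unfolding L2_norm_sq set_lebesgue_integral_def
      using x2 sqf f2m unfolding set_integrable_def
      by (intro integral_cong_AE) (auto intro: borel_measurable_integrable)
    also have "\<dots> = (LINT t|lborel. (cmod (f t))\<^sup>2)" by (rule integral_completion) measurable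
    finally show ?thesis .
  qed
  have tf: "truncated_fourier E x t = complex_of_real (1 / sqrt (2 * pi)) * ft f t" for t
  proof -
    have cm [measurable]: "(\<lambda>\<xi>. cis (t * \<xi>)) \<in> borel_measurable borel" by (rule measurable_cis_mult)
    have "(LINT \<xi>:E|lebesgue. exp (\<i> * complex_of_real (t * \<xi>)) * x \<xi>) = (LINT \<xi>|lebesgue. f \<xi> * cis (t * \<xi>))"
      unfolding set_lebesgue_integral_def
    proof (rule integral_cong_AE)
      show "(\<lambda>\<xi>. indicator E \<xi> *\<^sub>R (exp (\<i> * complex_of_real (t * \<xi>)) * x \<xi>)) \<in> borel_measurable lebesgue"
        using fourier_kernel_set_integrable[OF E x, of t] unfolding set_integrable_def
        by (rule borel_measurable_integrable)
      show "(\<lambda>\<xi>. f \<xi> * cis (t * \<xi>)) \<in> borel_measurable lebesgue"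
        by (intro measurable_completion) measurable
      show "AE \<xi> in lebesgue. indicator E \<xi> *\<^sub>R (exp (\<i> * complex_of_real (t * \<xi>)) * x \<xi>) = f \<xi> * cis (t * \<xi>)"
        using xf'
      proof eventually_elim
        case (elim \<xi>)
        have "indicator E \<xi> *\<^sub>R (exp (\<i> * complex_of_real (t * \<xi>)) * x \<xi>)
            = exp (\<i> * complex_of_real (t * \<xi>)) * (indicator E \<xi> *\<^sub>R x \<xi>)"
          by (rule mult_scaleR_right[symmetric])
        then show ?case unfolding elim cis_conv_exp by (simp only: mult.commute)
      qed
    qed
    also have "\<dots> = ft f t" unfolding ft_def by (rule integral_completion) measurable
    finally show ?thesis unfolding truncated_fourier_def by simp
  qed
  define \<delta> :: real where "\<delta> = inverse (21 * exp 80) * exp (- (21 * exp 80) * s\<^sup>2)"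
  \<comment> \<open>Nonnegativity of 1 - \<delta> is what allows the final inequality to pass from
    extended nonnegative reals back to the reals.\<close>
  have delta_le: "0 \<le> 1 - \<delta>"
  proof -
    have "inverse (21 * exp (80::real)) \<le> 1"
      using exp_ge_add_one_self[of "80::real"] by (intro inverse_le_1_iff[THEN iffD2] disjI2) linarith
    then have "\<delta> \<le> 1 * 1" unfolding \<delta>_def by (intro mult_mono) auto
    then show ?thesis by simp
  qed
  let ?y = "truncated_fourier E x"
  have yint: "set_integrable lebesgue E (\<lambda>t. (cmod (?y t))\<^sup>2)"
    using truncated_fourier_in_L2[OF E x] by (simp add: L2_def)
  have "ennreal ((L2_norm E ?y)\<^sup>2) = (\<integral>\<^sup>+t. ennreal (indicator E t *\<^sub>R (cmod (?y t))\<^sup>2) \<partial>lebesgue)"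
    unfolding L2_norm_sq set_lebesgue_integral_def using yint unfolding set_integrable_def
    by (intro nn_integral_eq_integral[symmetric]) auto
  also have "\<dots> = (\<integral>\<^sup>+t. ennreal (indicator E t *\<^sub>R (cmod (?y t))\<^sup>2) \<partial>lborel)"
    by (rule nn_integral_completion)
  also have "\<dots> = (\<integral>\<^sup>+t. ennreal (1 / (2 * pi)) * (ennreal ((cmod (ft f t))\<^sup>2) * indicator S t) \<partial>lborel)"
  proof (rule nn_integral_cong_AE)
    show "AE t in lborel. ennreal (indicator E t *\<^sub>R (cmod (?y t))\<^sup>2)
      = ennreal (1 / (2 * pi)) * (ennreal ((cmod (ft f t))\<^sup>2) * indicator S t)"
      using ES
    proof eventually_elim
      case (elim t)
      have "(cmod (?y t))\<^sup>2 = 1 / (2 * pi) * (cmod (ft f t))\<^sup>2"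
        by (simp add: tf norm_mult norm_divide power_mult_distrib power_divide)
      then have "ennreal ((cmod (?y t))\<^sup>2) = ennreal (1 / (2 * pi)) * ennreal ((cmod (ft f t))\<^sup>2)"
        by (simp only: ennreal_mult[symmetric]) (subst ennreal_mult[symmetric], simp_all)
      then show ?case using elim by (auto simp: indicator_def)
    qed
  qed
  also have "\<dots> = ennreal (1 / (2 * pi)) * (\<integral>\<^sup>+t\<in>S. ennreal ((cmod (ft f t))\<^sup>2) \<partial>lborel)"
    by (intro nn_integral_cmult) measurable
  also have "\<dots> \<le> ennreal (1 / (2 * pi)) * ennreal ((1 - \<delta>) * (2 * pi * (LINT t|lborel. (cmod (f t))\<^sup>2)))"
    unfolding \<delta>_def
    by (intro mult_left_mono nazarov_fraction_L2[OF fm f1 f2 S s Ss]) (auto simp: f_def split: if_splits)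
  also have "\<dots> = ennreal (1 / (2 * pi) * ((1 - \<delta>) * (2 * pi * (LINT t|lborel. (cmod (f t))\<^sup>2))))"
    using delta_le by (intro ennreal_mult[symmetric] mult_nonneg_nonneg) simp_all
  also have "1 / (2 * pi) * ((1 - \<delta>) * (2 * pi * (LINT t|lborel. (cmod (f t))\<^sup>2))) = (1 - \<delta>) * (L2_norm E x)\<^sup>2"
    unfolding norm_x by simp
  finally have "(L2_norm E ?y)\<^sup>2 \<le> (1 - \<delta>) * (L2_norm E x)\<^sup>2"
    using delta_le by (subst (asm) ennreal_le_iff) (simp_all add: mult_nonneg_nonneg)
  then show ?thesis unfolding \<delta>_def s_def .
qed

lemma L2_cnj: "x \<in> L2 E \<Longrightarrow> (\<lambda>t. cnj (x t)) \<in> L2 E"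
proof -
  assume x: "x \<in> L2 E"
  have "cnj \<in> borel_measurable borel"
    by (intro borel_measurable_continuous_onI continuous_intros)
  moreover have "(\<lambda>t. indicator E t *\<^sub>R x t) \<in> borel_measurable lebesgue"
    using x by (simp add: L2_def set_borel_measurable_def)
  ultimately have "(\<lambda>t. cnj (indicator E t *\<^sub>R x t)) \<in> borel_measurable lebesgue"
    by (rule measurable_compose[rotated])
  then show ?thesis using x by (simp add: L2_def set_borel_measurable_def)
qed

text \<open>Conjugation flips the sign of the exponent and preserves all moduli, so the bound for
  the adjoint follows with the same constant. The reflection t to - t also exchanges the two
  transforms, but it would move the set over which the norm is taken.\<close>

lemma truncated_fourier_adj_cnj:
  "truncated_fourier_adj E x t = cnj (truncated_fourier E (\<lambda>t. cnj (x t)) t)"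
proof -
  have "(LINT \<xi>:E|lebesgue. exp (- \<i> * complex_of_real (t * \<xi>)) * x \<xi>)
    = (LINT \<xi>|lebesgue. cnj (indicator E \<xi> *\<^sub>R (exp (\<i> * complex_of_real (t * \<xi>)) * cnj (x \<xi>))))"
    unfolding set_lebesgue_integral_def by (simp add: exp_cnj)
  also have "\<dots> = cnj (LINT \<xi>:E|lebesgue. exp (\<i> * complex_of_real (t * \<xi>)) * cnj (x \<xi>))"
    unfolding set_lebesgue_integral_def by (rule Bochner_Integration.integral_cnj)
  finally show ?thesis
    unfolding truncated_fourier_def truncated_fourier_adj_def by simp
qed

theorem theorem1p2:
  "\<exists>A::real. 1 \<le> A \<and>
     (\<forall>E::real set. E \<in> sets lebesgue \<and> emeasure lebesgue E < \<infinity> \<longrightarrow>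
       (\<forall>x\<in>L2 E.
          (L2_norm E (truncated_fourier E x))\<^sup>2
            \<le> (1 - inverse A * exp (- A * (measure lebesgue E)\<^sup>2)) * (L2_norm E x)\<^sup>2 \<and>
          (L2_norm E (truncated_fourier_adj E x))\<^sup>2
            \<le> (1 - inverse A * exp (- A * (measure lebesgue E)\<^sup>2)) * (L2_norm E x)\<^sup>2))"
proof (intro exI[of _ "21 * exp 80 :: real"] conjI allI impI ballI; (elim conjE)?)
  \<comment> \<open>The constant is the one found in \<open>fraction_le\<close>.\<close>
  show "1 \<le> 21 * exp (80::real)" using exp_ge_add_one_self[of "80::real"] by simp
  fix E :: "real set" and x
  assume E: "E \<in> sets lebesgue" "emeasure lebesgue E < \<infinity>" and x: "x \<in> L2 E"
  show "(L2_norm E (truncated_fourier E x))\<^sup>2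
    \<le> (1 - inverse (21 * exp 80) * exp (- (21 * exp 80) * (measure lebesgue E)\<^sup>2)) * (L2_norm E x)\<^sup>2"
    by (rule truncated_fourier_bound[OF E x])
  have "L2_norm E (truncated_fourier_adj E x) = L2_norm E (truncated_fourier E (\<lambda>t. cnj (x t)))"
    by (simp add: L2_norm_def truncated_fourier_adj_cnj)
  moreover have "L2_norm E (\<lambda>t. cnj (x t)) = L2_norm E x"
    by (simp add: L2_norm_def)
  ultimately show "(L2_norm E (truncated_fourier_adj E x))\<^sup>2
    \<le> (1 - inverse (21 * exp 80) * exp (- (21 * exp 80) * (measure lebesgue E)\<^sup>2)) * (L2_norm E x)\<^sup>2"
    using truncated_fourier_bound[OF E L2_cnj[OF x]] by simp
qed

end
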